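(* Let $n,k\ge 0$ be integers, $X=\{x_1,\dots,x_n\}$ and $Y=\{y_1,\dots,y_k\}$. The group $\mathcal{K}^{\mathrm{IA}}_{n,k}$ is generated by the finite set $$\{M_{x,[y,z]} \mid x\in X,\ y\in Y,\ z\in (X\cup Y)\setminus\{x,y\}\}\ \cup\ \{C_{y,z},\,C_{z,y} \mid y\in Y,\ z\in (X\cup Y)\setminus\{y\}\}.$$
   Context: $F_{n,k}$ is the free group on $X\cup Y=\{x_1,\dots,x_n,y_1,\dots,y_k\}$ and $F_n$ is the free group on $\{x_1,\dots,x_n\}$. Write $[\![z]\!]$ for the conjugacy class of $z\in F_{n,k}$. Define $$\mathcal{A}_{n,k}=\{f\in\mathrm{Aut}(F_{n,k}) \mid [\![f(y_i)]\!]=[\![y_i]\!] \text{ for } 1\le i\le k\}.$$ The map $F_{n,k}\to F_n$ whose kernel is the normal closure of $\{y_1,\dots,y_k\}$ (sending $x_i\mapsto x_i$) induces a homomorphism $\pi:\mathcal{A}_{n,k}\to\mathrm{Aut}(F_n)$; put $\mathcal{K}_{n,k}=\ker\pi$. Let $\mathrm{IA}_{n,k}$ be the kernel of the natural map $\mathrm{Aut}(F_{n,k})\to\mathrm{GL}_{n+k}(\mathbb{Z})$ given by the action on the abelianization of $F_{n,k}$, and put $\mathcal{K}^{\mathrm{IA}}_{n,k}=\mathcal{K}_{n,k}\cap\mathrm{IA}_{n,k}$. For distinct $z,z'\in X\cup Y$, $C_{z,z'}\in\mathrm{Aut}(F_{n,k})$ sends $z\mapsto z'z(z')^{-1}$ and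 fixes all other elements of $X\cup Y$. For $z\in X\cup Y$ and $v$ in the subgroup generated by $(X\cup Y)\setminus\{z\}$, $M_{z,v}\in\mathrm{Aut}(F_{n,k})$ sends $z\mapsto vz$ and fixes all other elements of $X\cup Y$. Commutators are $[a,b]=aba^{-1}b^{-1}$. *)

theory Defs
  imports "HOL-Algebra.Bij" "HOL-Algebra.Generated_Groups"
begin

section \<open>Free groups as groups of reduced words\<close>

text \<open>The letter \<open>(a, True)\<close> stands for the generator \<open>a\<close> and \<open>(a, False)\<close> for its inverse.\<close>

type_synonym 'a word = "('a \<times> bool) list"

definition inv_letter :: "'a \<times> bool \<Rightarrow> 'a \<times> bool"
  where "inv_letter p = (fst p, \<not> snd p)"

definition reduced :: "'a word \<Rightarrow> bool"
  where "reduced w = successively (\<lambda>p q. q \<noteq> inv_letter p) w"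

text \<open>Left multiplication of a reduced word by one letter; iterating it over the letters of
  a word \<open>u\<close> gives the reduced form of the concatenation.\<close>

definition push :: "'a \<times> bool \<Rightarrow> 'a word \<Rightarrow> 'a word"
  where "push p w =
    (case w of [] \<Rightarrow> [p] | q # w' \<Rightarrow> if q = inv_letter p then w' else p # w)"

definition free_group :: "'a set \<Rightarrow> 'a word monoid"
  where "free_group S =
    \<lparr>carrier = {w. reduced w \<and> fst ` set w \<subseteq> S},
     mult = (\<lambda>u v. foldr push u v),
     one = []\<rparr>"

definition gen :: "'a \<Rightarrow> 'a word"
  where "gen a = [(a, True)]"

text \<open>The homomorphism from a free group to \<open>G\<close> that sends each generator \<open>a\<close> to \<open>\<phi> a\<close>.\<close>

definition free_lift :: "('b, 'm) monoid_scheme \<Rightarrow> ('a \<Rightarrow> 'b) \<Rightarrow> 'a word \<Rightarrow> 'b"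
  where "free_lift G \<phi> w =
    foldr (\<lambda>p g. (if snd p then \<phi> (fst p) else inv\<^bsub>G\<^esub> (\<phi> (fst p))) \<otimes>\<^bsub>G\<^esub> g) w \<one>\<^bsub>G\<^esub>"

lemma inv_letter_inv_letter [simp]: "inv_letter (inv_letter p) = p"
  by (simp add: inv_letter_def)

lemma fst_inv_letter [simp]: "fst (inv_letter p) = fst p"
  by (simp add: inv_letter_def)

lemma reduced_Nil [simp]: "reduced []"
  by (simp add: reduced_def)

lemma reduced_tl: "reduced (p # w) \<Longrightarrow> reduced w"
  by (cases w) (auto simp: reduced_def)

lemma reduced_push: "reduced w \<Longrightarrow> reduced (push p w)"
  by (cases w) (auto simp: push_def reduced_def successively_Cons)

lemma reduced_foldr_push: "reduced w \<Longrightarrow> reduced (foldr push u w)"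
  by (induction u) (auto simp: reduced_push)

lemma set_push: "set (push p w) \<subseteq> insert p (set w)"
  by (cases w) (auto simp: push_def)

lemma set_foldr_push: "set (foldr push u w) \<subseteq> set u \<union> set w"
  by (induction u) (use set_push in fastforce)+

lemma push_push_inv: "reduced w \<Longrightarrow> push p (push (inv_letter p) w) = w"
  by (cases w) (auto simp: push_def reduced_def successively_Cons split: list.splits)

lemma push_reduced: "reduced (p # w) \<Longrightarrow> push p w = p # w"
  by (cases w) (auto simp: push_def reduced_def)

lemma foldr_push_Nil: "reduced u \<Longrightarrow> foldr push u [] = u"
proof (induction u)
  case (Cons p u)
  then show ?case using push_reduced[of p u] reduced_tl[of p u] by simp
qed simp

lemma foldr_push_push:
  assumes "reduced w"
  shows "foldr push (push p v) w = push p (foldr push v w)"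
proof (cases v)
  case (Cons q v')
  then show ?thesis
    using push_push_inv[of "foldr push v' w" p] reduced_foldr_push[OF assms]
    by (auto simp: push_def)
qed (simp add: push_def)

lemma foldr_push_assoc:
  "reduced w \<Longrightarrow> foldr push (foldr push u v) w = foldr push u (foldr push v w)"
  by (induction u) (auto simp: foldr_push_push)

lemma foldr_push_inverse:
  "reduced x \<Longrightarrow> foldr push (rev (map inv_letter u)) (foldr push u x) = x"
proof (induction u)
  case (Cons p u)
  then show ?case
    using push_push_inv[of "foldr push u x" "inv_letter p"] by (simp add: reduced_foldr_push)
qed simp

lemma reduced_rev_inv: "reduced u \<Longrightarrow> reduced (rev (map inv_letter u))"
  unfolding reduced_def successively_rev successively_map
  by (erule successively_mono) (auto simp: inv_letter_def)

lemma group_free_group: "group (free_group S)"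
proof (rule groupI)
  fix x y assume "x \<in> carrier (free_group S)" "y \<in> carrier (free_group S)"
  then show "x \<otimes>\<^bsub>free_group S\<^esub> y \<in> carrier (free_group S)"
    using set_foldr_push[of x y] by (fastforce simp: free_group_def reduced_foldr_push)
next
  fix x assume x: "x \<in> carrier (free_group S)"
  have "foldr push (rev (map inv_letter x)) x = []"
    using foldr_push_inverse[of "[]" x] x by (simp add: foldr_push_Nil free_group_def)
  moreover have "rev (map inv_letter x) \<in> carrier (free_group S)"
    using x by (auto simp: free_group_def reduced_rev_inv)
  ultimately show "\<exists>y\<in>carrier (free_group S). y \<otimes>\<^bsub>free_group S\<^esub> x = \<one>\<^bsub>free_group S\<^esub>"
    by (intro bexI[of _ "rev (map inv_letter x)"]) (auto simp: free_group_def)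
qed (auto simp: free_group_def foldr_push_assoc)

lemma gen_in_free_group: "a \<in> S \<Longrightarrow> gen a \<in> carrier (free_group S)"
  by (auto simp: free_group_def gen_def reduced_def)

lemma inv_gen:
  assumes "a \<in> S"
  shows "inv\<^bsub>free_group S\<^esub> (gen a) = [(a, False)]"
proof -
  interpret group "free_group S" by (rule group_free_group)
  have "[(a, False)] \<in> carrier (free_group S)" "[(a, False)] \<otimes>\<^bsub>free_group S\<^esub> gen a = \<one>\<^bsub>free_group S\<^esub>"
    using assms by (auto simp: free_group_def gen_def reduced_def push_def inv_letter_def)
  then show ?thesis using gen_in_free_group[OF assms] inv_equality by metis
qed

context group
begin

lemma free_lift_closed:
  assumes "\<phi> \<in> S \<rightarrow> carrier G" "fst ` set w \<subseteq> S"
  shows "free_lift G \<phi> w \<in> carrier G"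
  using assms(2) by (induction w) (use assms(1) in \<open>auto simp: free_lift_def\<close>)

lemma free_lift_Cons:
  "free_lift G \<phi> (p # w) =
    (if snd p then \<phi> (fst p) else inv (\<phi> (fst p))) \<otimes> free_lift G \<phi> w"
  by (simp add: free_lift_def)

lemma free_lift_push:
  assumes "\<phi> \<in> S \<rightarrow> carrier G" "fst p \<in> S" "fst ` set w \<subseteq> S"
  shows "free_lift G \<phi> (push p w) = free_lift G \<phi> (p # w)"
proof (cases w)
  case (Cons q w')
  have "\<phi> (fst p) \<in> carrier G" "free_lift G \<phi> w' \<in> carrier G"
    using assms Cons free_lift_closed[of \<phi> S w'] by auto
  then show ?thesis
    using Cons by (auto simp: push_def free_lift_Cons inv_letter_def m_assoc[symmetric])
qed (simp add: push_def)

lemma free_lift_hom: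
  assumes \<phi>: "\<phi> \<in> S \<rightarrow> carrier G"
  shows "free_lift G \<phi> \<in> hom (free_group S) G"
proof (rule homI)
  fix u v assume u: "u \<in> carrier (free_group S)" and v: "v \<in> carrier (free_group S)"
  have "fst ` set u \<subseteq> S \<Longrightarrow> free_lift G \<phi> (foldr push u v) = free_lift G \<phi> u \<otimes> free_lift G \<phi> v"
  proof (induction u)
    case Nil
    then show ?case
      using free_lift_closed[OF \<phi>, of v] v by (simp add: free_lift_def free_group_def)
  next
    case (Cons p u)
    have "fst ` set (foldr push u v) \<subseteq> S"
      using set_foldr_push[of u v] Cons.prems v by (fastforce simp: free_group_def)
    moreover have "\<phi> (fst p) \<in> carrier G" "free_lift G \<phi> u \<in> carrier G" "free_lift G \<phi> v \<in> carrier G"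
      using \<phi> Cons.prems v free_lift_closed[OF \<phi>] by (auto simp: free_group_def)
    ultimately show ?case
      using Cons free_lift_push[OF \<phi>] by (auto simp: free_lift_Cons m_assoc)
  qed
  then show "free_lift G \<phi> (u \<otimes>\<^bsub>free_group S\<^esub> v) = free_lift G \<phi> u \<otimes> free_lift G \<phi> v"
    using u by (simp add: free_group_def)
qed (use free_lift_closed[OF \<phi>] in \<open>simp add: free_group_def\<close>)

lemma free_lift_gen: "\<phi> a \<in> carrier G \<Longrightarrow> free_lift G \<phi> (gen a) = \<phi> a"
  by (simp add: free_lift_def gen_def)

lemma hom_free_group_eqI:
  assumes f: "f \<in> hom (free_group S) G" and g: "g \<in> hom (free_group S) G"
    and eq: "\<And>a. a \<in> S \<Longrightarrow> f (gen a) = g (gen a)"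
    and w: "w \<in> carrier (free_group S)"
  shows "f w = g w"
proof -
  interpret F: group "free_group S" by (rule group_free_group)
  interpret f: group_hom "free_group S" G f by unfold_locales (rule f)
  interpret g: group_hom "free_group S" G g by unfold_locales (rule g)
  have "reduced w \<Longrightarrow> fst ` set w \<subseteq> S \<Longrightarrow> f w = g w"
  proof (induction w)
    case Nil
    then show ?case using f.hom_one g.hom_one by (simp add: free_group_def)
  next
    case (Cons p w)
    have a: "fst p \<in> S" and w: "w \<in> carrier (free_group S)"
      using Cons.prems by (auto simp: free_group_def dest: reduced_tl)
    have "[p] = (if snd p then gen (fst p) else inv\<^bsub>free_group S\<^esub> (gen (fst p)))"
      using a inv_gen[OF a] by (cases p) (auto simp: gen_def)
    then have p: "[p] \<in> carrier (free_group S)" "f [p] = g [p]"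
      using a gen_in_free_group[OF a] eq[OF a] by auto
    have "p # w = [p] \<otimes>\<^bsub>free_group S\<^esub> w"
      using Cons.prems by (simp add: free_group_def push_reduced)
    moreover have "f w = g w"
      using Cons.IH Cons.prems reduced_tl[of p w] by simp
    ultimately show ?case
      using p w by simp
  qed
  then show ?thesis using w by (simp add: free_group_def)
qed

end


section \<open>Conjugacy classes, induced automorphisms\<close>

definition conj_class :: "('a, 'm) monoid_scheme \<Rightarrow> 'a \<Rightarrow> 'a set"
  where "conj_class G z = {g \<otimes>\<^bsub>G\<^esub> z \<otimes>\<^bsub>G\<^esub> inv\<^bsub>G\<^esub> g | g. g \<in> carrier G}"

lemma conj_class_subset:
  assumes "group G" "z \<in> carrier G"
  shows "conj_class G z \<subseteq> carrier G"
proof -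
  interpret group G by fact
  show ?thesis using assms(2) by (auto simp: conj_class_def)
qed

lemma conj_class_self:
  assumes "group G" "z \<in> carrier G"
  shows "z \<in> conj_class G z"
proof -
  interpret group G by fact
  show ?thesis
    unfolding conj_class_def mem_Collect_eq
    by (rule exI[of _ "\<one>\<^bsub>G\<^esub>"]) (simp add: assms(2))
qed

definition commutator :: "('a, 'm) monoid_scheme \<Rightarrow> 'a \<Rightarrow> 'a \<Rightarrow> 'a"
  where "commutator G a b = a \<otimes>\<^bsub>G\<^esub> b \<otimes>\<^bsub>G\<^esub> inv\<^bsub>G\<^esub> a \<otimes>\<^bsub>G\<^esub> inv\<^bsub>G\<^esub> b"

text \<open>The automorphism of \<open>H\<close> induced along a surjection \<open>q: G \<rightarrow> H\<close> by an automorphism \<open>f\<close> of \<open>G\<close>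
  that preserves the kernel of \<open>q\<close>; it exists and is unique by lemma \<open>induced_aut\<close>.\<close>

definition induced_aut ::
    "('a, 'm) monoid_scheme \<Rightarrow> ('b, 'l) monoid_scheme \<Rightarrow> ('a \<Rightarrow> 'b) \<Rightarrow> ('a \<Rightarrow> 'a) \<Rightarrow> 'b \<Rightarrow> 'b"
  where "induced_aut G H q f =
    (THE g. g \<in> auto H \<and> (\<forall>w\<in>carrier G. g (q w) = q (f w)))"

lemma auto_homD: "f \<in> auto G \<Longrightarrow> f \<in> hom G G"
  by (simp add: auto_def)

lemma auto_closed: "f \<in> auto G \<Longrightarrow> w \<in> carrier G \<Longrightarrow> f w \<in> carrier G"
  by (auto simp: auto_def hom_def)

lemma auto_bij: "f \<in> auto G \<Longrightarrow> bij_betw f (carrier G) (carrier G)"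
  by (simp add: auto_def Bij_def)

lemma induced_aut:
  assumes G: "group G" and H: "group H" and q: "q \<in> hom G H" and surj: "q ` carrier G = carrier H"
    and f: "f \<in> auto G"
    and ker: "\<And>w. w \<in> carrier G \<Longrightarrow> q (f w) = \<one>\<^bsub>H\<^esub> \<longleftrightarrow> q w = \<one>\<^bsub>H\<^esub>"
  shows "induced_aut G H q f \<in> auto H"
    and "w \<in> carrier G \<Longrightarrow> induced_aut G H q f (q w) = q (f w)"
    and "g \<in> auto H \<Longrightarrow> (\<And>w. w \<in> carrier G \<Longrightarrow> g (q w) = q (f w)) \<Longrightarrow> induced_aut G H q f = g"
proof -
  interpret G: group G by (rule G)
  interpret H: group H by (rule H)
  interpret q: group_hom G H q by unfold_locales (rule q)
  interpret f: group_hom G G f by unfold_locales (rule auto_homD[OF f])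
  have eq_iff: "q (f v) = q (f w) \<longleftrightarrow> q v = q w" if "v \<in> carrier G" "w \<in> carrier G" for v w
  proof -
    have "q (f v) = q (f w) \<longleftrightarrow> q (f (v \<otimes>\<^bsub>G\<^esub> inv\<^bsub>G\<^esub> w)) = \<one>\<^bsub>H\<^esub>"
      using that by (simp add: H.inv_solve_right')
    also have "\<dots> \<longleftrightarrow> q v = q w"
      using that ker[of "v \<otimes>\<^bsub>G\<^esub> inv\<^bsub>G\<^esub> w"] by (simp add: H.inv_solve_right')
    finally show ?thesis .
  qed
  define g0 where "g0 = (\<lambda>h\<in>carrier H. q (f (inv_into (carrier G) q h)))"
  have g0: "g0 (q w) = q (f w)" if "w \<in> carrier G" for w
  proof -
    have "inv_into (carrier G) q (q w) \<in> carrier G" "q (inv_into (carrier G) q (q w)) = q w"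
      using that by (auto intro: inv_into_into f_inv_into_f)
    then show ?thesis using that eq_iff by (simp add: g0_def)
  qed
  have ex: "\<exists>w\<in>carrier G. h = q w" if "h \<in> carrier H" for h
    using surj that by blast
  have "g0 \<in> hom H H"
  proof (rule homI)
    fix x assume "x \<in> carrier H"
    then show "g0 x \<in> carrier H" using ex[of x] g0 by auto
  next
    fix x y assume "x \<in> carrier H" "y \<in> carrier H"
    then obtain v w where "v \<in> carrier G" "x = q v" "w \<in> carrier G" "y = q w"
      using ex by metis
    then show "g0 (x \<otimes>\<^bsub>H\<^esub> y) = g0 x \<otimes>\<^bsub>H\<^esub> g0 y"
      using g0[of "v \<otimes>\<^bsub>G\<^esub> w"] g0[of v] g0[of w] by simp
  qed
  moreover have "inj_on g0 (carrier H)"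
  proof (rule inj_onI)
    fix x y assume "x \<in> carrier H" "y \<in> carrier H" and e: "g0 x = g0 y"
    then obtain v w where "v \<in> carrier G" "x = q v" "w \<in> carrier G" "y = q w"
      using ex by metis
    then show "x = y" using e g0 eq_iff by simp
  qed
  moreover have "g0 ` carrier H = carrier H"
  proof -
    have "g0 ` carrier H = (\<lambda>w. g0 (q w)) ` carrier G"
      by (simp add: surj[symmetric] image_image)
    also have "\<dots> = q ` (f ` carrier G)"
      by (simp add: g0 image_image)
    also have "\<dots> = carrier H"
      using auto_bij[OF f] surj by (simp add: bij_betw_def)
    finally show ?thesis .
  qed
  ultimately have g0_auto: "g0 \<in> auto H"
    by (simp add: auto_def Bij_def bij_betw_def g0_def)
  have uniq: "g = g0" if g: "g \<in> auto H" and gq: "\<And>w. w \<in> carrier G \<Longrightarrow> g (q w) = q (f w)" for g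
  proof (rule extensionalityI)
    show "g \<in> extensional (carrier H)" "g0 \<in> extensional (carrier H)"
      using g g0_auto by (auto simp: auto_def Bij_def)
    fix h assume "h \<in> carrier H"
    then show "g h = g0 h" using ex[of h] gq g0 by auto
  qed
  have eq: "induced_aut G H q f = g0"
    unfolding induced_aut_def
  proof (rule the_equality)
    show "g0 \<in> auto H \<and> (\<forall>w\<in>carrier G. g0 (q w) = q (f w))"
      using g0_auto g0 by blast
  qed (rule uniq; blast)
  show "induced_aut G H q f \<in> auto H"
    unfolding eq by (rule g0_auto)
  show "induced_aut G H q f (q w) = q (f w)" if "w \<in> carrier G"
    unfolding eq by (rule g0[OF that])
  show "induced_aut G H q f = g"
    if "g \<in> auto H" "\<And>w. w \<in> carrier G \<Longrightarrow> g (q w) = q (f w)"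
    unfolding eq by (rule uniq[OF that, symmetric])
qed

lemma AutoGroup_mult:
  "f \<in> auto G \<Longrightarrow> g \<in> auto G \<Longrightarrow> f \<otimes>\<^bsub>AutoGroup G\<^esub> g = compose (carrier G) f g"
  by (simp add: AutoGroup_def BijGroup_def auto_def)

lemma carrier_AutoGroup [simp]: "carrier (AutoGroup G) = auto G"
  by (simp add: AutoGroup_def)

lemma one_AutoGroup: "\<one>\<^bsub>AutoGroup G\<^esub> = (\<lambda>x\<in>carrier G. x)"
  by (simp add: AutoGroup_def BijGroup_def)

lemma AutoGroup_inv_apply:
  assumes G: "group G" and f: "f \<in> auto G" and w: "w \<in> carrier G"
  shows "(inv\<^bsub>AutoGroup G\<^esub> f) (f w) = w"
proof -
  interpret AG: group "AutoGroup G" by (rule group.AutoGroup[OF G])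
  have ia: "inv\<^bsub>AutoGroup G\<^esub> f \<in> auto G"
    using AG.inv_closed[of f] f by simp
  have "compose (carrier G) (inv\<^bsub>AutoGroup G\<^esub> f) f = (\<lambda>x\<in>carrier G. x)"
    using AG.l_inv[of f] f AutoGroup_mult[OF ia f] by (simp add: one_AutoGroup)
  then have "compose (carrier G) (inv\<^bsub>AutoGroup G\<^esub> f) f w = (\<lambda>x\<in>carrier G. x) w"
    by (rule fun_cong)
  then show ?thesis using w by (simp add: compose_eq)
qed

lemma compose_auto:
  "group G \<Longrightarrow> f \<in> auto G \<Longrightarrow> g \<in> auto G \<Longrightarrow> compose (carrier G) f g \<in> auto G"
  using monoid.m_closed[of "AutoGroup G" f g] group.AutoGroup[of G]
  by (simp add: AutoGroup_mult group.is_monoid)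

lemma induced_aut_compose:
  assumes G: "group G" and H: "group H" and q: "q \<in> hom G H" and surj: "q ` carrier G = carrier H"
    and f: "f \<in> auto G" and g: "g \<in> auto G"
    and kerf: "\<And>w. w \<in> carrier G \<Longrightarrow> q (f w) = \<one>\<^bsub>H\<^esub> \<longleftrightarrow> q w = \<one>\<^bsub>H\<^esub>"
    and kerg: "\<And>w. w \<in> carrier G \<Longrightarrow> q (g w) = \<one>\<^bsub>H\<^esub> \<longleftrightarrow> q w = \<one>\<^bsub>H\<^esub>"
  shows "induced_aut G H q (f \<otimes>\<^bsub>AutoGroup G\<^esub> g) =
    induced_aut G H q f \<otimes>\<^bsub>AutoGroup H\<^esub> induced_aut G H q g"
proof -
  have If: "induced_aut G H q f \<in> auto H"
      "\<And>w. w \<in> carrier G \<Longrightarrow> induced_aut G H q f (q w) = q (f w)"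
    using induced_aut(1,2)[OF G H q surj f] kerf by blast+
  have Ig: "induced_aut G H q g \<in> auto H"
      "\<And>w. w \<in> carrier G \<Longrightarrow> induced_aut G H q g (q w) = q (g w)"
    using induced_aut(1,2)[OF G H q surj g] kerg by blast+
  have qc: "q w \<in> carrier H" if "w \<in> carrier G" for w
    using that q by (auto simp: hom_def)
  show ?thesis
    unfolding AutoGroup_mult[OF f g] AutoGroup_mult[OF If(1) Ig(1)]
  proof (rule induced_aut(3)[OF G H q surj])
    show "compose (carrier G) f g \<in> auto G" by (rule compose_auto[OF G f g])
    show "compose (carrier H) (induced_aut G H q f) (induced_aut G H q g) \<in> auto H"
      by (rule compose_auto[OF H If(1) Ig(1)])
    show "q (compose (carrier G) f g w) = \<one>\<^bsub>H\<^esub> \<longleftrightarrow> q w = \<one>\<^bsub>H\<^esub>" if "w \<in> carrier G" for w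
      using that kerf kerg auto_closed[OF g] by (simp add: compose_eq)
    show "compose (carrier H) (induced_aut G H q f) (induced_aut G H q g) (q w) =
        q (compose (carrier G) f g w)" if "w \<in> carrier G" for w
      using that qc auto_closed[OF g] If(2) Ig(2) by (simp add: compose_eq)
  qed
qed


section \<open>The groups\<close>

datatype letter = X nat | Y nat

definition X_set :: "nat \<Rightarrow> letter set"
  where "X_set n = X ` {1..n}"

definition Y_set :: "nat \<Rightarrow> letter set"
  where "Y_set k = Y ` {1..k}"

definition XY_set :: "nat \<Rightarrow> nat \<Rightarrow> letter set"
  where "XY_set n k = X_set n \<union> Y_set k"

abbreviation F :: "nat \<Rightarrow> nat \<Rightarrow> letter word monoid"
  where "F n k \<equiv> free_group (XY_set n k)"

abbreviation Fx :: "nat \<Rightarrow> letter word monoid"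
  where "Fx n \<equiv> free_group (X_set n)"

definition A_set :: "nat \<Rightarrow> nat \<Rightarrow> (letter word \<Rightarrow> letter word) set"
  where "A_set n k = {f \<in> auto (F n k).
    \<forall>i\<in>{1..k}. conj_class (F n k) (f (gen (Y i))) = conj_class (F n k) (gen (Y i))}"

definition A_group :: "nat \<Rightarrow> nat \<Rightarrow> (letter word \<Rightarrow> letter word) monoid"
  where "A_group n k = (AutoGroup (F n k)) \<lparr>carrier := A_set n k\<rparr>"

definition kill_Y :: "nat \<Rightarrow> letter word \<Rightarrow> letter word"
  where "kill_Y n = free_lift (Fx n) (\<lambda>a. case a of X i \<Rightarrow> gen (X i) | Y i \<Rightarrow> \<one>\<^bsub>Fx n\<^esub>)"

text \<open>\<open>kill_Y n\<close> is the map from \<open>F n k\<close> onto \<open>Fx n\<close> that fixes the \<open>x\<close>'s and whose kernel is the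
  normal closure of the \<open>y\<close>'s; see \<open>kernel_kill_Y\<close> below.\<close>

lemma gen_in_F: "a \<in> XY_set n k \<Longrightarrow> gen a \<in> carrier (F n k)"
  by (rule gen_in_free_group)

lemma gen_Y_in_F: "i \<in> {1..k} \<Longrightarrow> gen (Y i) \<in> carrier (F n k)"
  by (rule gen_in_F) (simp add: XY_set_def Y_set_def)

lemma carrier_Fx_subset: "carrier (Fx n) \<subseteq> carrier (F n k)"
  by (auto simp: free_group_def XY_set_def)

lemma kill_Y_hom: "kill_Y n \<in> hom (F n k) (Fx n)"
proof -
  interpret group "Fx n" by (rule group_free_group)
  have "(case a of X i \<Rightarrow> gen (X i) | Y i \<Rightarrow> \<one>\<^bsub>Fx n\<^esub>) \<in> carrier (Fx n)" if "a \<in> XY_set n k" for a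
    using that gen_in_free_group[of a "X_set n"] one_closed
    by (cases a) (simp_all add: XY_set_def Y_set_def image_iff)
  then show ?thesis
    unfolding kill_Y_def by (intro free_lift_hom Pi_I)
qed

lemma kill_Y_X: "i \<in> {1..n} \<Longrightarrow> kill_Y n (gen (X i)) = gen (X i)"
  using gen_in_free_group[of "X i" "X_set n"]
  by (simp add: kill_Y_def group.free_lift_gen[OF group_free_group] X_set_def)

lemma kill_Y_Y: "kill_Y n (gen (Y i)) = \<one>\<^bsub>Fx n\<^esub>"
  using monoid.one_closed[OF group.is_monoid[OF group_free_group[of "X_set n"]]]
  by (simp add: kill_Y_def group.free_lift_gen[OF group_free_group])

lemma incl_hom: "(\<lambda>w. w) \<in> hom (Fx n) (F n k)"
  by (rule homI) (auto simp: free_group_def XY_set_def)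

lemma kill_Y_id:
  assumes w: "w \<in> carrier (Fx n)"
  shows "kill_Y n w = w"
proof -
  interpret group "Fx n" by (rule group_free_group)
  have "kill_Y n \<in> hom (Fx n) (Fx n)"
    using kill_Y_hom[of n 0] by (simp add: XY_set_def Y_set_def)
  moreover have "(\<lambda>w. w) \<in> hom (Fx n) (Fx n)" by (rule homI) auto
  ultimately show ?thesis
    by (rule hom_free_group_eqI[OF _ _ _ w]) (auto simp: X_set_def kill_Y_X)
qed

lemma kill_Y_closed: "w \<in> carrier (F n k) \<Longrightarrow> kill_Y n w \<in> carrier (Fx n)"
  using kill_Y_hom[of n k] by (auto simp: hom_def)

lemma kill_Y_surj: "kill_Y n ` carrier (F n k) = carrier (Fx n)"
proof
  show "carrier (Fx n) \<subseteq> kill_Y n ` carrier (F n k)"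
  proof
    fix w assume "w \<in> carrier (Fx n)"
    then show "w \<in> kill_Y n ` carrier (F n k)"
      using carrier_Fx_subset[of n k] by (intro image_eqI[of _ _ w]) (auto simp: kill_Y_id)
  qed
qed (auto simp: kill_Y_closed)

lemma kernel_kill_Y:
  "kernel (F n k) (Fx n) (kill_Y n) =
    generate (F n k) (\<Union>i\<in>{1..k}. conj_class (F n k) (gen (Y i)))"
  (is "_ = generate _ ?R")
proof -
  interpret G: group "F n k" by (rule group_free_group)
  interpret q: group_hom "F n k" "Fx n" "kill_Y n"
    by (intro group_hom.intro group_hom_axioms.intro group_free_group kill_Y_hom)
  have y: "gen (Y i) \<in> carrier (F n k)" if "i \<in> {1..k}" for i
    by (rule gen_Y_in_F[OF that])
  have R: "?R \<subseteq> carrier (F n k)" using y by (auto simp: conj_class_def)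
  have N: "generate (F n k) ?R \<lhd> F n k" (is "?N \<lhd> _")
  proof (rule G.normal_generateI[OF R])
    fix h g assume "h \<in> ?R" and g: "g \<in> carrier (F n k)"
    then obtain i c where i: "i \<in> {1..k}" and c: "c \<in> carrier (F n k)"
      and h: "h = c \<otimes>\<^bsub>F n k\<^esub> gen (Y i) \<otimes>\<^bsub>F n k\<^esub> inv\<^bsub>F n k\<^esub> c"
      by (auto simp: conj_class_def)
    have "g \<otimes>\<^bsub>F n k\<^esub> h \<otimes>\<^bsub>F n k\<^esub> inv\<^bsub>F n k\<^esub> g =
        (g \<otimes>\<^bsub>F n k\<^esub> c) \<otimes>\<^bsub>F n k\<^esub> gen (Y i) \<otimes>\<^bsub>F n k\<^esub> inv\<^bsub>F n k\<^esub> (g \<otimes>\<^bsub>F n k\<^esub> c)"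
      using g c y[OF i] by (simp add: h G.m_assoc G.inv_mult_group)
    then show "g \<otimes>\<^bsub>F n k\<^esub> h \<otimes>\<^bsub>F n k\<^esub> inv\<^bsub>F n k\<^esub> g \<in> ?R"
      using i g c unfolding conj_class_def by blast
  qed
  interpret N: normal ?N "F n k" by (rule N)
  interpret Q: group "F n k Mod ?N" by (rule N.factorgroup_is_group)
  have coset_hom: "(\<lambda>w. ?N #>\<^bsub>F n k\<^esub> w) \<in> hom (F n k) (F n k Mod ?N)"
    by (rule N.r_coset_hom_Mod)
  have "(\<lambda>w. ?N #>\<^bsub>F n k\<^esub> w) \<circ> ((\<lambda>w. w) \<circ> kill_Y n) \<in> hom (F n k) (F n k Mod ?N)"
    by (intro Group.hom_compose[OF _ coset_hom] Group.hom_compose[OF kill_Y_hom] incl_hom)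
  then have coset_hom': "(\<lambda>w. ?N #>\<^bsub>F n k\<^esub> kill_Y n w) \<in> hom (F n k) (F n k Mod ?N)"
    by (simp add: comp_def)
  have one: "\<one>\<^bsub>Fx n\<^esub> = \<one>\<^bsub>F n k\<^esub>" by (simp add: free_group_def)
  have eq: "?N #>\<^bsub>F n k\<^esub> w = ?N #>\<^bsub>F n k\<^esub> kill_Y n w" if "w \<in> carrier (F n k)" for w
  proof (rule Q.hom_free_group_eqI[OF coset_hom coset_hom' _ that])
    fix a assume "a \<in> XY_set n k"
    then consider i where "a = X i" "i \<in> {1..n}" | i where "a = Y i" "i \<in> {1..k}"
      by (auto simp: XY_set_def X_set_def Y_set_def)
    then show "?N #>\<^bsub>F n k\<^esub> gen a = ?N #>\<^bsub>F n k\<^esub> kill_Y n (gen a)"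
    proof cases
      case 2
      have "gen (Y i) \<in> conj_class (F n k) (gen (Y i))"
        by (rule conj_class_self[OF G.is_group y[OF 2(2)]])
      then have "gen (Y i) \<in> ?N"
        using 2 by (intro generate.incl) blast
      then show ?thesis
        using G.coset_join2[OF y[OF 2(2)] N.is_subgroup] G.coset_join2[OF G.one_closed N.is_subgroup]
          N.subgroup_axioms[THEN subgroup.one_closed] 2(1)
        by (simp only: kill_Y_Y one)
    qed (simp add: kill_Y_X)
  qed
  show ?thesis
  proof
    show "kernel (F n k) (Fx n) (kill_Y n) \<subseteq> ?N"
    proof
      fix w assume "w \<in> kernel (F n k) (Fx n) (kill_Y n)"
      then have w: "w \<in> carrier (F n k)" "kill_Y n w = \<one>\<^bsub>F n k\<^esub>"
        by (simp_all add: kernel_def one)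
      then have "?N #>\<^bsub>F n k\<^esub> w = ?N"
        using eq[OF w(1)] G.coset_mult_one[OF N.subset] by simp
      then show "w \<in> ?N" using w(1) by (rule G.coset_join1[OF _ _ N.is_subgroup])
    qed
    have "?R \<subseteq> kernel (F n k) (Fx n) (kill_Y n)"
    proof
      fix h assume "h \<in> ?R"
      then obtain i c where i: "i \<in> {1..k}" and c: "c \<in> carrier (F n k)"
        and h: "h = c \<otimes>\<^bsub>F n k\<^esub> gen (Y i) \<otimes>\<^bsub>F n k\<^esub> inv\<^bsub>F n k\<^esub> c"
        by (auto simp: conj_class_def)
      then show "h \<in> kernel (F n k) (Fx n) (kill_Y n)"
        using y[OF i] by (simp add: kernel_def kill_Y_Y)
    qed
    then show "?N \<subseteq> kernel (F n k) (Fx n) (kill_Y n)"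
      by (rule G.generate_subgroup_incl[OF _ q.subgroup_kernel])
  qed
qed

definition proj :: "nat \<Rightarrow> nat \<Rightarrow> (letter word \<Rightarrow> letter word) \<Rightarrow> letter word \<Rightarrow> letter word"
  where "proj n k = induced_aut (F n k) (Fx n) (kill_Y n)"

lemma A_setD: "f \<in> A_set n k \<Longrightarrow> f \<in> auto (F n k)"
  by (simp add: A_set_def)

lemma conj_class_auto:
  assumes G: "group G" and f: "f \<in> auto G" and z: "z \<in> carrier G"
  shows "conj_class G (f z) = f ` conj_class G z"
proof -
  interpret group G by (rule G)
  interpret f: group_hom G G f by unfold_locales (rule auto_homD[OF f])
  have img: "f ` carrier G = carrier G" using auto_bij[OF f] by (simp add: bij_betw_def)
  have "conj_class G (f z) = (\<lambda>g. g \<otimes>\<^bsub>G\<^esub> f z \<otimes>\<^bsub>G\<^esub> inv\<^bsub>G\<^esub> g) ` (f ` carrier G)"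
    unfolding img conj_class_def Setcompr_eq_image by simp
  also have "\<dots> = f ` ((\<lambda>g. g \<otimes>\<^bsub>G\<^esub> z \<otimes>\<^bsub>G\<^esub> inv\<^bsub>G\<^esub> g) ` carrier G)"
    unfolding image_image using z by (intro image_cong) auto
  also have "\<dots> = f ` conj_class G z"
    unfolding conj_class_def Setcompr_eq_image by simp
  finally show ?thesis .
qed

lemma subgroup_A_set: "subgroup (A_set n k) (AutoGroup (F n k))"
proof -
  interpret G: group "F n k" by (rule group_free_group)
  interpret AG: group "AutoGroup (F n k)" by (rule G.AutoGroup)
  let ?c = "\<lambda>i. conj_class (F n k) (gen (Y i))"
  have y: "gen (Y i) \<in> carrier (F n k)" if "i \<in> {1..k}" for i
    by (rule gen_Y_in_F[OF that])
  have A_iff: "f \<in> A_set n k \<longleftrightarrow> f \<in> auto (F n k) \<and> (\<forall>i\<in>{1..k}. f ` ?c i = ?c i)" for f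
  proof (cases "f \<in> auto (F n k)")
    case True
    have "conj_class (F n k) (f (gen (Y i))) = f ` ?c i" if "i \<in> {1..k}" for i
      by (rule conj_class_auto[OF G.is_group True y[OF that]])
    then have "(\<forall>i\<in>{1..k}. conj_class (F n k) (f (gen (Y i))) = ?c i) \<longleftrightarrow> (\<forall>i\<in>{1..k}. f ` ?c i = ?c i)"
      by (intro ball_cong refl) simp
    then show ?thesis using True unfolding A_set_def by blast
  qed (simp add: A_set_def)
  have A_img: "f ` ?c i = ?c i" if "f \<in> A_set n k" "i \<in> {1..k}" for f i
    using that unfolding A_iff by blast
  have csub: "?c i \<subseteq> carrier (F n k)" if "i \<in> {1..k}" for i
    by (rule conj_class_subset[OF G.is_group y[OF that]])
  show ?thesis
  proof (rule AG.subgroupI)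
    show "A_set n k \<subseteq> carrier (AutoGroup (F n k))" by (auto simp: A_set_def)
    have "(\<lambda>x\<in>carrier (F n k). x) \<in> A_set n k"
      using y G.id_in_auto by (simp add: A_set_def)
    then show "A_set n k \<noteq> {}" by blast
  next
    fix f assume f: "f \<in> A_set n k"
    have fa: "f \<in> auto (F n k)" by (rule A_setD[OF f])
    have ia: "inv\<^bsub>AutoGroup (F n k)\<^esub> f \<in> auto (F n k)"
      using AG.inv_closed fa by simp
    have "(inv\<^bsub>AutoGroup (F n k)\<^esub> f) ` ?c i = ?c i" if i: "i \<in> {1..k}" for i
    proof -
      have "(inv\<^bsub>AutoGroup (F n k)\<^esub> f) ` (f ` ?c i) = (\<lambda>w. w) ` ?c i"
        unfolding image_image
        by (rule image_cong[OF refl])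
          (rule AutoGroup_inv_apply[OF G.is_group fa subsetD[OF csub[OF i]]])
      then show ?thesis by (simp only: A_img[OF f i] image_ident)
    qed
    then show "inv\<^bsub>AutoGroup (F n k)\<^esub> f \<in> A_set n k"
      using ia unfolding A_iff by blast
  next
    fix f g assume fg: "f \<in> A_set n k" "g \<in> A_set n k"
    then have a: "f \<in> auto (F n k)" "g \<in> auto (F n k)" by (auto dest: A_setD)
    have "compose (carrier (F n k)) f g ` ?c i = ?c i" if i: "i \<in> {1..k}" for i
    proof -
      have "compose (carrier (F n k)) f g ` ?c i = f ` (g ` ?c i)"
        unfolding image_image
        by (rule image_cong[OF refl]) (rule compose_eq[OF subsetD[OF csub[OF i]]])
      also have "\<dots> = ?c i" by (simp only: A_img[OF fg(1) i] A_img[OF fg(2) i])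
      finally show ?thesis .
    qed
    then show "f \<otimes>\<^bsub>AutoGroup (F n k)\<^esub> g \<in> A_set n k"
      using compose_auto[OF G.is_group a] unfolding AutoGroup_mult[OF a] A_iff by blast
  qed
qed

lemma A_set_kill_Y:
  assumes f: "f \<in> A_set n k" and w: "w \<in> carrier (F n k)"
  shows "kill_Y n (f w) = kill_Y n (f (kill_Y n w))"
proof -
  interpret G: group "F n k" by (rule group_free_group)
  interpret H: group "Fx n" by (rule group_free_group)
  interpret q: group_hom "F n k" "Fx n" "kill_Y n" by unfold_locales (rule kill_Y_hom)
  interpret f: group_hom "F n k" "F n k" f by unfold_locales (rule auto_homD[OF A_setD[OF f]])
  have one: "\<one>\<^bsub>Fx n\<^esub> = \<one>\<^bsub>F n k\<^esub>" by (simp add: free_group_def)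
  have h1: "kill_Y n \<circ> f \<in> hom (F n k) (Fx n)"
    by (rule Group.hom_compose[OF f.homh kill_Y_hom])
  have h2: "(kill_Y n \<circ> f) \<circ> ((\<lambda>w. w) \<circ> kill_Y n) \<in> hom (F n k) (Fx n)"
    by (intro Group.hom_compose[OF _ h1] Group.hom_compose[OF kill_Y_hom] incl_hom)
  have "(kill_Y n \<circ> f) w = ((kill_Y n \<circ> f) \<circ> ((\<lambda>w. w) \<circ> kill_Y n)) w"
  proof (rule H.hom_free_group_eqI[OF h1 h2 _ w])
    fix a assume "a \<in> XY_set n k"
    then consider i where "a = X i" "i \<in> {1..n}" | i where "a = Y i" "i \<in> {1..k}"
      by (auto simp: XY_set_def X_set_def Y_set_def)
    then show "(kill_Y n \<circ> f) (gen a) = ((kill_Y n \<circ> f) \<circ> ((\<lambda>w. w) \<circ> kill_Y n)) (gen a)"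
    proof cases
      case 2
      have y: "gen (Y i) \<in> carrier (F n k)" by (rule gen_Y_in_F[OF 2(2)])
      have "f (gen (Y i)) \<in> conj_class (F n k) (f (gen (Y i)))"
        by (rule conj_class_self[OF G.is_group]) (use y in simp)
      then have "f (gen (Y i)) \<in> conj_class (F n k) (gen (Y i))"
        using f 2 by (simp add: A_set_def)
      then obtain c where "c \<in> carrier (F n k)"
        "f (gen (Y i)) = c \<otimes>\<^bsub>F n k\<^esub> gen (Y i) \<otimes>\<^bsub>F n k\<^esub> inv\<^bsub>F n k\<^esub> c"
        by (auto simp: conj_class_def)
      then have "kill_Y n (f (gen (Y i))) = \<one>\<^bsub>Fx n\<^esub>"
        using y by (simp add: kill_Y_Y)
      moreover have "kill_Y n (f (\<one>\<^bsub>Fx n\<^esub>)) = \<one>\<^bsub>Fx n\<^esub>"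
        unfolding one by (metis f.hom_one one q.hom_one)
      ultimately show ?thesis using 2 by (simp add: kill_Y_Y)
    qed (simp add: kill_Y_X)
  qed
  then show ?thesis by simp
qed

lemma A_set_kernel:
  assumes f: "f \<in> A_set n k" and w: "w \<in> carrier (F n k)"
  shows "kill_Y n (f w) = \<one>\<^bsub>Fx n\<^esub> \<longleftrightarrow> kill_Y n w = \<one>\<^bsub>Fx n\<^esub>"
proof -
  interpret G: group "F n k" by (rule group_free_group)
  interpret AG: group "AutoGroup (F n k)" by (rule G.AutoGroup)
  have one: "\<one>\<^bsub>Fx n\<^esub> = \<one>\<^bsub>F n k\<^esub>" by (simp add: free_group_def)
  have *: "kill_Y n (g v) = \<one>\<^bsub>Fx n\<^esub>"
    if g: "g \<in> A_set n k" and v: "v \<in> carrier (F n k)" and e: "kill_Y n v = \<one>\<^bsub>Fx n\<^esub>" for g v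
  proof -
    interpret q: group_hom "F n k" "Fx n" "kill_Y n"
      by (intro group_hom.intro group_hom_axioms.intro group_free_group kill_Y_hom)
    interpret g: group_hom "F n k" "F n k" g by unfold_locales (rule auto_homD[OF A_setD[OF g]])
    have "kill_Y n (g v) = kill_Y n (g \<one>\<^bsub>F n k\<^esub>)"
      using A_set_kill_Y[OF g v] e one by simp
    then show ?thesis by (metis g.hom_one q.hom_one)
  qed
  let ?i = "inv\<^bsub>AutoGroup (F n k)\<^esub> f"
  have fa: "f \<in> auto (F n k)" by (rule A_setD[OF f])
  have i: "?i \<in> A_set n k"
    using subgroup.m_inv_closed[OF subgroup_A_set f] .
  have "?i (f w) = w" by (rule AutoGroup_inv_apply[OF G.is_group fa w])
  then show ?thesis
    using *[OF f w] *[OF i auto_closed[OF fa w]] by metis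
qed

lemma proj_kill_Y:
  assumes "f \<in> A_set n k"
  shows "proj n k f \<in> auto (Fx n)"
    and "w \<in> carrier (F n k) \<Longrightarrow> proj n k f (kill_Y n w) = kill_Y n (f w)"
  unfolding proj_def
  using induced_aut(1,2)[OF group_free_group group_free_group kill_Y_hom kill_Y_surj
      A_setD[OF assms] A_set_kernel[OF assms]] by auto

lemma proj_hom: "proj n k \<in> hom (A_group n k) (AutoGroup (Fx n))"
proof (rule homI)
  fix f g assume "f \<in> carrier (A_group n k)" "g \<in> carrier (A_group n k)"
  then have fg: "f \<in> A_set n k" "g \<in> A_set n k" by (auto simp: A_group_def)
  have "proj n k (f \<otimes>\<^bsub>AutoGroup (F n k)\<^esub> g) = proj n k f \<otimes>\<^bsub>AutoGroup (Fx n)\<^esub> proj n k g"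
    unfolding proj_def
    by (rule induced_aut_compose[OF group_free_group group_free_group kill_Y_hom kill_Y_surj])
      (use fg in \<open>auto simp: A_set_kernel A_setD\<close>)
  then show "proj n k (f \<otimes>\<^bsub>A_group n k\<^esub> g) = proj n k f \<otimes>\<^bsub>AutoGroup (Fx n)\<^esub> proj n k g"
    by (simp add: A_group_def)
qed (simp add: proj_kill_Y(1) A_group_def)

definition K_set :: "nat \<Rightarrow> nat \<Rightarrow> (letter word \<Rightarrow> letter word) set"
  where "K_set n k = kernel (A_group n k) (AutoGroup (Fx n)) (proj n k)"

definition ab_kernel :: "('a, 'm) monoid_scheme \<Rightarrow> 'a set"
  where "ab_kernel G = derived G (carrier G)"

definition abelianization :: "('a, 'm) monoid_scheme \<Rightarrow> 'a set monoid"
  where "abelianization G = G Mod ab_kernel G"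

definition ab_action :: "('a, 'm) monoid_scheme \<Rightarrow> ('a \<Rightarrow> 'a) \<Rightarrow> 'a set \<Rightarrow> 'a set"
  where "ab_action G = induced_aut G (abelianization G) (\<lambda>w. ab_kernel G #>\<^bsub>G\<^esub> w)"

text \<open>The abelianization of \<open>F n k\<close> is free abelian of rank \<open>n + k\<close>, so its automorphism group
  is \<open>GL\<close> of degree \<open>n + k\<close> over the integers, written without a choice of basis.\<close>

lemma derived_auto:
  assumes G: "group G" and f: "f \<in> auto G"
  shows "f ` ab_kernel G = ab_kernel G"
proof -
  interpret group G by (rule G)
  interpret f: group_hom G G f by unfold_locales (rule auto_homD[OF f])
  show ?thesis
    using f.derived_img[of "carrier G"] auto_bij[OF f] by (simp add: ab_kernel_def bij_betw_def)
qed

lemma ab_action: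
  assumes G: "group G"
  shows "f \<in> auto G \<Longrightarrow> ab_action G f \<in> auto (abelianization G)"
    and "f \<in> auto G \<Longrightarrow> w \<in> carrier G \<Longrightarrow>
      ab_action G f (ab_kernel G #>\<^bsub>G\<^esub> w) = ab_kernel G #>\<^bsub>G\<^esub> f w"
    and "ab_action G \<in> hom (AutoGroup G) (AutoGroup (abelianization G))"
proof -
  interpret group G by (rule G)
  interpret N: normal "ab_kernel G" G
    unfolding ab_kernel_def by (rule derived_self_is_normal)
  let ?q = "\<lambda>w. ab_kernel G #>\<^bsub>G\<^esub> w"
  have H: "group (abelianization G)"
    unfolding abelianization_def by (rule N.factorgroup_is_group)
  have q: "?q \<in> hom G (abelianization G)"
    unfolding abelianization_def by (rule N.r_coset_hom_Mod)
  have surj: "?q ` carrier G = carrier (abelianization G)"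
    by (simp add: abelianization_def carrier_FactGroup)
  have one_iff: "?q w = \<one>\<^bsub>abelianization G\<^esub> \<longleftrightarrow> w \<in> ab_kernel G" if "w \<in> carrier G" for w
    using coset_join1[OF _ that N.is_subgroup] coset_join2[OF that N.is_subgroup]
    unfolding abelianization_def one_FactGroup by blast
  have ker: "?q (f w) = \<one>\<^bsub>abelianization G\<^esub> \<longleftrightarrow> ?q w = \<one>\<^bsub>abelianization G\<^esub>"
    if f: "f \<in> auto G" and w: "w \<in> carrier G" for f w
  proof -
    have "f w \<in> f ` ab_kernel G \<longleftrightarrow> w \<in> ab_kernel G"
      using inj_on_image_mem_iff[OF bij_betw_imp_inj_on[OF auto_bij[OF f]] w N.subset] .
    then show ?thesis
      unfolding one_iff[OF w] one_iff[OF auto_closed[OF f w]] derived_auto[OF G f] .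
  qed
  show 1: "ab_action G f \<in> auto (abelianization G)" if "f \<in> auto G" for f
    unfolding ab_action_def by (rule induced_aut(1)[OF G H q surj that ker[OF that]])
  show "ab_action G f (ab_kernel G #>\<^bsub>G\<^esub> w) = ab_kernel G #>\<^bsub>G\<^esub> f w"
    if f: "f \<in> auto G" and w: "w \<in> carrier G" for f w
    unfolding ab_action_def by (rule induced_aut(2)[OF G H q surj f ker[OF f] w])
  show "ab_action G \<in> hom (AutoGroup G) (AutoGroup (abelianization G))"
  proof (rule homI)
    fix f g assume "f \<in> carrier (AutoGroup G)" "g \<in> carrier (AutoGroup G)"
    then have fg: "f \<in> auto G" "g \<in> auto G" by auto
    show "ab_action G (f \<otimes>\<^bsub>AutoGroup G\<^esub> g) =
        ab_action G f \<otimes>\<^bsub>AutoGroup (abelianization G)\<^esub> ab_action G g"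
      unfolding ab_action_def
      by (rule induced_aut_compose[OF G H q surj fg ker[OF fg(1)] ker[OF fg(2)]])
  qed (simp add: 1)
qed

definition IA_set :: "nat \<Rightarrow> nat \<Rightarrow> (letter word \<Rightarrow> letter word) set"
  where "IA_set n k =
    kernel (AutoGroup (F n k)) (AutoGroup (abelianization (F n k))) (ab_action (F n k))"

definition KIA_set :: "nat \<Rightarrow> nat \<Rightarrow> (letter word \<Rightarrow> letter word) set"
  where "KIA_set n k = K_set n k \<inter> IA_set n k"


section \<open>The generators\<close>

definition subst_gen :: "nat \<Rightarrow> nat \<Rightarrow> letter \<Rightarrow> letter word \<Rightarrow> letter word \<Rightarrow> letter word"
  where "subst_gen n k z u =
    restrict (free_lift (F n k) (\<lambda>a. if a = z then u else gen a)) (carrier (F n k))"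

definition C_aut :: "nat \<Rightarrow> nat \<Rightarrow> letter \<Rightarrow> letter \<Rightarrow> letter word \<Rightarrow> letter word"
  where "C_aut n k z z' =
    subst_gen n k z (gen z' \<otimes>\<^bsub>F n k\<^esub> gen z \<otimes>\<^bsub>F n k\<^esub> inv\<^bsub>F n k\<^esub> (gen z'))"

definition M_aut :: "nat \<Rightarrow> nat \<Rightarrow> letter \<Rightarrow> letter word \<Rightarrow> letter word \<Rightarrow> letter word"
  where "M_aut n k z v = subst_gen n k z (v \<otimes>\<^bsub>F n k\<^esub> gen z)"

definition KIA_generators :: "nat \<Rightarrow> nat \<Rightarrow> (letter word \<Rightarrow> letter word) set"
  where "KIA_generators n k =
    {M_aut n k x (commutator (F n k) (gen y) (gen z)) | x y z.
       x \<in> X_set n \<and> y \<in> Y_set k \<and> z \<in> XY_set n k - {x, y}}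
    \<union> {C_aut n k y z | y z. y \<in> Y_set k \<and> z \<in> XY_set n k - {y}}
    \<union> {C_aut n k z y | y z. y \<in> Y_set k \<and> z \<in> XY_set n k - {y}}"

end

theory Submission
  imports Defs
begin

text \<open>
  Write \<open>A\<close> for the group of automorphisms of \<open>F = F n k\<close> that preserve the conjugacy classes of
  the \<open>y\<close>, \<open>K\<close> for the kernel of its projection to the automorphisms of \<open>Fx n\<close>, and \<open>T\<close> for the
  set of generators in the theorem. All of \<open>T\<close> lies in \<open>K\<close> and acts trivially on the
  abelianization; this is checked on the generators of \<open>F\<close> (\<open>KIA_generators_in_KIA\<close>). The
  converse peels off two layers, each time by the same principle (\<open>generate_Un_decomp\<close>): if the
  elements of \<open>P\<close> normalize the group generated by \<open>Q\<close>, then \<open>P\<close> and \<open>Q\<close> together generate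
  \<open>\<langle>P\<rangle>\<langle>Q\<rangle>\<close>.

  The basis of everything is a set of generators of \<open>A\<close> (\<open>A_set_factor\<close>), obtained by Nielsen
  reduction. An element \<open>f\<close> of \<open>A\<close> is a basis of \<open>F\<close> in which the member belonging to \<open>y\<close> has the
  form \<open>g y g\<^sup>-\<^sup>1\<close>. Precomposing \<open>f\<close> with \<open>x \<mapsto> q\<^sup>-\<^sup>1 x\<close> or \<open>y \<mapsto> q\<^sup>-\<^sup>1 y q\<close>, for a letter \<open>q\<close> or its
  inverse, changes one member of that basis and stays inside \<open>A\<close>. If no such move makes the basis
  shorter, or lexicographically smaller at equal length, then in a product of basis members only the
  ends of the factors cancel and a letter survives of each of them. So a letter of \<open>F\<close>, being such a
  product, is itself a member of the basis or the inverse of one, and \<open>f\<close> permutes the letters up to sign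
  (\<open>A_set_generated\<close>). That the classical argument only needs the moves available in \<open>A\<close> rests on
  the odd length of \<open>g y g\<^sup>-\<^sup>1\<close>: such a word does not split into two equal halves, so wherever the classical
  proof would multiply it by another member, conjugating it works instead, or changing the other
  member does.

  First layer. The moves and signed permutations among the \<open>x\<close> alone normalize the group generated by
  the \<open>x \<mapsto> y x\<close> and the conjugations \<open>x \<mapsto> y x y\<^sup>-\<^sup>1\<close> and \<open>y \<mapsto> z y z\<^sup>-\<^sup>1\<close>
  (\<open>X_generators_normalize\<close>). Hence every element of \<open>A\<close> is a product \<open>e s\<close>, where \<open>e\<close> comes from an
  automorphism of \<open>Fx n\<close> and \<open>s\<close> lies in that group, which is contained in \<open>K\<close>. For an element of
  \<open>K\<close> the factor \<open>e\<close> is trivial, so \<open>K\<close> is generated by these maps (\<open>K_set_generated\<close>).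

  Second layer. The conjugations belong to \<open>T\<close>, and the maps \<open>x \<mapsto> y\<^sup>\<plusminus>\<^sup>1 x\<close> normalize the group
  generated by \<open>T\<close> (\<open>Y_multiplications_normalize\<close>). So every element of \<open>K\<close> is a product \<open>m t\<close> with
  \<open>t\<close> in \<open>\<langle>T\<rangle>\<close> and \<open>m\<close> of the form \<open>x \<mapsto> v x\<close>, where \<open>v\<close> depends on \<open>x\<close> and is a word in the \<open>y\<close>.
  If the product acts trivially on the abelianization, so does \<open>m\<close>, and then each \<open>v\<close> lies in the
  commutator subgroup of the free group on the \<open>y\<close>. The words \<open>v\<close> in the \<open>y\<close> for which \<open>x \<mapsto> v x\<close>
  lies in \<open>\<langle>T\<rangle>\<close> form a normal subgroup of that free group, because \<open>T\<close> contains the conjugations of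
  \<open>x\<close> by the \<open>y\<close>, and this subgroup contains the commutators of the \<open>y\<close>; so it contains every such
  \<open>v\<close>, and \<open>m\<close> lies in \<open>\<langle>T\<rangle>\<close> (\<open>Y_multiplications_IA\<close>).
\<close>

section \<open>Reduced words and common prefixes\<close>

definition winv :: "'a word \<Rightarrow> 'a word"
  where "winv u = rev (map inv_letter u)"

lemma inv_letter_neq [simp]: "inv_letter p \<noteq> p" "p \<noteq> inv_letter p"
  by (cases p; simp add: inv_letter_def)+

lemma inv_letter_eq_iff [simp]: "inv_letter p = inv_letter q \<longleftrightarrow> p = q"
  by (metis inv_letter_inv_letter)

lemma winv_Nil [simp]: "winv [] = []"
  and winv_Cons: "winv (p # u) = winv u @ [inv_letter p]"
  and winv_append: "winv (u @ v) = winv v @ winv u"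
  and winv_winv [simp]: "winv (winv u) = u"
  and length_winv [simp]: "length (winv u) = length u"
  and winv_eq_Nil [simp]: "winv u = [] \<longleftrightarrow> u = []"
  and fst_set_winv [simp]: "fst ` set (winv u) = fst ` set u"
  by (simp_all add: winv_def rev_map[symmetric] comp_def image_image)

lemma reduced_winv [simp]: "reduced (winv u) \<longleftrightarrow> reduced u"
  using reduced_rev_inv[of u] reduced_rev_inv[of "winv u"] winv_winv[of u]
  by (auto simp: winv_def)

lemma same_letter_cases:
  obtains "fst r \<noteq> fst p" | "r = p" | "r = inv_letter p"
  by (cases r; cases p) (auto simp: inv_letter_def)

lemma reduced_append_iff:
  "reduced (u @ v) \<longleftrightarrow>
    reduced u \<and> reduced v \<and> (u \<noteq> [] \<longrightarrow> v \<noteq> [] \<longrightarrow> hd v \<noteq> inv_letter (last u))"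
  by (auto simp: reduced_def successively_append_iff)

lemma reduced_take: "reduced u \<Longrightarrow> reduced (take c u)"
  by (metis append_take_drop_id reduced_append_iff)

lemma mul_reduced_append: "reduced (u @ v) \<Longrightarrow> foldr push u v = u @ v"
  by (metis append_Nil2 foldr_append foldr_push_Nil reduced_append_iff)

lemma mul_winv_cancel:
  "reduced v \<Longrightarrow> foldr push (winv u) (foldr push u v) = v"
  "reduced v \<Longrightarrow> foldr push u (foldr push (winv u) v) = v"
  using foldr_push_inverse[of v u] foldr_push_inverse[of v "winv u"] winv_winv[of u]
  unfolding winv_def by simp_all

lemma push_Nil: "push p [] = [p]"
  and push_Cons: "push p (q # w) = (if q = inv_letter p then w else p # q # w)"
  by (simp_all add: push_def)

lemma length_push_le: "length (push p w) \<le> Suc (length w)"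
  by (cases w) (auto simp: push_def)

lemma push_length_eq: "length (push p w) = Suc (length w) \<Longrightarrow> push p w = p # w"
  by (cases w) (auto simp: push_Nil push_Cons split: if_splits)

lemma length_mul_le: "length (foldr push u v) \<le> length u + length v"
proof (induction u)
  case (Cons p u)
  then show ?case using length_push_le[of p "foldr push u v"] by simp
qed simp

lemma mul_length_eq:
  "length (foldr push u v) = length u + length v \<Longrightarrow> foldr push u v = u @ v"
proof (induction u)
  case (Cons p u)
  have *: "length (foldr push u v) = length u + length v"
    using Cons.prems length_push_le[of p "foldr push u v"] length_mul_le[of u v] by simp
  then have "foldr push u v = u @ v" by (rule Cons.IH)
  then show ?case using Cons.prems push_length_eq[of p "u @ v"] by simp
qed simp

text \<open>The length of the longest common prefix. Cancellation in the product of \<open>u\<^sup>-\<^sup>1\<close> and \<open>v\<close> removes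
  exactly the common prefix of \<open>u\<close> and \<open>v\<close>, so this function measures all cancellation below.\<close>

fun lcp :: "'a list \<Rightarrow> 'a list \<Rightarrow> nat" where
  "lcp (a # u) (b # v) = (if a = b then Suc (lcp u v) else 0)"
| "lcp _ _ = 0"

lemma lcp_commute: "lcp u v = lcp v u"
  by (induction u v rule: lcp.induct) auto

lemma lcp_le: "lcp u v \<le> length u" "lcp u v \<le> length v"
  by (induction u v rule: lcp.induct) auto

lemma lcp_ge_iff:
  "c \<le> lcp u v \<longleftrightarrow> c \<le> length u \<and> c \<le> length v \<and> take c u = take c v"
proof (induction u v arbitrary: c rule: lcp.induct)
  case (1 a u b v)
  then show ?case by (cases c) auto
qed auto

lemma take_lcp: "take (lcp u v) u = take (lcp u v) v"
  using lcp_ge_iff[of "lcp u v" u v] by simp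

lemma lcp_split:
  obtains s u' v' where "u = s @ u'" "v = s @ v'" "length s = lcp u v"
    "u' \<noteq> [] \<Longrightarrow> v' \<noteq> [] \<Longrightarrow> hd u' \<noteq> hd v'"
proof
  let ?c = "lcp u v"
  show "u = take ?c u @ drop ?c u" "v = take ?c u @ drop ?c v"
    by (simp, subst take_lcp, simp)
  show "length (take ?c u) = ?c" using lcp_le[of u v] by simp
  assume ne: "drop ?c u \<noteq> []" "drop ?c v \<noteq> []"
  show "hd (drop ?c u) \<noteq> hd (drop ?c v)"
  proof
    assume "hd (drop ?c u) = hd (drop ?c v)"
    then have "u ! ?c = v ! ?c" using ne by (simp add: hd_drop_conv_nth)
    then have "Suc ?c \<le> lcp u v"
      using ne take_lcp[of u v] by (subst lcp_ge_iff) (simp add: take_Suc_conv_app_nth)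
    then show False by simp
  qed
qed

lemma lcp_take: "lcp u (take m w) = min m (lcp u w)"
proof (induction u w arbitrary: m rule: lcp.induct)
  case (1 a u b v)
  then show ?case by (cases m) auto
next
  case ("2_2" u)
  then show ?case by (cases u) auto
qed auto

text \<open>A word that agrees with \<open>u\<close> beyond the point where \<open>q\<close> leaves \<open>u\<close> is left by \<open>q\<close> at the same point.\<close>

lemma lcp_take_eq:
  assumes "lcp q u < r" "take r w = take r u" "r \<le> length w" "r \<le> length u"
  shows "lcp q w = lcp q u"
proof (rule antisym)
  have "c \<le> lcp q u" if "c \<le> lcp q w" for c
  proof (rule ccontr)
    assume "\<not> c \<le> lcp q u"
    then have "Suc (lcp q u) \<le> lcp q w" using that by simp
    moreover have "take (Suc (lcp q u)) w = take (Suc (lcp q u)) u"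
      using assms(1,2) by (metis Suc_leI min.absorb1 take_take)
    ultimately have "Suc (lcp q u) \<le> lcp q u"
      using assms by (subst lcp_ge_iff) (auto simp: lcp_ge_iff[of _ q w])
    then show False by simp
  qed
  then show "lcp q w \<le> lcp q u" by simp
  have "take (lcp q u) w = take (lcp q u) u"
    using assms(1,2) by (metis less_imp_le_nat min.absorb1 take_take)
  then show "lcp q u \<le> lcp q w"
    using assms take_lcp[of q u] by (subst lcp_ge_iff) (auto simp: lcp_le)
qed

lemma mul_winv_eq:
  assumes "reduced u" "reduced v"
  shows "foldr push (winv u) v = winv (drop (lcp u v) u) @ drop (lcp u v) v"
proof -
  obtain s u' v' where *: "u = s @ u'" "v = s @ v'" "length s = lcp u v"
    "u' \<noteq> [] \<Longrightarrow> v' \<noteq> [] \<Longrightarrow> hd u' \<noteq> hd v'" by (rule lcp_split[of u v]) blast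
  have r: "reduced s" "reduced u'" "reduced v'" "reduced (s @ v')"
    using assms by (auto simp: * reduced_append_iff)
  have "last (winv u') = inv_letter (hd u')" if "u' \<noteq> []"
    using that by (cases u') (simp_all add: winv_Cons)
  then have "reduced (winv u' @ v')"
    using r *(4) by (auto simp: reduced_append_iff)
  then have "foldr push (winv u') (foldr push (winv s) (s @ v')) = winv u' @ v'"
    using r(3) mul_winv_cancel(1)[of v' s] mul_reduced_append[OF r(4)]
    by (simp add: mul_reduced_append)
  then have "foldr push (winv u) v = winv u' @ v'"
    by (simp add: *(1,2) winv_append)
  then show ?thesis using * by (metis append_eq_conv_conj)
qed

lemma length_mul_winv:
  assumes "reduced u" "reduced v"
  shows "length (foldr push (winv u) v) + 2 * lcp u v = length u + length v"
  using assms lcp_le[of u v] by (simp add: mul_winv_eq)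

text \<open>If half of \<open>w\<close> were shared, the two letters next to the centre of \<open>w\<close> would be inverse to each
  other, or the central letter would be its own inverse.\<close>

lemma lcp_winv:
  assumes "reduced w" "w \<noteq> []"
  shows "2 * lcp w (winv w) < length w"
proof (rule ccontr)
  assume *: "\<not> 2 * lcp w (winv w) < length w"
  have nth: "w ! i = inv_letter (w ! (length w - 1 - i))" if "i < lcp w (winv w)" for i
  proof -
    have "i < length w" using that lcp_le(1) by (rule less_le_trans)
    then have "winv w ! i = inv_letter (w ! (length w - 1 - i))"
      by (simp add: winv_def rev_nth)
    moreover have "w ! i = winv w ! i"
      using that take_lcp by (metis nth_take)
    ultimately show ?thesis by simp
  qed
  have le: "lcp w (winv w) \<le> length w" by (rule lcp_le)
  show False
  proof (cases "even (length w)")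
    case True
    then obtain h where h: "length w = 2 * h" by blast
    then have h0: "h > 0" using assms by (cases h) auto
    then have "w ! (h - 1) = inv_letter (w ! h)"
      using nth[of "h - 1"] * h by simp
    moreover have "w ! Suc (h - 1) \<noteq> inv_letter (w ! (h - 1))"
      using assms(1) h h0 unfolding reduced_def successively_conv_nth
      by (metis Suc_pred' lessI less_add_same_cancel1 mult_2)
    ultimately show False using h0 by simp
  next
    case False
    then obtain h where h: "length w = 2 * h + 1" using oddE by blast
    then have "w ! h = inv_letter (w ! h)" using nth[of h] * by simp
    then show False by simp
  qed
qed

section \<open>Nielsen reduced systems\<close>

definition signed_lift :: "('a \<Rightarrow> 'b word) \<Rightarrow> 'a \<times> bool \<Rightarrow> 'b word"
  where "signed_lift \<phi> p = (if snd p then \<phi> (fst p) else winv (\<phi> (fst p)))"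

definition letter_prod :: "('a \<times> bool \<Rightarrow> 'b word) \<Rightarrow> 'a word \<Rightarrow> 'b word"
  where "letter_prod B w = foldr (\<lambda>p. foldr push (B p)) w []"

lemma letter_prod_Nil [simp]: "letter_prod B [] = []"
  and letter_prod_Cons [simp]: "letter_prod B (p # w) = foldr push (B p) (letter_prod B w)"
  by (simp_all add: letter_prod_def)

lemma reduced_letter_prod [simp]: "reduced (letter_prod B w)"
  by (induction w) (auto intro: reduced_foldr_push)

text \<open>A family of words indexed by letters and their inverses, such as their images under an injective
  homomorphism of free groups.\<close>

locale signed_system =
  fixes P :: "('a \<times> bool) set" and B :: "'a \<times> bool \<Rightarrow> 'b word"
  assumes P_inv: "p \<in> P \<Longrightarrow> inv_letter p \<in> P"
    and B_inv: "p \<in> P \<Longrightarrow> B (inv_letter p) = winv (B p)"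
    and B_reduced: "p \<in> P \<Longrightarrow> reduced (B p)"
    and B_nonempty: "p \<in> P \<Longrightarrow> B p \<noteq> []"
begin

text \<open>Nielsen's length estimate. By \<open>half\<close> and \<open>mid\<close>, cancellation with both neighbours never consumes a
  factor completely, so every factor leaves at least one letter in the product. The hypotheses
  compare prefixes, which correspond to cancellation with the inverse of the neighbour.\<close>

lemma nielsen_reduced_length:
  assumes half: "\<And>p q. p \<in> P \<Longrightarrow> q \<in> P \<Longrightarrow> p \<noteq> q \<Longrightarrow> 2 * lcp (B q) (B p) \<le> length (B p)"
    and mid: "\<And>p q r. p \<in> P \<Longrightarrow> q \<in> P \<Longrightarrow> r \<in> P \<Longrightarrow> q \<noteq> p \<Longrightarrow> r \<noteq> inv_letter p \<Longrightarrow>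
        lcp (B q) (B p) + lcp (B r) (B (inv_letter p)) < length (B p)"
    and w: "reduced w" "set w \<subseteq> P"
  shows "length w \<le> length (letter_prod B w)"
proof -
  \<comment> \<open>Towards the next factor, the product behaves like its first factor, and its length exceeds the
   number of factors by as much as that next factor can still cancel.\<close>
  have "(\<forall>q\<in>P. q \<noteq> p \<longrightarrow> lcp (B q) (letter_prod B (p # w)) = lcp (B q) (B p) \<and>
      Suc (length w) + lcp (B q) (B p) \<le> length (letter_prod B (p # w)))"
    if "reduced (p # w)" "set (p # w) \<subseteq> P" for p w
    using that
  proof (induction w arbitrary: p)
    case Nil
    have "letter_prod B [p] = B p" using Nil B_reduced by (simp add: foldr_push_Nil)
    moreover have "length (B p) \<ge> 1" using Nil B_nonempty[of p] by (cases "B p") auto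
    ultimately show ?case using half[of p] Nil by (fastforce)
  next
    case (Cons p' w)
    define c where "c = lcp (B (inv_letter p)) (B p')"
    have p: "p \<in> P" "inv_letter p \<in> P" "p' \<in> P" "p' \<noteq> inv_letter p"
      using Cons.prems P_inv by (auto simp: reduced_def)
    have IH: "lcp (B (inv_letter p)) (letter_prod B (p' # w)) = c"
      "Suc (length w) + c \<le> length (letter_prod B (p' # w))"
      using Cons.IH[of p'] Cons.prems p reduced_tl[of p "p' # w"] by (auto simp: c_def)
    have eq: "letter_prod B (p # p' # w) = winv (drop c (B (inv_letter p))) @ drop c (letter_prod B (p' # w))"
      using mul_winv_eq[of "B (inv_letter p)" "letter_prod B (p' # w)"] p B_inv[of p] B_reduced IH
      by (simp del: foldr.simps letter_prod_Cons add: letter_prod_Cons[of B p])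
    have le: "c \<le> length (B p)" using lcp_le(1)[of "B (inv_letter p)" "B p'"] B_inv[of p] p
      by (simp add: c_def)
    have tk: "winv (drop c (B (inv_letter p))) = take (length (B p) - c) (B p)"
      using B_inv[of p] p by (simp add: winv_def drop_map drop_rev rev_map comp_def)
    show ?case
    proof (intro ballI impI)
      fix q assume q: "q \<in> P" "q \<noteq> p"
      have N2: "lcp (B q) (B p) + c < length (B p)"
        using mid[of p q p'] p q lcp_commute[of "B p'"] by (simp add: c_def)
      have len: "length (letter_prod B (p # p' # w)) = length (B p) - c + (length (letter_prod B (p' # w)) - c)"
        unfolding eq tk by simp
      have "lcp (B q) (letter_prod B (p # p' # w)) = lcp (B q) (B p)"
        by (rule lcp_take_eq[of _ _ "length (B p) - c"])
          (use N2 len eq tk in \<open>simp_all del: letter_prod_Cons\<close>)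
      then show "lcp (B q) (letter_prod B (p # p' # w)) = lcp (B q) (B p) \<and>
          Suc (length (p' # w)) + lcp (B q) (B p) \<le> length (letter_prod B (p # p' # w))"
        using len N2 IH(2) le by simp
    qed
  qed
  note main = this
  show ?thesis
  proof (cases w)
    case (Cons p w')
    have "inv_letter p \<in> P" using w(2) Cons P_inv by simp
    then show ?thesis using main[of p w'] w Cons by fastforce
  qed simp
qed

end

section \<open>Endomorphisms given by the images of the generators\<close>

lemma carrier_free_group: "w \<in> carrier (free_group S) \<longleftrightarrow> reduced w \<and> fst ` set w \<subseteq> S"
  and mult_free_group: "u \<otimes>\<^bsub>free_group S\<^esub> v = foldr push u v"
  and one_free_group: "\<one>\<^bsub>free_group S\<^esub> = []"
  by (auto simp: free_group_def)

lemma winv_closed: "u \<in> carrier (free_group S) \<Longrightarrow> winv u \<in> carrier (free_group S)"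
  by (auto simp: carrier_free_group)

lemma mul_closed:
  "u \<in> carrier (free_group S) \<Longrightarrow> v \<in> carrier (free_group S) \<Longrightarrow>
    foldr push u v \<in> carrier (free_group S)"
  using monoid.m_closed[OF group.is_monoid[OF group_free_group]] by (metis mult_free_group)

lemma inv_free_group:
  assumes "u \<in> carrier (free_group S)"
  shows "inv\<^bsub>free_group S\<^esub> u = winv u"
proof -
  interpret group "free_group S" by (rule group_free_group)
  have "foldr push (winv u) u = []"
    using assms mul_winv_cancel(1)[of "[]" u] by (simp add: carrier_free_group foldr_push_Nil)
  then show ?thesis
    using assms by (intro inv_equality) (simp_all add: mult_free_group one_free_group winv_closed)
qed

lemma singleton_in_free_group [simp]: "[p] \<in> carrier (free_group S) \<longleftrightarrow> fst p \<in> S"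
  by (simp add: carrier_free_group reduced_def)

text \<open>The value of \<open>free_lift\<close> computed on words, without reference to a carrier. On concrete words it is
  evaluated by rewriting, which is how the identities between automorphisms are checked below.\<close>

definition wlift :: "('a \<Rightarrow> 'b word) \<Rightarrow> 'a word \<Rightarrow> 'b word"
  where "wlift \<phi> = letter_prod (signed_lift \<phi>)"

lemma wlift_Nil [simp]: "wlift \<phi> [] = []"
  and wlift_Cons: "wlift \<phi> (p # w) = foldr push (signed_lift \<phi> p) (wlift \<phi> w)"
  by (simp_all add: wlift_def)

lemma reduced_wlift [simp]: "reduced (wlift \<phi> w)"
  by (simp add: wlift_def)

definition endo :: "'a set \<Rightarrow> ('a \<Rightarrow> 'a word) \<Rightarrow> 'a word \<Rightarrow> 'a word"
  where "endo S \<phi> = restrict (free_lift (free_group S) \<phi>) (carrier (free_group S))"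

abbreviation adm :: "'a set \<Rightarrow> ('a \<Rightarrow> 'a word) \<Rightarrow> bool"
  where "adm S \<phi> \<equiv> \<phi> \<in> S \<rightarrow> carrier (free_group S)"

lemma free_lift_eq_wlift:
  assumes "adm S \<phi>" "fst ` set w \<subseteq> S"
  shows "free_lift (free_group S) \<phi> w = wlift \<phi> w"
  using assms(2)
proof (induction w)
  case Nil
  then show ?case by (simp add: free_lift_def one_free_group)
next
  case (Cons p w)
  then have "\<phi> (fst p) \<in> carrier (free_group S)" using assms(1) by auto
  then show ?case
    using Cons
    by (simp add: group.free_lift_Cons[OF group_free_group] wlift_Cons signed_lift_def inv_free_group
        mult_free_group)
qed

lemma endo_apply: "adm S \<phi> \<Longrightarrow> w \<in> carrier (free_group S) \<Longrightarrow> endo S \<phi> w = wlift \<phi> w"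
  by (simp add: endo_def free_lift_eq_wlift carrier_free_group)

lemma free_lift_cong: "(\<And>a. a \<in> fst ` set w \<Longrightarrow> \<phi> a = \<psi> a) \<Longrightarrow> free_lift G \<phi> w = free_lift G \<psi> w"
  by (induction w) (auto simp: free_lift_def)

lemma endo_cong: "(\<And>a. a \<in> S \<Longrightarrow> \<phi> a = \<psi> a) \<Longrightarrow> endo S \<phi> = endo S \<psi>"
  unfolding endo_def
  by (intro restrict_ext free_lift_cong) (auto simp: carrier_free_group)

lemma endo_hom: "adm S \<phi> \<Longrightarrow> endo S \<phi> \<in> hom (free_group S) (free_group S)"
  using group.free_lift_hom[OF group_free_group, of \<phi> S S]
  by (simp add: endo_def hom_def monoid.m_closed[OF group.is_monoid[OF group_free_group]] Pi_def)

lemma gen_closed [simp]: "a \<in> S \<Longrightarrow> gen a \<in> carrier (free_group S)"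
  by (rule gen_in_free_group)

lemma wlift_gen: "a \<in> S \<Longrightarrow> adm S \<phi> \<Longrightarrow> wlift \<phi> (gen a) = \<phi> a"
  by (auto simp: gen_def wlift_Cons signed_lift_def foldr_push_Nil carrier_free_group Pi_def)

lemma endo_gen: "a \<in> S \<Longrightarrow> adm S \<phi> \<Longrightarrow> endo S \<phi> (gen a) = \<phi> a"
  by (simp add: endo_apply wlift_gen)

lemma endo_closed: "adm S \<phi> \<Longrightarrow> w \<in> carrier (free_group S) \<Longrightarrow> endo S \<phi> w \<in> carrier (free_group S)"
  using endo_hom[of \<phi> S] by (auto simp: hom_def)

lemma wlift_closed: "adm S \<phi> \<Longrightarrow> w \<in> carrier (free_group S) \<Longrightarrow> wlift \<phi> w \<in> carrier (free_group S)"
  using endo_closed[of \<phi> S w] by (simp add: endo_apply)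

lemma hom_eq_on_gens:
  assumes "f \<in> hom (free_group S) G" "g \<in> hom (free_group S) G" "group G"
    "\<And>a. a \<in> S \<Longrightarrow> f (gen a) = g (gen a)" "w \<in> carrier (free_group S)"
  shows "f w = g w"
  using group.hom_free_group_eqI[OF assms(3,1,2,4,5)] by blast

lemma auto_eq_endo:
  assumes f: "f \<in> auto (free_group S)"
  shows "adm S (\<lambda>a. f (gen a))" "f = endo S (\<lambda>a. f (gen a))"
proof -
  show adm: "adm S (\<lambda>a. f (gen a))" by (simp add: auto_closed[OF f])
  show "f = endo S (\<lambda>a. f (gen a))"
  proof
    fix w
    show "f w = endo S (\<lambda>a. f (gen a)) w"
    proof (cases "w \<in> carrier (free_group S)")
      case True
      then show ?thesis
        by (intro hom_eq_on_gens[OF auto_homD[OF f] endo_hom[OF adm] group_free_group _ True])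
          (simp add: endo_gen adm)
    next
      case False
      then show ?thesis
        using f by (auto simp: auto_def Bij_def endo_def extensional_def)
    qed
  qed
qed

lemma endo_comp:
  assumes "adm S \<phi>" "adm S \<psi>"
  shows "compose (carrier (free_group S)) (endo S \<phi>) (endo S \<psi>) = endo S (\<lambda>a. wlift \<phi> (\<psi> a))"
proof
  fix w
  let ?C = "carrier (free_group S)"
  have adm: "adm S (\<lambda>a. wlift \<phi> (\<psi> a))"
    using assms wlift_closed[OF assms(1)] by (simp add: Pi_iff)
  show "compose ?C (endo S \<phi>) (endo S \<psi>) w = endo S (\<lambda>a. wlift \<phi> (\<psi> a)) w"
  proof (cases "w \<in> ?C")
    case True
    have h: "endo S \<phi> \<circ> endo S \<psi> \<in> hom (free_group S) (free_group S)"
      by (rule Group.hom_compose[OF endo_hom endo_hom]) (rule assms)+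
    have "(endo S \<phi> \<circ> endo S \<psi>) w = endo S (\<lambda>a. wlift \<phi> (\<psi> a)) w"
      by (rule hom_eq_on_gens[OF h endo_hom[OF adm] group_free_group _ True])
        (use endo_gen[OF _ assms(2)] endo_gen[OF _ adm] endo_apply[OF assms(1)] assms(2) in
          \<open>simp add: Pi_iff\<close>)
    then show ?thesis using True by (simp add: compose_eq)
  qed (simp add: compose_def endo_def)
qed

lemma endo_id: "endo S gen = (\<lambda>x\<in>carrier (free_group S). x)"
proof
  fix w
  have adm: "adm S gen" by simp
  have id: "(\<lambda>w. w) \<in> hom (free_group S) (free_group S)" by (auto simp: hom_def)
  show "endo S gen w = (\<lambda>x\<in>carrier (free_group S). x) w"
  proof (cases "w \<in> carrier (free_group S)")
    case True
    then have "endo S gen w = w"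
      by (intro hom_eq_on_gens[OF endo_hom[OF adm] id group_free_group _ True])
        (simp add: endo_gen)
    then show ?thesis using True by simp
  qed (simp add: endo_def)
qed

lemma endo_auto:
  assumes "adm S \<phi>" "adm S \<psi>"
    and "\<And>a. a \<in> S \<Longrightarrow> wlift \<phi> (\<psi> a) = gen a" "\<And>a. a \<in> S \<Longrightarrow> wlift \<psi> (\<phi> a) = gen a"
  shows "endo S \<phi> \<in> auto (free_group S)"
proof -
  let ?C = "carrier (free_group S)"
  have "compose ?C (endo S \<phi>) (endo S \<psi>) = (\<lambda>x\<in>?C. x)"
    "compose ?C (endo S \<psi>) (endo S \<phi>) = (\<lambda>x\<in>?C. x)"
    unfolding endo_id[symmetric] using assms by (auto simp: endo_comp intro: endo_cong)
  then have *: "endo S \<phi> (endo S \<psi> w) = w" "endo S \<psi> (endo S \<phi> w) = w" if "w \<in> ?C" for w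
    using that by (metis compose_eq restrict_apply')+
  have "bij_betw (endo S \<phi>) ?C ?C"
    by (rule bij_betw_byWitness[where f' = "endo S \<psi>"])
      (use * assms in \<open>auto simp: endo_closed\<close>)
  moreover have "endo S \<phi> \<in> extensional ?C" by (simp add: endo_def)
  ultimately show ?thesis
    using endo_hom[OF assms(1)] by (simp add: auto_def Bij_def)
qed

abbreviation AG :: "'a set \<Rightarrow> ('a word \<Rightarrow> 'a word) monoid"
  where "AG S \<equiv> AutoGroup (free_group S)"

abbreviation endoF :: "nat \<Rightarrow> nat \<Rightarrow> (letter \<Rightarrow> letter word) \<Rightarrow> letter word \<Rightarrow> letter word"
  where "endoF n k \<equiv> endo (XY_set n k)"

abbreviation AF :: "nat \<Rightarrow> nat \<Rightarrow> (letter word \<Rightarrow> letter word) monoid"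
  where "AF n k \<equiv> AG (XY_set n k)"

abbreviation conjugateF where
  "conjugateF n k p q \<equiv> p \<otimes>\<^bsub>AF n k\<^esub> q \<otimes>\<^bsub>AF n k\<^esub> inv\<^bsub>AF n k\<^esub> p"

lemma group_AG: "group (AG S)"
  by (rule group.AutoGroup[OF group_free_group])

lemma AG_mult:
  assumes "endo S \<phi> \<in> auto (free_group S)" "endo S \<psi> \<in> auto (free_group S)"
    "adm S \<phi>" "adm S \<psi>"
  shows "endo S \<phi> \<otimes>\<^bsub>AG S\<^esub> endo S \<psi> = endo S (\<lambda>a. wlift \<phi> (\<psi> a))"
  using assms by (simp add: AutoGroup_mult endo_comp)

lemma endo_mult_in_subgroup:
  assumes "subgroup H (AG S)" "endo S \<phi> \<in> H" "endo S \<psi> \<in> H" "adm S \<phi>" "adm S \<psi>"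
    "\<And>a. a \<in> S \<Longrightarrow> \<chi> a = wlift \<phi> (\<psi> a)"
  shows "endo S \<chi> \<in> H"
proof -
  have "endo S \<phi> \<otimes>\<^bsub>AG S\<^esub> endo S \<psi> \<in> H"
    using assms(1-3) by (rule subgroup.m_closed)
  moreover have "endo S \<phi> \<otimes>\<^bsub>AG S\<^esub> endo S \<psi> = endo S \<chi>"
    using assms subgroup.mem_carrier[OF assms(1)] by (auto simp: AG_mult intro!: endo_cong)
  ultimately show ?thesis by simp
qed

lemma endo_inv:
  assumes "endo S \<phi> \<in> auto (free_group S)" "adm S \<phi>" "adm S \<psi>"
    "\<And>a. a \<in> S \<Longrightarrow> wlift \<phi> (\<psi> a) = gen a"
  shows "inv\<^bsub>AG S\<^esub> (endo S \<phi>) = endo S \<psi>"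
proof
  fix w
  let ?C = "carrier (free_group S)" and ?i = "inv\<^bsub>AG S\<^esub> (endo S \<phi>)"
  interpret A: group "AG S" by (rule group_AG)
  have i: "?i \<in> auto (free_group S)" using A.inv_closed[of "endo S \<phi>"] assms(1) by simp
  show "?i w = endo S \<psi> w"
  proof (cases "w \<in> ?C")
    case True
    have "endo S \<phi> (endo S \<psi> w) = compose ?C (endo S \<phi>) (endo S \<psi>) w"
      using True by (simp add: compose_eq)
    also have "\<dots> = endo S gen w"
      using assms by (auto simp: endo_comp cong: endo_cong)
    also have "\<dots> = w" using True by (simp add: endo_id)
    finally have "endo S \<phi> (endo S \<psi> w) = w" .
    then show ?thesis
      using AutoGroup_inv_apply[OF group_free_group assms(1), of "endo S \<psi> w"]
        endo_closed[OF assms(3) True] by simp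
  next
    case False
    then show ?thesis using i by (auto simp: auto_def Bij_def endo_def extensional_def)
  qed
qed

lemma endo_inv_in_subgroup:
  assumes "subgroup H (AG S)" "endo S \<phi> \<in> H" "adm S \<phi>" "adm S \<psi>"
    "\<And>a. a \<in> S \<Longrightarrow> wlift \<phi> (\<psi> a) = gen a"
  shows "endo S \<psi> \<in> H"
proof -
  have "endo S \<phi> \<in> auto (free_group S)" using subgroup.mem_carrier[OF assms(1,2)] by simp
  then have "inv\<^bsub>AG S\<^esub> (endo S \<phi>) = endo S \<psi>" using assms by (intro endo_inv) auto
  then show ?thesis using subgroup.m_inv_closed[OF assms(1,2)] by simp
qed

text \<open>Conjugating by a substitution with known inverse \<open>\<phi>'\<close> is again a substitution, so a statement about
  conjugates turns into a computation with words.\<close>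

lemma endo_conj:
  assumes "endo S \<phi> \<in> auto (free_group S)" "adm S \<phi>" "adm S \<phi>'"
    "\<And>a. a \<in> S \<Longrightarrow> wlift \<phi> (\<phi>' a) = gen a"
    "endo S \<psi> \<in> auto (free_group S)" "adm S \<psi>"
  shows "endo S \<phi> \<otimes>\<^bsub>AG S\<^esub> endo S \<psi> \<otimes>\<^bsub>AG S\<^esub> inv\<^bsub>AG S\<^esub> (endo S \<phi>) =
    endo S (\<lambda>a. wlift \<phi> (wlift \<psi> (\<phi>' a)))"
proof -
  interpret A: group "AG S" by (rule group_AG)
  have inv: "inv\<^bsub>AG S\<^esub> (endo S \<phi>) = endo S \<phi>'" using assms by (intro endo_inv) auto
  have i: "endo S \<phi>' \<in> auto (free_group S)"
    using A.inv_closed[of "endo S \<phi>"] assms(1) inv by simp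
  have adm: "adm S (\<lambda>a. wlift \<psi> (\<phi>' a))" using assms by (auto simp: wlift_closed Pi_iff)
  have e: "endo S \<psi> \<otimes>\<^bsub>AG S\<^esub> endo S \<phi>' = endo S (\<lambda>a. wlift \<psi> (\<phi>' a))"
    using assms i by (simp add: AG_mult)
  have ea: "endo S (\<lambda>a. wlift \<psi> (\<phi>' a)) \<in> auto (free_group S)"
    using A.m_closed[of "endo S \<psi>" "endo S \<phi>'"] assms(5) i unfolding e by simp
  show ?thesis
    unfolding inv using assms(1,5) i
    by (simp add: A.m_assoc e AG_mult[OF assms(1) ea assms(2) adm])
qed

section \<open>Generating sets normalized by another set\<close>

text \<open>It suffices to conjugate generators by generators. Closure of \<open>P\<close> under inverses matters: conjugation
  by \<open>p\<close> alone could map \<open>\<langle>Q\<rangle>\<close> to a proper subgroup of itself.\<close>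

lemma generate_conj_closed:
  fixes G (structure)
  assumes "group G" "P \<subseteq> carrier G" "Q \<subseteq> carrier G"
    and inv: "\<And>p. p \<in> P \<Longrightarrow> inv\<^bsub>G\<^esub> p \<in> P"
    and conj: "\<And>p q. p \<in> P \<Longrightarrow> q \<in> Q \<Longrightarrow> p \<otimes>\<^bsub>G\<^esub> q \<otimes>\<^bsub>G\<^esub> inv\<^bsub>G\<^esub> p \<in> generate G Q"
    and "g \<in> generate G P" "h \<in> generate G Q"
  shows "g \<otimes>\<^bsub>G\<^esub> h \<otimes>\<^bsub>G\<^esub> inv\<^bsub>G\<^esub> g \<in> generate G Q"
proof -
  interpret group G by fact
  note gc = generate_in_carrier[OF assms(2)] generate_in_carrier[OF assms(3)]
  have P1: "p \<otimes> h \<otimes> inv p \<in> generate G Q" if p: "p \<in> P" and h: "h \<in> generate G Q" for p h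
    using h
  proof induction
    case one
    have "p \<in> carrier G" using p assms(2) by auto
    then show ?case by (simp add: generate.one)
  next
    case (incl h)
    then show ?case by (rule conj[OF p])
  next
    case (inv h)
    have c: "p \<in> carrier G" "h \<in> carrier G" using p inv assms(2,3) by auto
    have "inv (p \<otimes> h \<otimes> inv p) \<in> generate G Q"
      using conj[OF p inv] assms(3) by (simp add: generate_m_inv_closed)
    then show ?case using c by (simp add: inv_mult_group m_assoc)
  next
    case (eng h1 h2)
    have c: "p \<in> carrier G" "h1 \<in> carrier G" "h2 \<in> carrier G" using p eng assms(2) gc by auto
    have "p \<otimes> (h1 \<otimes> h2) \<otimes> inv p = (p \<otimes> h1 \<otimes> inv p) \<otimes> (p \<otimes> h2 \<otimes> inv p)"
      using c by (simp add: m_assoc) (simp add: m_assoc[symmetric])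
    then show ?case using eng by (simp add: generate.eng)
  qed
  from assms(6,7) show ?thesis
  proof (induction arbitrary: h)
    case one
    then show ?case using gc by simp
  next
    case (incl p)
    then show ?case using P1 by blast
  next
    case (inv p)
    then show ?case using P1[OF assms(4)] by blast
  next
    case (eng g1 g2)
    have c: "g1 \<in> carrier G" "g2 \<in> carrier G" "h \<in> carrier G" using eng gc by auto
    have "g1 \<otimes> g2 \<otimes> h \<otimes> inv (g1 \<otimes> g2) = g1 \<otimes> (g2 \<otimes> h \<otimes> inv g2) \<otimes> inv g1"
      using c by (simp add: m_assoc inv_mult_group)
    then show ?case using eng by simp
  qed
qed

text \<open>In a product of elements of \<open>P\<close> and \<open>Q\<close>, those of \<open>P\<close> can be moved to the left.\<close>

lemma generate_Un_decomp:
  fixes G (structure)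
  assumes "group G" "P \<subseteq> carrier G" "Q \<subseteq> carrier G"
    and inv: "\<And>p. p \<in> P \<Longrightarrow> inv\<^bsub>G\<^esub> p \<in> P"
    and conj: "\<And>p q. p \<in> P \<Longrightarrow> q \<in> Q \<Longrightarrow> p \<otimes>\<^bsub>G\<^esub> q \<otimes>\<^bsub>G\<^esub> inv\<^bsub>G\<^esub> p \<in> generate G Q"
    and f: "f \<in> generate G (P \<union> Q)"
  obtains g h where "g \<in> generate G P" "h \<in> generate G Q" "f = g \<otimes>\<^bsub>G\<^esub> h" "f \<otimes>\<^bsub>G\<^esub> inv\<^bsub>G\<^esub> h = g"
proof -
  interpret group G by fact
  note gc = generate_in_carrier[OF assms(2)] generate_in_carrier[OF assms(3)]
  have step: "\<exists>g\<in>generate G P. \<exists>h\<in>generate G Q. x = g \<otimes> h"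
    if "x \<in> generate G P \<or> x \<in> generate G Q" for x
    using that gc by (metis generate.one l_one r_one)
  from f have "\<exists>g\<in>generate G P. \<exists>h\<in>generate G Q. f = g \<otimes> h"
  proof induction
    case one
    then show ?case by (intro step) (auto intro: generate.intros)
  next
    case (incl h)
    then show ?case by (intro step) (auto intro: generate.intros)
  next
    case (inv h)
    then show ?case by (intro step) (auto intro: generate.intros)
  next
    case (eng f1 f2)
    then obtain g1 h1 g2 h2 where 1: "g1 \<in> generate G P" "h1 \<in> generate G Q" "f1 = g1 \<otimes> h1"
      "g2 \<in> generate G P" "h2 \<in> generate G Q" "f2 = g2 \<otimes> h2" by blast
    have c: "g1 \<in> carrier G" "g2 \<in> carrier G" "h1 \<in> carrier G" "h2 \<in> carrier G"
      using 1 gc by auto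
    have "f1 \<otimes> f2 = (g1 \<otimes> g2) \<otimes> ((inv g2 \<otimes> h1 \<otimes> inv (inv g2)) \<otimes> h2)"
      using c by (simp add: 1 m_assoc) (simp add: m_assoc[symmetric])
    moreover have "inv g2 \<otimes> h1 \<otimes> inv (inv g2) \<in> generate G Q"
      by (rule generate_conj_closed[OF assms(1-5)]) (use 1 assms(2) generate_m_inv_closed in auto)
    ultimately show ?case using 1 by (metis generate.eng)
  qed
  then obtain g h where gh: "g \<in> generate G P" "h \<in> generate G Q" "f = g \<otimes> h" by blast
  then have "f \<otimes> inv h = g" using gc by (simp add: m_assoc)
  with gh show thesis by (rule that)
qed

section \<open>Nielsen reduction of automorphisms preserving the classes of the y\<close>

lemma conj_class_iff:
  assumes "reduced z"
  shows "w \<in> conj_class (free_group S) z \<longleftrightarrow>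
    (\<exists>c\<in>carrier (free_group S). w = foldr push c (foldr push z (winv c)))"
proof -
  have "g \<otimes>\<^bsub>free_group S\<^esub> z \<otimes>\<^bsub>free_group S\<^esub> inv\<^bsub>free_group S\<^esub> g =
      foldr push g (foldr push z (winv g))" if "g \<in> carrier (free_group S)" for g
    using that unfolding inv_free_group[OF that] mult_free_group
    by (intro foldr_push_assoc) (simp add: carrier_free_group)
  then show ?thesis unfolding conj_class_def mem_Collect_eq by metis
qed

lemma conj_class_eqI:
  assumes "group G" "z \<in> carrier G" "w \<in> conj_class G z"
  shows "conj_class G w = conj_class G z"
proof -
  interpret group G by fact
  have sub: "conj_class G v \<subseteq> conj_class G u" if u: "u \<in> carrier G" and v: "v \<in> conj_class G u" for u v
  proof
    fix t assume "t \<in> conj_class G v"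
    then obtain c d where cd: "c \<in> carrier G" "d \<in> carrier G"
      and t: "t = d \<otimes>\<^bsub>G\<^esub> (c \<otimes>\<^bsub>G\<^esub> u \<otimes>\<^bsub>G\<^esub> inv\<^bsub>G\<^esub> c) \<otimes>\<^bsub>G\<^esub> inv\<^bsub>G\<^esub> d"
      using v by (auto simp: conj_class_def)
    then have "t = (d \<otimes>\<^bsub>G\<^esub> c) \<otimes>\<^bsub>G\<^esub> u \<otimes>\<^bsub>G\<^esub> inv\<^bsub>G\<^esub> (d \<otimes>\<^bsub>G\<^esub> c)"
      using u by (simp add: m_assoc inv_mult_group)
    then show "t \<in> conj_class G u" using cd by (auto simp: conj_class_def)
  qed
  obtain c where c: "c \<in> carrier G" "w = c \<otimes>\<^bsub>G\<^esub> z \<otimes>\<^bsub>G\<^esub> inv\<^bsub>G\<^esub> c"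
    using assms(3) by (auto simp: conj_class_def)
  then have "z = inv\<^bsub>G\<^esub> c \<otimes>\<^bsub>G\<^esub> w \<otimes>\<^bsub>G\<^esub> inv\<^bsub>G\<^esub> (inv\<^bsub>G\<^esub> c)"
    using assms(2) by (simp add: m_assoc) (simp add: m_assoc[symmetric])
  then have "z \<in> conj_class G w"
    unfolding conj_class_def using c(1) by (intro CollectI exI[of _ "inv\<^bsub>G\<^esub> c"]) simp
  then show ?thesis using sub[OF assms(2,3)] sub[of w z] c assms(2) by simp
qed

lemma A_set_iff:
  "f \<in> A_set n k \<longleftrightarrow> f \<in> auto (F n k) \<and>
    (\<forall>i\<in>{1..k}. f (gen (Y i)) \<in> conj_class (F n k) (gen (Y i)))"
proof -
  have "conj_class (F n k) (f (gen (Y i))) = conj_class (F n k) (gen (Y i)) \<longleftrightarrow>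
      f (gen (Y i)) \<in> conj_class (F n k) (gen (Y i))"
    if "f \<in> auto (F n k)" "i \<in> {1..k}" for i
    using conj_class_eqI[OF group_free_group gen_Y_in_F[OF that(2)]]
      conj_class_self[OF group_free_group auto_closed[OF that(1) gen_Y_in_F[OF that(2)]]] by metis
  then show ?thesis by (auto simp: A_set_def)
qed

text \<open>Trailing powers of \<open>p\<close> in the conjugating word commute with \<open>p\<close> and can be dropped; what remains
  does not cancel against \<open>p\<close>.\<close>

lemma conj_letter_form:
  assumes "reduced c"
  shows "\<exists>g. foldr push c (push p (winv c)) = g @ [p] @ winv g"
  using assms
proof (induction c rule: rev_induct)
  case (snoc q c)
  have c: "reduced c" "reduced (winv c)" using snoc.prems by (auto simp: reduced_append_iff)
  consider "q = p" | "q = inv_letter p" | "q \<noteq> p" "q \<noteq> inv_letter p" by blast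
  then show ?case
  proof cases
    case 1
    then show ?thesis
      using snoc.IH c push_push_inv[of "winv c" p]
      by (simp add: winv_append winv_Cons push_Cons)
  next
    case 2
    have "reduced (p # winv c)" using snoc.prems reduced_winv[of "c @ [q]"] 2
      by (simp add: winv_append winv_Cons)
    then have "push p (winv c) = p # winv c" by (rule push_reduced)
    then show ?thesis
      using snoc.IH c 2 by (simp add: winv_append winv_Cons push_Cons)
  next
    case 3
    have r: "reduced (c @ [q])" "reduced (winv (c @ [q]))" using snoc.prems by auto
    have "reduced ((c @ [q]) @ [p] @ winv (c @ [q]))"
      using r 3 unfolding reduced_append_iff[of "c @ [q]"] reduced_append_iff[of "[p]"]
      by (auto simp: winv_append winv_Cons reduced_def)
    moreover have "push p (winv (c @ [q])) = [p] @ winv (c @ [q])"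
      using push_reduced[of p "winv (c @ [q])"] calculation reduced_tl[of q "p # winv (c @ [q])"]
      by (simp add: reduced_append_iff[of c] reduced_append_iff[of "[q]"])
    ultimately have "foldr push (c @ [q]) (push p (winv (c @ [q]))) = (c @ [q]) @ [p] @ winv (c @ [q])"
      by (metis mul_reduced_append)
    then show ?thesis by blast
  qed
qed (simp add: push_Nil exI[of _ "[]"])

text \<open>The first half without the central letter. For a conjugate \<open>g p g\<^sup>-\<^sup>1\<close> this is \<open>g\<close>.\<close>

definition half :: "'a list \<Rightarrow> 'a list"
  where "half w = take (length w div 2) w"

lemma half_conj: "half (g @ [p] @ winv g) = g"
  by (simp add: half_def)

abbreviation letters :: "nat \<Rightarrow> nat \<Rightarrow> (letter \<times> bool) set"
  where "letters n k \<equiv> XY_set n k \<times> UNIV"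

lemma finite_letters: "finite (letters n k)"
  by (simp add: XY_set_def X_set_def Y_set_def)

lemma set_subset_letters: "w \<in> carrier (F n k) \<Longrightarrow> set w \<subseteq> letters n k"
  by (auto simp: carrier_free_group image_subset_iff dest!: bspec)

lemma XY_cases:
  assumes "a \<in> XY_set n k"
  obtains i where "a = X i" "a \<in> X_set n" | i where "a = Y i" "i \<in> {1..k}"
  using assms by (auto simp: XY_set_def X_set_def Y_set_def)

definition perm_subst :: "nat \<Rightarrow> nat \<Rightarrow> (letter \<Rightarrow> letter word) \<Rightarrow> bool"
  where "perm_subst n k \<phi> \<longleftrightarrow> (\<forall>i\<in>{1..k}. \<phi> (Y i) = gen (Y i)) \<and>
    (\<forall>a\<in>X_set n. \<exists>b\<in>X_set n. \<exists>e. \<phi> a = [(b, e)])"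

text \<open>The second substitution is the inverse of the first one; requiring it to be of the same kind makes
  the set visibly closed under inverses.\<close>

definition signed_perms :: "nat \<Rightarrow> nat \<Rightarrow> (letter word \<Rightarrow> letter word) set"
  where "signed_perms n k = {endoF n k \<phi> | \<phi> \<phi>'. perm_subst n k \<phi> \<and> perm_subst n k \<phi>' \<and>
    (\<forall>a\<in>XY_set n k. wlift \<phi> (\<phi>' a) = gen a \<and> wlift \<phi>' (\<phi> a) = gen a)}"

text \<open>The Nielsen moves available in \<open>A\<close>: the signed letter \<open>p\<close> goes to \<open>q\<^sup>-\<^sup>1 p\<close> if it belongs to an \<open>x\<close>,
  and to \<open>q\<^sup>-\<^sup>1 p q\<close> if it belongs to a \<open>y\<close>. As a substitution is given on positive letters, a
  negative \<open>p\<close> over an \<open>x\<close> results in \<open>x \<mapsto> x q\<close>.\<close>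

definition move :: "letter \<times> bool \<Rightarrow> letter \<times> bool \<Rightarrow> letter \<Rightarrow> letter word"
  where "move p q = gen(fst p := (case fst p of
      X _ \<Rightarrow> if snd p then [inv_letter q, p] else [inv_letter p, q]
    | Y _ \<Rightarrow> [inv_letter q, (fst p, True), q]))"

lemma word_closed_Cons: "reduced (p # q # w) \<longleftrightarrow> q \<noteq> inv_letter p \<and> reduced (q # w)"
  "reduced [p]"
  by (auto simp: reduced_def)

lemma adm_move:
  assumes "p \<in> letters n k" "q \<in> letters n k" "fst p \<noteq> fst q"
  shows "adm (XY_set n k) (move p q)"
proof
  fix a assume a: "a \<in> XY_set n k"
  have ne: "q \<noteq> p" "q \<noteq> inv_letter p" "p \<noteq> inv_letter q" using assms(3) by auto
  show "move p q a \<in> carrier (F n k)"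
    using assms a ne by (cases p; cases "fst p")
      (auto simp: move_def carrier_free_group word_closed_Cons inv_letter_def gen_def)
qed

lemma move_inverse:
  assumes "fst p \<noteq> fst q"
  shows "wlift (move p q) (move p (inv_letter q) a) = gen a"
  using assms by (cases p; cases q; cases "fst p"; cases "snd p"; cases "snd q")
    (auto simp: move_def wlift_Cons signed_lift_def push_Nil push_Cons winv_Cons gen_def inv_letter_def)

lemma move_in_A_set:
  assumes "p \<in> letters n k" "q \<in> letters n k" "fst p \<noteq> fst q"
  shows "endoF n k (move p q) \<in> A_set n k"
  unfolding A_set_iff
proof (intro conjI ballI)
  have q': "inv_letter q \<in> letters n k" using assms by (auto simp: mem_Times_iff)
  show "endoF n k (move p q) \<in> auto (F n k)"
    by (rule endo_auto[of _ _ "move p (inv_letter q)"])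
      (use assms q' move_inverse[of p q] move_inverse[of p "inv_letter q"] in \<open>simp_all add: adm_move\<close>)
  fix i assume i: "i \<in> {1..k}"
  then have "Y i \<in> XY_set n k" by (auto simp: XY_set_def Y_set_def)
  then have e: "endoF n k (move p q) (gen (Y i)) = move p q (Y i)"
    by (rule endo_gen) (rule adm_move[OF assms])
  have "reduced (gen (Y i))" by (simp add: gen_def reduced_def)
  show "endoF n k (move p q) (gen (Y i)) \<in> conj_class (F n k) (gen (Y i))"
  proof (cases "fst p = Y i")
    case True
    have "move p q (Y i) = foldr push [inv_letter q] (foldr push (gen (Y i)) (winv [inv_letter q]))"
      using True assms(3) by (cases q)
        (auto simp: move_def push_Nil push_Cons gen_def winv_Cons inv_letter_def)
    moreover have "[inv_letter q] \<in> carrier (F n k)" using assms(2) by auto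
    ultimately show ?thesis unfolding e conj_class_iff[OF \<open>reduced (gen (Y i))\<close>] by blast
  next
    case False
    then have "move p q (Y i) = gen (Y i)" by (simp add: move_def)
    then show ?thesis
      unfolding e using conj_class_self[OF group_free_group gen_Y_in_F[OF i]] by simp
  qed
qed

text \<open>Reading words as numbers in base \<open>b\<close> gives a linear order on words of a fixed length that is
  compatible with appending a common suffix. Ties in length are broken by this order.\<close>

locale letter_coding =
  fixes n k :: nat and code :: "letter \<times> bool \<Rightarrow> nat" and b :: nat
  assumes code_inj: "inj_on code (letters n k)"
    and code_less: "p \<in> letters n k \<Longrightarrow> code p < b"
begin

abbreviation "L \<equiv> letters n k"

definition lex_value :: "letter word \<Rightarrow> nat"
  where "lex_value w = foldl (\<lambda>s p. s * b + code p) 0 w"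

lemma lex_value_snoc: "lex_value (u @ [p]) = lex_value u * b + code p"
  by (simp add: lex_value_def)

lemma lex_value_append: "lex_value (u @ w) = lex_value u * b ^ length w + lex_value w"
proof (induction w rule: rev_induct)
  case (snoc p w)
  then show ?case
    using lex_value_snoc[of "u @ w" p] lex_value_snoc[of w p] by (simp add: algebra_simps)
qed (simp add: lex_value_def)

lemma lex_value_inj:
  "length u = length w \<Longrightarrow> set u \<subseteq> L \<Longrightarrow> set w \<subseteq> L \<Longrightarrow> lex_value u = lex_value w \<Longrightarrow> u = w"
proof (induction u arbitrary: w rule: rev_induct)
  case (snoc p u)
  obtain w' q where w: "w = w' @ [q]" using snoc.prems(1) by (cases w rule: rev_cases) auto
  have lt: "code p < b" "code q < b" using snoc.prems w code_less by auto
  have eq: "lex_value u * b + code p = lex_value w' * b + code q"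
    using snoc.prems(4) by (simp add: w lex_value_snoc)
  then have "(lex_value u * b + code p) div b = (lex_value w' * b + code q) div b"
    "(lex_value u * b + code p) mod b = (lex_value w' * b + code q) mod b" by simp_all
  then have "lex_value u = lex_value w'" "code p = code q" using lt by simp_all
  moreover have "p = q" using calculation(2) code_inj snoc.prems w by (auto dest: inj_onD)
  ultimately show ?case using snoc.IH[of w'] snoc.prems w by simp
qed simp

lemma lex_value_less_append: "lex_value t < lex_value s \<Longrightarrow> p \<in> L \<Longrightarrow> lex_value (t @ w) < lex_value (s @ w)"
  using code_less[of p] by (simp add: lex_value_append)

definition total_length :: "(letter word \<Rightarrow> letter word) \<Rightarrow> nat"
  where "total_length f = (\<Sum>p\<in>L. length (f [p]))"

text \<open>Only the first halves count. A move that replaces a short prefix of \<open>f p\<close> by one of the same length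
  then affects the first half of \<open>f p\<close> but not that of its inverse.\<close>

definition lex_sum :: "(letter word \<Rightarrow> letter word) \<Rightarrow> nat"
  where "lex_sum f = (\<Sum>p\<in>L. lex_value (half (f [p])))"

definition smaller :: "(letter word \<Rightarrow> letter word) \<Rightarrow> (letter word \<Rightarrow> letter word) \<Rightarrow> bool"
  where "smaller f g \<longleftrightarrow> total_length f < total_length g \<or> total_length f = total_length g \<and> lex_sum f < lex_sum g"

lemma smaller_by_length:
  assumes "\<And>r. r \<in> L \<Longrightarrow> length (f [r]) \<le> length (g [r])" "p \<in> L" "length (f [p]) < length (g [p])"
  shows "smaller f g"
  unfolding smaller_def total_length_def
  using assms by (intro disjI1 sum_strict_mono_ex1) (auto simp: finite_letters)

lemma smaller_by_lex_sum:
  assumes "\<And>r. r \<in> L \<Longrightarrow> length (f [r]) = length (g [r])"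
    "\<And>r. r \<in> L \<Longrightarrow> lex_value (half (f [r])) \<le> lex_value (half (g [r]))"
    "p \<in> L" "lex_value (half (f [p])) < lex_value (half (g [p]))"
  shows "smaller f g"
proof -
  have "lex_sum f < lex_sum g"
    unfolding lex_sum_def using assms by (intro sum_strict_mono_ex1) (auto simp: finite_letters)
  moreover have "total_length f = total_length g" unfolding total_length_def using assms(1) by (intro sum.cong) auto
  ultimately show ?thesis by (simp add: smaller_def)
qed

end

locale A_element = letter_coding +
  fixes f :: "letter word \<Rightarrow> letter word"
  assumes f_in_A: "f \<in> A_set n k"
begin

lemma f_auto: "f \<in> auto (F n k)"
  using f_in_A by (rule A_setD)

sublocale group_hom "F n k" "F n k" f
  by (intro group_hom.intro group_free_group group_hom_axioms.intro auto_homD f_auto)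

lemma f_mult:
  "u \<in> carrier (F n k) \<Longrightarrow> v \<in> carrier (F n k) \<Longrightarrow> f (foldr push u v) = foldr push (f u) (f v)"
  using hom_mult[of u v] by (simp add: mult_free_group)

lemma f_winv: "u \<in> carrier (F n k) \<Longrightarrow> f (winv u) = winv (f u)"
  using hom_inv[of u] auto_closed[OF f_auto, of u] by (simp add: inv_free_group)

lemma f_Nil: "f [] = []"
  using hom_one by (simp add: one_free_group)

lemma f_inj: "u \<in> carrier (F n k) \<Longrightarrow> v \<in> carrier (F n k) \<Longrightarrow> f u = f v \<Longrightarrow> u = v"
  using auto_bij[OF f_auto] by (auto simp: bij_betw_def dest: inj_onD)

lemma f_closed: "u \<in> carrier (F n k) \<Longrightarrow> f u \<in> carrier (F n k)"
  by (rule auto_closed[OF f_auto])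

sublocale signed_system L "\<lambda>p. f [p]"
proof
  fix p assume p: "p \<in> L"
  then show "inv_letter p \<in> L" by (auto simp: mem_Times_iff)
  show "f [inv_letter p] = winv (f [p])"
    using f_winv[of "[p]"] p by (simp add: winv_Cons mem_Times_iff)
  show "reduced (f [p])" using f_closed[of "[p]"] p
    unfolding singleton_in_free_group by (simp add: carrier_free_group mem_Times_iff)
  show "f [p] \<noteq> []"
    using f_inj[of "[p]" "[]"] p by (auto simp: f_Nil carrier_free_group word_closed_Cons)
qed

lemma f_letter_prod: "w \<in> carrier (F n k) \<Longrightarrow> f w = letter_prod (\<lambda>p. f [p]) w"
proof (induction w)
  case (Cons p w)
  have w: "w \<in> carrier (F n k)" "[p] \<in> carrier (F n k)"
    using Cons.prems reduced_tl[of p w] by (auto simp: carrier_free_group word_closed_Cons)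
  have "foldr push [p] w = p # w"
    using Cons.prems by (simp add: push_reduced carrier_free_group)
  then show ?case using f_mult[OF w(2,1)] Cons.IH[OF w(1)] by simp
qed (simp add: f_Nil)

text \<open>The conjugating word is the same for both signs of \<open>y\<close>, so a single move acts on both.\<close>

lemma Y_form:
  assumes "p \<in> L" "fst p = Y i"
  shows "f [p] = half (f [p]) @ [p] @ winv (half (f [p]))"
    "half (f [inv_letter p]) = half (f [p])"
proof -
  have i: "i \<in> {1..k}" using assms by (auto simp: XY_set_def X_set_def Y_set_def)
  have g: "reduced (gen (Y i))" by (simp add: gen_def reduced_def)
  have "f (gen (Y i)) \<in> conj_class (F n k) (gen (Y i))"
    using f_in_A[unfolded A_set_iff, THEN conjunct2] i by (rule bspec)
  then obtain c where c: "c \<in> carrier (F n k)"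
    "f (gen (Y i)) = foldr push c (foldr push (gen (Y i)) (winv c))"
    unfolding conj_class_iff[OF g] by (rule bexE)
  then obtain h where h: "f (gen (Y i)) = h @ [(Y i, True)] @ winv h"
    using conj_letter_form[of c "(Y i, True)"] by (auto simp: carrier_free_group gen_def)
  have Yi: "(Y i, True) \<in> L" using i by (auto simp: XY_set_def Y_set_def)
  have T: "f [(Y i, True)] = h @ [(Y i, True)] @ winv h"
    using h by (simp add: gen_def)
  have F: "f [(Y i, False)] = h @ [(Y i, False)] @ winv h"
    using B_inv[OF Yi] by (simp add: T winv_append winv_Cons inv_letter_def)
  have pc: "p = (Y i, True) \<or> p = (Y i, False)" using assms(2) by (cases p) auto
  have e: "half (f [(Y i, e)]) = h" for e
    by (cases e) (simp_all only: T F half_conj)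
  show "f [p] = half (f [p]) @ [p] @ winv (half (f [p]))"
    using pc T F e by metis
  show "half (f [inv_letter p]) = half (f [p])"
    using pc e by (auto simp: inv_letter_def)
qed

text \<open>The word that a move multiplies by \<open>(f q)\<^sup>-\<^sup>1\<close> on the left: the whole image of an \<open>x\<close>, but only the
  conjugating word for a \<open>y\<close>.\<close>

definition core :: "letter \<times> bool \<Rightarrow> letter word"
  where "core p = (case fst p of X _ \<Rightarrow> f [p] | Y _ \<Rightarrow> half (f [p]))"

abbreviation moved where
  "moved p q \<equiv> compose (carrier (F n k)) f (endoF n k (move p q))"

context
  fixes p q
  assumes pL: "p \<in> L" and qL: "q \<in> L" and pq: "fst p \<noteq> fst q"
begin

lemma moved_letter:
  assumes "r \<in> L"
  shows "moved p q [r] = f (signed_lift (move p q) r)"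
proof -
  have r: "[r] \<in> carrier (F n k)" using assms by auto
  have "wlift (move p q) [r] = signed_lift (move p q) r"
  proof -
    have "signed_lift (move p q) r \<in> carrier (F n k)"
      using adm_move[OF pL qL pq] assms by (auto simp: signed_lift_def Pi_iff winv_closed)
    then show ?thesis by (simp add: wlift_Cons foldr_push_Nil carrier_free_group)
  qed
  then show ?thesis using r by (simp add: compose_eq endo_apply adm_move[OF pL qL pq])
qed

lemma moved_other: "r \<in> L \<Longrightarrow> fst r \<noteq> fst p \<Longrightarrow> moved p q [r] = f [r]"
  by (simp add: moved_letter)
    (cases r, auto simp: signed_lift_def move_def gen_def winv_Cons inv_letter_def)

lemma f_quotient: "f [inv_letter q, p] = foldr push (winv (f [q])) (f [p])"
proof -
  have "foldr push [inv_letter q] [p] = [inv_letter q, p]" using pq by (auto simp: push_Cons)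
  then show ?thesis
    using f_mult[of "[inv_letter q]" "[p]"] pL qL B_inv[OF qL] by auto
qed

lemma moved_X:
  assumes "fst p = X i"
  shows "moved p q [p] = foldr push (winv (f [q])) (f [p])"
    "moved p q [inv_letter p] = winv (foldr push (winv (f [q])) (f [p]))"
proof -
  have s: "signed_lift (move p q) p = [inv_letter q, p]"
    "signed_lift (move p q) (inv_letter p) = winv [inv_letter q, p]"
    using assms by (cases p; simp add: signed_lift_def move_def winv_Cons; simp add: inv_letter_def)+
  have "[inv_letter q, p] \<in> carrier (F n k)"
    using pL qL pq by (auto simp: carrier_free_group word_closed_Cons)
  then show "moved p q [p] = foldr push (winv (f [q])) (f [p])"
    "moved p q [inv_letter p] = winv (foldr push (winv (f [q])) (f [p]))"
    using P_inv[OF pL] pL by (simp_all add: moved_letter s f_winv f_quotient)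
qed

lemma moved_Y:
  assumes "fst p = Y i" "r = p \<or> r = inv_letter p"
  shows "moved p q [r] = foldr push (foldr push (winv (f [q])) (half (f [p])))
    (push r (winv (foldr push (winv (f [q])) (half (f [p])))))"
proof -
  let ?g = "half (f [p])"
  have rL: "r \<in> L" using assms pL P_inv[OF pL] by blast
  have r: "fst r = Y i" "fst r \<noteq> fst q" using assms pq by (metis fst_inv_letter)+
  have hr: "half (f [r]) = ?g" using Y_form(2)[OF pL assms(1)] assms(2) by auto
  have fr: "f [r] = ?g @ [r] @ winv ?g" using Y_form(1)[OF rL r(1)] hr by simp
  have red: "reduced (?g @ [r] @ winv ?g)" using B_reduced[OF rL] fr by simp
  then have redg: "reduced ?g" "reduced ([r] @ winv ?g)"
    using reduced_append_iff[of ?g "[r] @ winv ?g"] by auto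
  have fr': "f [r] = foldr push ?g (push r (winv ?g))"
    using mul_reduced_append[OF red] mul_reduced_append[OF redg(2)] fr by simp
  have s: "signed_lift (move p q) r = [inv_letter q, r, q]"
    using r assms(1) by (cases r)
      (auto simp: signed_lift_def move_def winv_Cons inv_letter_def)
  have c: "[inv_letter q] \<in> carrier (F n k)" "[r, q] \<in> carrier (F n k)" "[q] \<in> carrier (F n k)"
    "[r] \<in> carrier (F n k)"
    using rL qL r(2) by (auto simp: carrier_free_group word_closed_Cons)
  have e: "foldr push [r] [q] = [r, q]" "foldr push [inv_letter q] [r, q] = [inv_letter q, r, q]"
    using r(2) by (auto simp: push_Cons)
  have "f [inv_letter q, r, q] = foldr push (winv (f [q])) (foldr push (f [r]) (f [q]))"
    using f_mult[OF c(1,2)] f_mult[OF c(4,3)] B_inv[OF qL] unfolding e by simp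
  moreover have "winv (foldr push (winv (f [q])) ?g) = foldr push (winv ?g) (f [q])"
  proof -
    interpret group "free_group (UNIV :: letter set)" by (rule group_free_group)
    have "winv (f [q]) \<in> carrier (free_group UNIV)" "?g \<in> carrier (free_group UNIV)"
      using B_reduced[OF qL] redg by (auto simp: carrier_free_group)
    then show ?thesis
      using inv_mult_group[of "winv (f [q])" ?g]
      by (simp add: mult_free_group inv_free_group mul_closed winv_closed)
  qed
  ultimately show ?thesis
    using B_reduced[OF qL] redg
    by (simp add: moved_letter[OF rL] s fr' foldr_push_assoc foldr_push_push reduced_foldr_push
        reduced_push)
qed

text \<open>For a \<open>y\<close>, shortening the conjugating word shortens the conjugate, since the new conjugate has at
  most twice the length of the new conjugating word plus one.\<close>

lemma shorter_core:
  assumes "length (foldr push (winv (f [q])) (core p)) < length (core p)"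
  shows "smaller (moved p q) f"
proof (cases "fst p")
  case (X i)
  then have core: "core p = f [p]" by (simp add: core_def)
  show ?thesis
  proof (rule smaller_by_length[of "moved p q" f p, OF _ pL])
    show "length (moved p q [p]) < length (f [p])"
      using assms core moved_X[OF X] by simp
    fix r assume r: "r \<in> L"
    show "length (moved p q [r]) \<le> length (f [r])"
      by (rule same_letter_cases[of r p]) (use assms core moved_X[OF X] moved_other[OF r] B_inv[OF pL] in auto)
  qed
next
  case (Y i)
  let ?h = "foldr push (winv (f [q])) (half (f [p]))"
  have core: "core p = half (f [p])" using Y by (simp add: core_def)
  have less: "length (moved p q [r]) < length (f [r])" if r: "r = p \<or> r = inv_letter p" for r
  proof -
    have "length (moved p q [r]) \<le> length ?h + Suc (length ?h)"
      unfolding moved_Y[OF Y r]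
      using length_mul_le[of ?h "push r (winv ?h)"] length_push_le[of r "winv ?h"] by simp
    moreover have "length (f [r]) = length (f [p])" using r B_inv[OF pL] by auto
    moreover have "length (f [p]) = 2 * length (half (f [p])) + 1"
      using arg_cong[OF Y_form(1)[OF pL Y], of length] by simp
    ultimately show ?thesis using assms core by simp
  qed
  show ?thesis
  proof (rule smaller_by_length[of "moved p q" f p, OF _ pL])
    show "length (moved p q [p]) < length (f [p])" using less by simp
    fix r assume r: "r \<in> L"
    show "length (moved p q [r]) \<le> length (f [r])"
      by (rule same_letter_cases[of r p]) (use less[of r] moved_other[OF r] in auto)
  qed
qed

text \<open>The tie-breaking move. The word \<open>f q = s t\<^sup>-\<^sup>1\<close> has halves of equal length, and \<open>f p\<close> begins with \<open>s\<close>.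
  Multiplying by \<open>(f q)\<^sup>-\<^sup>1\<close> exchanges this prefix for \<open>t\<close> and keeps the length. If \<open>p\<close> belongs to a
  \<open>y\<close>, then \<open>s\<close> is a prefix of the conjugating word, as the length of \<open>f p\<close> is odd; the new conjugate
  either is shorter or has the exchanged prefix in its conjugating word.\<close>

lemma lex_smaller_prefix:
  assumes q: "f [q] = s @ winv t" "length s = length t" and lcp: "lcp (f [q]) (f [p]) = length s"
    and long: "2 * length s \<le> length (f [p])" and lex_value: "lex_value t < lex_value s"
  shows "smaller (moved p q) f"
proof -
  define h where "h = length s"
  have s: "s = take h (f [p])" using take_lcp[of "f [q]" "f [p]"] lcp q by (simp add: h_def)
  have dq: "winv (drop h (f [q])) = t" by (simp add: q h_def)
  have red: "reduced (f [p])" "reduced (f [q])" using B_reduced pL qL by auto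
  show ?thesis
  proof (cases "fst p")
    case (X i)
    define p' where "p' = drop h (f [p])"
    have fp: "f [p] = s @ p'" by (simp add: s p'_def)
    have mp: "foldr push (winv (f [q])) (f [p]) = t @ p'"
      using mul_winv_eq[OF red(2,1)] dq lcp by (simp add: h_def p'_def)
    have hl: "length p' \<ge> h" using long fp by (simp add: h_def)
    have len: "length (moved p q [r]) = length (f [r])" if r: "r \<in> L" for r
    proof -
      show ?thesis
        by (rule same_letter_cases[of r p]) (use moved_X[OF X] moved_other[OF r] B_inv[OF pL] mp fp q(2) in auto)
    qed
    have half_p: "half (s @ p') = s @ take ((length s + length p') div 2 - h) p'"
      "half (t @ p') = t @ take ((length s + length p') div 2 - h) p'"
      using hl q(2) by (auto simp: half_def h_def)
    have less: "lex_value (half (moved p q [p])) < lex_value (half (f [p]))"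
      unfolding moved_X(1)[OF X, unfolded mp] fp half_p by (rule lex_value_less_append[OF lex_value pL])
    have inv: "half (moved p q [inv_letter p]) = half (f [inv_letter p])"
      unfolding moved_X(2)[OF X, unfolded mp] B_inv[OF pL] fp using hl q(2)
      by (simp add: half_def winv_append h_def)
    show ?thesis
    proof (rule smaller_by_lex_sum[of "moved p q" f p, OF len _ pL less])
      fix r assume r: "r \<in> L"
      show "lex_value (half (moved p q [r])) \<le> lex_value (half (f [r]))"
        by (rule same_letter_cases[of r p]) (use moved_other[OF r] less inv in auto)
    qed
  next
    case (Y i)
    let ?g = "half (f [p])"
    have fp: "f [p] = ?g @ [p] @ winv ?g" by (rule Y_form(1)[OF pL Y])
    have lfp: "length (f [p]) = 2 * length ?g + 1"
      using arg_cong[OF fp, of length] by simp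
    have hg: "h \<le> length ?g" using long lfp by (simp add: h_def)
    define g' where "g' = drop h ?g"
    have "take h ?g = take h (f [p])"
      by (subst (2) fp) (use hg in simp)
    then have g: "?g = s @ g'" unfolding g'_def s by (metis append_take_drop_id)
    have "lcp (f [q]) ?g = h"
    proof (rule antisym)
      have "take (lcp (f [q]) ?g) ?g = take (lcp (f [q]) ?g) (f [p])"
        by (subst (3) fp) (use lcp_le(2)[of "f [q]" ?g] in simp)
      then have "lcp (f [q]) ?g \<le> lcp (f [q]) (f [p])"
        using lcp_le[of "f [q]" ?g] take_lcp[of "f [q]" ?g] lfp by (subst lcp_ge_iff) auto
      then show "lcp (f [q]) ?g \<le> h" using lcp by (simp add: h_def)
      show "h \<le> lcp (f [q]) ?g"
        using hg g q by (subst lcp_ge_iff) (auto simp: h_def)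
    qed
    moreover have "reduced ?g" unfolding half_def by (rule reduced_take[OF red(1)])
    ultimately have mg: "foldr push (winv (f [q])) ?g = t @ g'"
      using mul_winv_eq[OF red(2), of ?g] dq by (simp add: g'_def)
    have le: "length (moved p q [r]) \<le> length (f [r])"
      and eq: "length (moved p q [r]) = length (f [r]) \<Longrightarrow> half (moved p q [r]) = t @ g'"
      if r: "r = p \<or> r = inv_letter p" for r
    proof -
      have lr: "length (f [r]) = length (f [p])" using r B_inv[OF pL] by auto
      have lt: "length (t @ g') = length ?g" using g q(2) by simp
      have m: "moved p q [r] = foldr push (t @ g') (push r (winv (t @ g')))"
        using moved_Y[OF Y r] unfolding mg .
      have l1: "length (push r (winv (t @ g'))) \<le> Suc (length (winv (t @ g')))"
        by (rule length_push_le)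
      have l2: "length (moved p q [r]) \<le> length (t @ g') + length (push r (winv (t @ g')))"
        unfolding m by (rule length_mul_le)
      show "length (moved p q [r]) \<le> length (f [r])" using l1 l2 lr lfp lt by simp
      assume e: "length (moved p q [r]) = length (f [r])"
      have "push r (winv (t @ g')) = r # winv (t @ g')"
        by (rule push_length_eq) (use e l1 l2 lr lfp lt in simp)
      moreover have "moved p q [r] = (t @ g') @ push r (winv (t @ g'))"
        unfolding m by (rule mul_length_eq) (use e l1 l2 lr lfp lt m in simp)
      ultimately have "moved p q [r] = (t @ g') @ [r] @ winv (t @ g')" by simp
      then show "half (moved p q [r]) = t @ g'" by (simp only: half_conj)
    qed
    have rc: "fst r \<noteq> fst p \<or> r = p \<or> r = inv_letter p" for r
      by (rule same_letter_cases[of r p]) auto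
    show ?thesis
    proof (cases "\<forall>r\<in>L. length (moved p q [r]) = length (f [r])")
      case True
      have less: "lex_value (half (moved p q [r])) < lex_value (half (f [r]))" if "r = p \<or> r = inv_letter p" for r
      proof -
        have "r \<in> L" using that pL P_inv by auto
        then have "half (moved p q [r]) = t @ g'" using eq[OF that] True by blast
        moreover have "half (f [r]) = s @ g'" using that Y_form(2)[OF pL Y] g by auto
        ultimately show ?thesis using lex_value_less_append[OF lex_value pL] by simp
      qed
      show ?thesis
      proof (rule smaller_by_lex_sum[of "moved p q" f p, OF _ _ pL less])
        fix r assume r: "r \<in> L"
        then show "length (moved p q [r]) = length (f [r])" using True by blast
        show "lex_value (half (moved p q [r])) \<le> lex_value (half (f [r]))"
          using rc[of r] less[of r] moved_other[OF r] by auto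
      qed simp
    next
      case False
      then obtain r where r: "r \<in> L" "length (moved p q [r]) \<noteq> length (f [r])" by blast
      have le': "length (moved p q [r]) \<le> length (f [r])" if "r \<in> L" for r
        using rc[of r] le[of r] moved_other[OF that] by auto
      show ?thesis
        by (rule smaller_by_length[of "moved p q" f r, OF le' r(1)]) (use le'[OF r(1)] r(2) in simp_all)
    qed
  qed
qed

end

lemma reduced_core: "p \<in> L \<Longrightarrow> reduced (core p)"
  using B_reduced[of p] by (auto simp: core_def half_def reduced_take split: letter.split)

lemma core_take: "core p = take (length (core p)) (f [p])"
  by (auto simp: core_def half_def split: letter.split)

lemma length_core_Y: "p \<in> L \<Longrightarrow> fst p = Y i \<Longrightarrow> length (f [p]) = 2 * length (core p) + 1"
  using arg_cong[OF Y_form(1)[of p i], of length] by (simp add: core_def)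

lemma nth_core_Y: "p \<in> L \<Longrightarrow> fst p = Y i \<Longrightarrow> f [p] ! length (core p) = p"
  using arg_cong[OF Y_form(1)[of p i], of "\<lambda>w. w ! length (core p)"] by (simp add: core_def nth_append)

context
  assumes min: "\<And>p q. p \<in> L \<Longrightarrow> q \<in> L \<Longrightarrow> fst p \<noteq> fst q \<Longrightarrow> \<not> smaller (moved p q) f"
begin

text \<open>Otherwise the corresponding move would shorten the core.\<close>

lemma overlap_core:
  assumes "p \<in> L" "q \<in> L" "fst p \<noteq> fst q"
  shows "2 * min (length (core p)) (lcp (f [q]) (f [p])) \<le> length (f [q])"
proof -
  have "length (core p) \<le> length (foldr push (winv (f [q])) (core p))"
    using shorter_core[OF assms] min[OF assms] by linarith
  then have "2 * lcp (f [q]) (core p) \<le> length (f [q])"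
    using length_mul_winv[OF B_reduced[OF assms(2)] reduced_core[OF assms(1)]] by simp
  moreover have "min (length (core p)) (lcp (f [q]) (f [p])) \<le> lcp (f [q]) (core p)"
    using lcp_take[of "f [q]" "length (core p)" "f [p]"] core_take[of p] by simp
  ultimately show ?thesis by simp
qed

text \<open>If \<open>p\<close> belongs to an \<open>x\<close>, this is \<open>overlap_core\<close>. If \<open>p\<close> belongs to a \<open>y\<close>, the overlap could only
  be too long by reaching past the conjugating word of \<open>p\<close>. Applying \<open>overlap_core\<close> with both roles
  then leaves only the case of two \<open>y\<close> with conjugating words of equal length whose central letters
  coincide.\<close>

lemma overlap_half:
  assumes "p \<in> L" "q \<in> L" "p \<noteq> q"
  shows "2 * lcp (f [p]) (f [q]) \<le> length (f [q])"
proof (cases "fst p = fst q")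
  case True
  then have "q = inv_letter p" using assms(3) by (cases p; cases q) (auto simp: inv_letter_def)
  then show ?thesis
    using lcp_winv[OF B_reduced B_nonempty, OF assms(1,1)] B_inv[OF assms(1)] by simp
next
  case False
  let ?c = "lcp (f [p]) (f [q])"
  have R: "2 * min (length (core p)) ?c \<le> length (f [q])"
    "2 * min (length (core q)) ?c \<le> length (f [p])"
    using overlap_core[OF assms(1,2) False] overlap_core[OF assms(2,1)] False
    by (simp_all add: lcp_commute[of "f [q]" "f [p]"])
  have c: "?c \<le> length (f [p])" "?c \<le> length (f [q])" by (rule lcp_le)+
  show ?thesis
  proof (cases "?c \<le> length (core p)")
    case True
    then show ?thesis using R(1) by simp
  next
    \<comment> \<open>The overlap reaches past the core, so \<open>p\<close> belongs to a \<open>y\<close>.\<close>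
    case long: False
    then obtain i where p: "fst p = Y i" using c(1) by (cases "fst p") (auto simp: core_def)
    have lp: "length (f [p]) = 2 * length (core p) + 1" by (rule length_core_Y[OF assms(1) p])
    show ?thesis
    proof (cases "fst q")
      case (X j)
      then have "core q = f [q]" by (simp add: core_def)
      then show ?thesis using R(2) c long lp by (simp add: min_def split: if_splits)
    next
      case (Y j)
      have lq: "length (f [q]) = 2 * length (core q) + 1" by (rule length_core_Y[OF assms(2) Y])
      \<comment> \<open>Each conjugating word is at most as long as the other one.\<close>
      have eq: "length (core q) = length (core p)"
        using R long lp lq by (simp add: min_def split: if_splits)
      have "f [p] ! length (core p) = f [q] ! length (core p)"
        using long take_lcp[of "f [p]" "f [q]"] by (metis not_le nth_take)
      then have "p = q"
        using nth_core_Y[OF assms(1) p] nth_core_Y[OF assms(2) Y] eq by simp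
      then show ?thesis using assms(3) by simp
    qed
  qed
qed

text \<open>By \<open>overlap_half\<close>, failure means that both overlaps are exactly half of \<open>f p\<close>. Then \<open>f p = s t\<^sup>-\<^sup>1\<close>
  with \<open>f q\<close> beginning with \<open>s\<close> and \<open>f r\<close> with \<open>t\<close>, and whichever of \<open>s\<close> and \<open>t\<close> is
  lexicographically larger can be exchanged for the other by a move.\<close>

lemma overlaps_leave_middle:
  assumes "p \<in> L" "q \<in> L" "r \<in> L" "q \<noteq> p" "r \<noteq> inv_letter p"
  shows "lcp (f [q]) (f [p]) + lcp (f [r]) (f [inv_letter p]) < length (f [p])"
proof (rule ccontr)
  assume contra: "\<not> ?thesis"
  define h where "h = lcp (f [q]) (f [p])"
  have p': "inv_letter p \<in> L" and inv: "f [inv_letter p] = winv (f [p])"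
    using P_inv B_inv assms(1) by auto
  have "2 * h \<le> length (f [p])" "2 * lcp (f [r]) (f [inv_letter p]) \<le> length (f [p])"
    using overlap_half[OF assms(2,1,4)] overlap_half[OF assms(3) p' assms(5)] inv by (simp_all add: h_def)
  then have h: "length (f [p]) = 2 * h" "lcp (f [r]) (f [inv_letter p]) = h"
    using contra by (simp_all add: h_def)
  have strict: "lcp (f [p]) (winv (f [p])) < h"
    using lcp_winv[OF B_reduced B_nonempty, OF assms(1,1)] h by simp
  have fst_q: "fst q \<noteq> fst p"
  proof
    assume "fst q = fst p"
    then have "q = inv_letter p" using assms(4) by (cases p; cases q) (auto simp: inv_letter_def)
    then show False using strict inv lcp_commute[of "f [p]"] by (simp add: h_def)
  qed
  have fst_r: "fst r \<noteq> fst (inv_letter p)"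
  proof
    assume "fst r = fst (inv_letter p)"
    then have "r = p" using assms(5) by (cases p; cases r) (auto simp: inv_letter_def)
    then show False using strict inv h by simp
  qed
  define s where "s = take h (f [p])"
  define t where "t = take h (winv (f [p]))"
  have wt: "winv t = drop h (f [p])"
    by (simp add: t_def winv_def take_map take_rev rev_map comp_def h)
  have p_eq: "f [p] = s @ winv t" by (simp add: wt s_def)
  have len: "length s = h" "length t = h" by (simp_all add: s_def t_def h)
  have "f [p] \<in> carrier (F n k)" using f_closed[of "[p]"] assms(1) by (simp add: mem_Times_iff)
  note fL = set_subset_letters[OF this] set_subset_letters[OF winv_closed[OF this]]
  have "set s \<subseteq> L" "set t \<subseteq> L"
    unfolding s_def t_def by (rule order_trans[OF set_take_subset fL(1)])
      (rule order_trans[OF set_take_subset fL(2)])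
  moreover have "s \<noteq> t"
    using strict lcp_ge_iff[of h "f [p]" "winv (f [p])"] h by (auto simp: s_def t_def)
  ultimately have "lex_value s \<noteq> lex_value t" using lex_value_inj[of s t] len by auto
  then consider "lex_value t < lex_value s" | "lex_value s < lex_value t" by linarith
  then show False
  proof cases
    case 1
    have "smaller (moved q p) f"
      by (rule lex_smaller_prefix[OF assms(2,1) fst_q p_eq _ _ _ 1])
        (use len overlap_half[OF assms(1,2)] assms(4) in
          \<open>simp_all add: h_def lcp_commute[of "f [p]" "f [q]"]\<close>)
    then show False using min[OF assms(2,1) fst_q] by simp
  next
    case 2
    have "f [inv_letter p] = t @ winv s" unfolding inv by (simp add: p_eq winv_append)
    then have "smaller (moved r (inv_letter p)) f"
      by (rule lex_smaller_prefix[OF assms(3) p' fst_r _ _ _ _ 2])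
        (use len overlap_half[OF p' assms(3)] assms(5) h in
          \<open>simp_all add: lcp_commute[of "f [inv_letter p]" "f [r]"]\<close>)
    then show False using min[OF assms(3) p' fst_r] by simp
  qed
qed

lemma letter_preimage:
  assumes "p \<in> L"
  shows "\<exists>q\<in>L. f [q] = [p]"
proof -
  have "[p] \<in> f ` carrier (F n k)"
    using auto_bij[OF f_auto] assms by (simp add: bij_betw_def mem_Times_iff)
  then obtain w where w: "w \<in> carrier (F n k)" "f w = [p]" by auto
  have wL: "reduced w" "set w \<subseteq> L"
    using w(1) set_subset_letters by (simp_all add: carrier_free_group)
  have "length w \<le> length (letter_prod (\<lambda>p. f [p]) w)"
    by (rule nielsen_reduced_length[OF _ _ wL]) (use overlap_half overlaps_leave_middle in auto)
  then have "length w \<le> 1" unfolding f_letter_prod[OF w(1), symmetric] w(2) by simp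
  moreover have "w \<noteq> []" using w(2) f_Nil by auto
  ultimately obtain q where "w = [q]" by (cases w) auto
  then show ?thesis using w wL by auto
qed

text \<open>By \<open>letter_preimage\<close> and finiteness: the signed letters with a letter as image already account for
  all signed letters.\<close>

lemma letter_image:
  assumes "p \<in> L"
  shows "\<exists>q\<in>L. f [p] = [q]"
proof -
  \<comment> \<open>The map \<open>q \<mapsto> hd (f [q])\<close> sends \<open>R\<close> onto \<open>L\<close>.\<close>
  define R where "R = {q \<in> L. \<exists>p\<in>L. f [q] = [p]}"
  have "L \<subseteq> (\<lambda>q. hd (f [q])) ` R"
  proof
    fix p assume "p \<in> L"
    then obtain q where "q \<in> L" "f [q] = [p]" using letter_preimage by blast
    then show "p \<in> (\<lambda>q. hd (f [q])) ` R"
      using \<open>p \<in> L\<close> by (intro image_eqI[of _ _ q]) (auto simp: R_def)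
  qed
  moreover have "finite R" using finite_letters by (auto simp: R_def)
  ultimately have "card L \<le> card R" by (rule surj_card_le[rotated])
  then have "R = L" using finite_letters by (intro card_seteq) (auto simp: R_def)
  then show ?thesis using assms by (auto simp: R_def)
qed

lemma Y_fixed:
  assumes "i \<in> {1..k}"
  shows "f [(Y i, e)] = [(Y i, e)]"
proof -
  have L: "(Y i, e) \<in> L" using assms by (auto simp: XY_set_def Y_set_def)
  have "length (f [(Y i, e)]) = 1" using letter_image[OF L] by auto
  then have "half (f [(Y i, e)]) = []" by (simp add: half_def)
  then show ?thesis using Y_form(1)[OF L] by simp
qed

text \<open>Minimal elements of \<open>A\<close> permute the signed letters. They fix every \<open>y\<close>, because a conjugate of \<open>y\<close>
  of length one is \<open>y\<close>, and so they permute the signed \<open>x\<close>.\<close>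

lemma minimal_signed_perm: "f \<in> signed_perms n k"
proof -
  define g where "g = inv\<^bsub>AF n k\<^esub> f"
  interpret A: group "AF n k" by (rule group_AG)
  have g_auto: "g \<in> auto (F n k)" using A.inv_closed[of f] f_auto by (simp add: g_def)
  have gf: "g (f w) = w" if "w \<in> carrier (F n k)" for w
    unfolding g_def by (rule AutoGroup_inv_apply[OF group_free_group f_auto that])
  have "inv\<^bsub>AF n k\<^esub> g = f" using f_auto by (simp add: g_def)
  then have fg: "f (g w) = w" if "w \<in> carrier (F n k)" for w
    using AutoGroup_inv_apply[OF group_free_group g_auto that] by simp
  define \<phi> where "\<phi> a = f (gen a)" for a
  define \<psi> where "\<psi> a = g (gen a)" for a
  have f: "adm (XY_set n k) \<phi>" "f = endoF n k \<phi>"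
    unfolding \<phi>_def using auto_eq_endo[OF f_auto] .
  have g: "adm (XY_set n k) \<psi>" "g = endoF n k \<psi>"
    unfolding \<psi>_def using auto_eq_endo[OF g_auto] .
  have perm: "perm_subst n k (\<lambda>a. h (gen a))"
    if img: "\<And>p. p \<in> L \<Longrightarrow> \<exists>q\<in>L. h [p] = [q]"
      and Y: "\<And>i e. i \<in> {1..k} \<Longrightarrow> h [(Y i, e)] = [(Y i, e)]"
      and inj: "\<And>u v. u \<in> carrier (F n k) \<Longrightarrow> v \<in> carrier (F n k) \<Longrightarrow> h u = h v \<Longrightarrow> u = v"
    for h :: "letter word \<Rightarrow> letter word"
    unfolding perm_subst_def
  proof (intro conjI ballI)
    show "h (gen (Y i)) = gen (Y i)" if "i \<in> {1..k}" for i using Y[OF that] by (simp add: gen_def)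
    fix a assume a: "a \<in> X_set n"
    then have aL: "(a, True) \<in> L" by (auto simp: XY_set_def)
    obtain q where q: "q \<in> L" "h [(a, True)] = [q]" using img[OF aL] by blast
    have "fst q \<in> X_set n"
    proof -
      from q(1) have "fst q \<in> XY_set n k" by auto
      then show ?thesis
      proof (cases rule: XY_cases)
        case (2 i)
        then obtain e where "q = (Y i, e)" by (cases q) simp
        then have "h [q] = [q]" using Y[OF 2(2)] by simp
        then have "[(a, True)] = [q]"
          using q aL by - (rule inj, simp_all add: mem_Times_iff)
        then show ?thesis using a by (simp add: prod_eq_iff[of _ q])
      qed
    qed
    then show "\<exists>b\<in>X_set n. \<exists>e. h (gen a) = [(b, e)]"
      using q(2) by (cases q) (auto simp: gen_def)
  qed
  have "perm_subst n k \<phi>"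
    unfolding \<phi>_def by (rule perm) (use letter_image Y_fixed f_inj in blast)+
  moreover have "perm_subst n k \<psi>"
    unfolding \<psi>_def
  proof (rule perm)
    show "\<exists>q\<in>L. g [p] = [q]" if p: "p \<in> L" for p
    proof -
      obtain q where "q \<in> L" "f [q] = [p]" using letter_preimage[OF p] by blast
      then show ?thesis using gf[of "[q]"] by auto
    qed
    show "g [(Y i, e)] = [(Y i, e)]" if "i \<in> {1..k}" for i e
      using gf[of "[(Y i, e)]"] Y_fixed[OF that, of e] that
      by (simp add: XY_set_def Y_set_def)
    show "u = v" if "u \<in> carrier (F n k)" "v \<in> carrier (F n k)" "g u = g v" for u v
      using fg that by metis
  qed
  moreover have "wlift \<phi> (\<psi> a) = gen a \<and> wlift \<psi> (\<phi> a) = gen a" if "a \<in> XY_set n k" for a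
  proof
    have c: "\<psi> a \<in> carrier (F n k)" "\<phi> a \<in> carrier (F n k)" using f(1) g(1) that by (auto simp: Pi_iff)
    have "wlift \<phi> (\<psi> a) = f (\<psi> a)"
      unfolding endo_apply[OF f(1) c(1), symmetric] by (simp only: f(2)[symmetric])
    then show "wlift \<phi> (\<psi> a) = gen a" unfolding \<psi>_def using fg[of "gen a"] that by simp
    have "wlift \<psi> (\<phi> a) = g (\<phi> a)"
      unfolding endo_apply[OF g(1) c(2), symmetric] by (simp only: g(2)[symmetric])
    then show "wlift \<psi> (\<phi> a) = gen a" unfolding \<phi>_def using gf[of "gen a"] that by simp
  qed
  ultimately show ?thesis
    unfolding signed_perms_def using f(2) by blast
qed

end

end

text \<open>Descent along the moves; it ends because length and lexicographic value are natural numbers.\<close>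

lemma A_set_generated:
  assumes H: "subgroup H (AF n k)"
    and moves: "\<And>p q. p \<in> letters n k \<Longrightarrow> q \<in> letters n k \<Longrightarrow> fst p \<noteq> fst q \<Longrightarrow>
      endoF n k (move p q) \<in> H"
    and perms: "signed_perms n k \<subseteq> H"
    and f: "f \<in> A_set n k"
  shows "f \<in> H"
proof -
  obtain b code where code: "code ` letters n k = {i. i < (b :: nat)}" "inj_on code (letters n k)"
    using finite_imp_inj_to_nat_seg[OF finite_letters[of n k]] by blast
  interpret letter_coding n k code b
    by unfold_locales (use code in auto)
  interpret A: group "AF n k" by (rule group_AG)
  have "wf (measures [total_length, lex_sum])" by simp
  then show ?thesis using f
  proof (induction f rule: wf_induct_rule)
    case (less f)
    interpret A_element n k code b f by unfold_locales (rule less.prems)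
    show ?case
    proof (cases "\<exists>p\<in>L. \<exists>q\<in>L. fst p \<noteq> fst q \<and> smaller (moved p q) f")
      case True
      then obtain p q where pq: "p \<in> L" "q \<in> L" "fst p \<noteq> fst q" "smaller (moved p q) f" by blast
      let ?m = "endoF n k (move p q)"
      have mA: "?m \<in> A_set n k" by (rule move_in_A_set[OF pq(1-3)])
      have eq: "f \<otimes>\<^bsub>AF n k\<^esub> ?m = moved p q"
        by (rule AutoGroup_mult[OF f_auto A_setD[OF mA]])
      have "moved p q \<in> A_set n k"
        using subgroup.m_closed[OF subgroup_A_set less.prems mA] unfolding eq .
      moreover have "(moved p q, f) \<in> measures [total_length, lex_sum]"
        using pq(4) by (auto simp: smaller_def)
      ultimately have "moved p q \<in> H" using less.IH by blast
      moreover have "inv\<^bsub>AF n k\<^esub> ?m \<in> H"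
        by (rule subgroup.m_inv_closed[OF H moves[OF pq(1-3)]])
      ultimately have "moved p q \<otimes>\<^bsub>AF n k\<^esub> inv\<^bsub>AF n k\<^esub> ?m \<in> H"
        by (rule subgroup.m_closed[OF H])
      moreover have "moved p q \<otimes>\<^bsub>AF n k\<^esub> inv\<^bsub>AF n k\<^esub> ?m = f"
      proof -
        have c: "f \<in> carrier (AF n k)" "?m \<in> carrier (AF n k)"
          using f_auto A_setD[OF mA] by simp_all
        show ?thesis
          unfolding eq[symmetric] A.m_assoc[OF c A.inv_closed[OF c(2)]] A.r_inv[OF c(2)] A.r_one[OF c(1)] ..
      qed
      ultimately show ?thesis by simp
    next
      case False
      then have "f \<in> signed_perms n k" by (intro minimal_signed_perm) blast
      then show ?thesis using perms by blast
    qed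
  qed
qed

section \<open>Substitutions inducing elements of a given subgroup\<close>

lemmas word_eval = wlift_Cons signed_lift_def push_Nil push_Cons winv_Cons gen_def inv_letter_def

lemmas word_mem = carrier_free_group word_closed_Cons gen_def inv_letter_def

definition endo_in :: "'a set \<Rightarrow> ('a word \<Rightarrow> 'a word) set \<Rightarrow> ('a \<Rightarrow> 'a word) \<Rightarrow> bool"
  where "endo_in S H \<phi> \<longleftrightarrow> adm S \<phi> \<and> endo S \<phi> \<in> H"

definition conj_by :: "'a \<Rightarrow> 'a \<Rightarrow> bool \<Rightarrow> 'a \<Rightarrow> 'a word"
  where "conj_by z z' e = gen(z := [(z', e), (z, True), (z', \<not> e)])"

text \<open>The substitution behind \<open>M_aut\<close>, meant for words \<open>v\<close> that avoid \<open>x\<close>. As nothing cancels against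
  \<open>x\<close> then, concatenation is the product.\<close>

definition lmult :: "'a \<Rightarrow> 'a word \<Rightarrow> 'a \<Rightarrow> 'a word"
  where "lmult x v = gen(x := v @ [(x, True)])"

definition rmult :: "'a \<Rightarrow> 'a word \<Rightarrow> 'a \<Rightarrow> 'a word"
  where "rmult x v = gen(x := (x, True) # v)"

lemma adm_upd: "u \<in> carrier (free_group S) \<Longrightarrow> adm S (gen(z := u))"
  by simp

lemma adm_conj_by: "z' \<in> S \<Longrightarrow> z \<in> S \<Longrightarrow> z \<noteq> z' \<Longrightarrow> adm S (conj_by z z' e)"
  unfolding conj_by_def by (intro adm_upd) (simp add: word_mem)

lemma append_in_free_group:
  "v \<in> carrier (free_group (S - {x})) \<Longrightarrow> x \<in> S \<Longrightarrow> v @ [(x, True)] \<in> carrier (free_group S)"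
  "v \<in> carrier (free_group (S - {x})) \<Longrightarrow> x \<in> S \<Longrightarrow> (x, True) # v \<in> carrier (free_group S)"
proof -
  assume v: "v \<in> carrier (free_group (S - {x}))" "x \<in> S"
  then have x: "fst p \<noteq> x" if "p \<in> set v" for p using that by (auto simp: carrier_free_group)
  have "(x, True) \<noteq> inv_letter (last v)" if "v \<noteq> []"
    using x[of "last v"] that by (metis fst_conv fst_inv_letter last_in_set)
  moreover have "hd v \<noteq> inv_letter (x, True)" if "v \<noteq> []"
    using x[of "hd v"] that by (metis fst_conv fst_inv_letter hd_in_set)
  ultimately show "v @ [(x, True)] \<in> carrier (free_group S)" "(x, True) # v \<in> carrier (free_group S)"
    using v reduced_append_iff[of v "[(x, True)]"] reduced_append_iff[of "[(x, True)]" v]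
    by (auto simp: carrier_free_group word_closed_Cons)
qed

lemma adm_lmult: "v \<in> carrier (free_group (S - {x})) \<Longrightarrow> x \<in> S \<Longrightarrow> adm S (lmult x v)"
  unfolding lmult_def by (intro adm_upd append_in_free_group)

lemma wlift_fixing:
  assumes "\<And>a. a \<in> T \<Longrightarrow> \<phi> a = gen a" "w \<in> carrier (free_group T)"
  shows "wlift \<phi> w = w"
proof -
  have "wlift \<phi> w = foldr push w []" if "fst ` set w \<subseteq> T" for w
    using that
  proof (induction w)
    case (Cons p w)
    have "signed_lift \<phi> p = [p]"
      using assms(1)[of "fst p"] Cons.prems
      by (cases p) (auto simp: signed_lift_def gen_def winv_Cons inv_letter_def)
    moreover have "wlift \<phi> w = foldr push w []" using Cons.prems by (intro Cons.IH) simp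
    ultimately show ?case unfolding wlift_Cons by (simp only: foldr.simps comp_apply id_apply)
  qed simp
  then show ?thesis using assms(2) by (simp add: carrier_free_group foldr_push_Nil)
qed

lemma wlift_upd_avoiding:
  "w \<in> carrier (free_group (S - {x})) \<Longrightarrow> wlift (gen(x := u)) w = w"
  by (rule wlift_fixing) auto

lemma wlift_append:
  "wlift \<phi> (u @ v) = foldr push (wlift \<phi> u) (wlift \<phi> v)"
proof (induction u)
  case (Cons p u)
  then show ?case by (simp add: wlift_Cons foldr_push_assoc)
qed simp

lemma signed_lift_inv: "signed_lift \<phi> (inv_letter p) = winv (signed_lift \<phi> p)"
  by (simp add: signed_lift_def inv_letter_def)

text \<open>Holds for arbitrary words because substitution respects the cancellation of adjacent inverse letters.\<close>

lemma wlift_push: "wlift \<phi> (push p w) = foldr push (signed_lift \<phi> p) (wlift \<phi> w)"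
proof (cases "\<exists>w'. w = inv_letter p # w'")
  case True
  then show ?thesis by (auto simp: push_Cons wlift_Cons signed_lift_inv mul_winv_cancel)
next
  case False
  then have "push p w = p # w" by (cases w) (auto simp: push_Nil push_Cons)
  then show ?thesis by (simp add: wlift_Cons)
qed

lemma wlift_mul: "wlift \<phi> (foldr push u w) = foldr push (wlift \<phi> u) (wlift \<phi> w)"
proof (induction u)
  case (Cons p u)
  then show ?case by (simp add: wlift_push wlift_Cons foldr_push_assoc)
qed simp

lemma endo_in_cong:
  assumes "endo_in S H \<phi>" and eq: "\<And>a. a \<in> S \<Longrightarrow> \<chi> a = \<phi> a"
  shows "endo_in S H \<chi>"
proof -
  have "endo S \<chi> = endo S \<phi>" by (rule endo_cong) (rule eq)
  moreover have "adm S \<chi>" using assms by (simp add: endo_in_def Pi_iff)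
  ultimately show ?thesis using assms(1) by (simp add: endo_in_def)
qed

lemma lmult_other [simp]: "a \<noteq> x \<Longrightarrow> lmult x v a = gen a"
  and lmult_same: "lmult x v x = v @ [(x, True)]"
  by (simp_all add: lmult_def)

lemma wlift_lmult_avoiding: "w \<in> carrier (free_group (S - {x})) \<Longrightarrow> wlift (lmult x v) w = w"
  unfolding lmult_def by (rule wlift_upd_avoiding)

lemma wlift_lmult_same:
  assumes "v \<in> carrier (free_group (S - {x}))" "x \<in> S"
  shows "wlift (lmult x v) [(x, True)] = v @ [(x, True)]"
  using append_in_free_group(1)[OF assms]
  by (simp add: wlift_Cons signed_lift_def lmult_def foldr_push_Nil carrier_free_group del: foldr_append)

lemma mul_append_assoc:
  "reduced u \<Longrightarrow> v \<in> carrier (free_group (S - {x})) \<Longrightarrow> u \<in> carrier (free_group (S - {x})) \<Longrightarrow> x \<in> S \<Longrightarrow>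
    foldr push u (v @ [(x, True)]) = foldr push u v @ [(x, True)]"
proof -
  assume a: "reduced u" "v \<in> carrier (free_group (S - {x}))" "u \<in> carrier (free_group (S - {x}))" "x \<in> S"
  have r: "reduced (v @ [(x, True)])" "reduced (foldr push u v @ [(x, True)])"
    using append_in_free_group(1)[OF a(2,4)] append_in_free_group(1)[OF mul_closed[OF a(3,2)] a(4)]
    by (simp_all add: carrier_free_group)
  have "foldr push u (v @ [(x, True)]) = foldr push u (foldr push v [(x, True)])"
    by (simp add: mul_reduced_append[OF r(1)])
  also have "\<dots> = foldr push (foldr push u v) [(x, True)]"
    by (simp add: foldr_push_assoc word_closed_Cons)
  also have "\<dots> = foldr push u v @ [(x, True)]"
    by (rule mul_reduced_append[OF r(2)])
  finally show ?thesis .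
qed

lemma lmult_inverse:
  assumes u: "u \<in> carrier (free_group (S - {x}))" and x: "x \<in> S"
  shows "wlift (lmult x u) (lmult x (winv u) a) = gen a"
proof (cases "a = x")
  case True
  have "foldr push (winv u) (u @ [(x, True)]) = [(x, True)]"
    using mul_winv_cancel(1)[of "[(x, True)]" u] append_in_free_group(1)[OF u x]
    by (simp add: carrier_free_group word_closed_Cons mul_reduced_append del: foldr_append)
  then show ?thesis
    using True wlift_lmult_avoiding[OF winv_closed[OF u]] wlift_lmult_same[OF u x]
    by (simp add: lmult_same wlift_append gen_def)
qed (simp add: word_eval)

locale auto_subgroup =
  fixes S :: "'a set" and H
  assumes H: "subgroup H (AG S)"
begin

lemma endo_in_mult:
  assumes "endo_in S H \<phi>" "endo_in S H \<psi>" "\<And>a. a \<in> S \<Longrightarrow> \<chi> a = wlift \<phi> (\<psi> a)"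
  shows "endo_in S H \<chi>"
proof -
  have adm: "adm S \<phi>" "adm S \<psi>" and H': "endo S \<phi> \<in> H" "endo S \<psi> \<in> H"
    using assms(1,2) by (simp_all add: endo_in_def)
  have "adm S \<chi>"
  proof
    fix a assume "a \<in> S"
    then show "\<chi> a \<in> carrier (free_group S)"
      using wlift_closed[OF adm(1)] adm(2) assms(3) by (simp add: Pi_iff)
  qed
  moreover have "endo S \<chi> \<in> H" by (rule endo_mult_in_subgroup[OF H H' adm]) (rule assms(3))
  ultimately show ?thesis by (simp add: endo_in_def)
qed

lemma endo_in_inverse:
  "endo_in S H \<phi> \<Longrightarrow> adm S \<psi> \<Longrightarrow> (\<And>a. a \<in> S \<Longrightarrow> wlift \<phi> (\<psi> a) = gen a) \<Longrightarrow> endo_in S H \<psi>"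
  unfolding endo_in_def using endo_inv_in_subgroup[OF H] by blast

lemma endo_in_mult3:
  assumes "endo_in S H \<phi>1" "endo_in S H \<phi>2" "endo_in S H \<phi>3" "\<And>a. a \<in> S \<Longrightarrow> \<chi> a = wlift \<phi>1 (wlift \<phi>2 (\<phi>3 a))"
  shows "endo_in S H \<chi>"
  by (rule endo_in_mult[OF assms(1) endo_in_mult[OF assms(2,3) refl] assms(4)])

text \<open>The words \<open>v\<close> for which \<open>x \<mapsto> v x\<close> lies in \<open>H\<close>. They form a group, because composing two such maps
  multiplies their words in the opposite order; working in it avoids composing automorphisms.\<close>

definition multiplier :: "'a \<Rightarrow> 'a word \<Rightarrow> bool"
  where "multiplier x v \<longleftrightarrow> x \<in> S \<and> v \<in> carrier (free_group (S - {x})) \<and> endo_in S H (lmult x v)"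

lemma multiplier_mem: "multiplier x v \<Longrightarrow> endo_in S H (lmult x v)"
  by (simp add: multiplier_def)

lemma multiplier_mult:
  assumes "multiplier x u" "multiplier x v"
  shows "multiplier x (foldr push u v)"
proof -
  have u: "x \<in> S" "u \<in> carrier (free_group (S - {x}))" "v \<in> carrier (free_group (S - {x}))" "reduced u"
    using assms by (auto simp: multiplier_def carrier_free_group)
  have "lmult x (foldr push u v) a = wlift (lmult x v) (lmult x u a)" if "a \<in> S" for a
  proof (cases "a = x")
    case True
    have "wlift (lmult x v) [(x, True)] = v @ [(x, True)]"
      by (rule wlift_lmult_same[OF u(3,1)])
    then show ?thesis
      using True u by (simp add: lmult_same wlift_append wlift_lmult_avoiding mul_append_assoc)
  next
    case False
    then show ?thesis using that by (simp add: word_eval)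
  qed
  then have "endo_in S H (lmult x (foldr push u v))"
    by (rule endo_in_mult[OF multiplier_mem[OF assms(2)] multiplier_mem[OF assms(1)]])
  then show ?thesis using u mul_closed[OF u(2,3)] by (simp add: multiplier_def)
qed

lemma multiplier_winv:
  assumes "multiplier x v"
  shows "multiplier x (winv v)"
proof -
  have v: "x \<in> S" "v \<in> carrier (free_group (S - {x}))" using assms by (auto simp: multiplier_def)
  note w = winv_closed[OF v(2)]
  have "endo_in S H (lmult x (winv v))"
    by (rule endo_in_inverse[OF multiplier_mem[OF assms] adm_lmult[OF w v(1)] lmult_inverse[OF v(2,1)]])
  then show ?thesis using v w by (simp add: multiplier_def)
qed

lemma multiplier_Nil: "x \<in> S \<Longrightarrow> multiplier x []"
proof -
  assume x: "x \<in> S"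
  have "endo S (lmult x []) = \<one>\<^bsub>AG S\<^esub>"
    unfolding one_AutoGroup endo_id[symmetric] by (rule endo_cong) (simp add: lmult_def gen_def)
  then show ?thesis
    using x subgroup.one_closed[OF H]
    by (simp add: multiplier_def endo_in_def adm_lmult carrier_free_group)
qed

lemma conj_by_inverse:
  assumes "endo_in S H (conj_by z z' e)" "z \<in> S" "z' \<in> S" "z \<noteq> z'"
  shows "endo_in S H (conj_by z z' d)"
proof (cases "d = e")
  case False
  then show ?thesis
    by - (rule endo_in_inverse[OF assms(1) adm_conj_by], use assms in \<open>auto simp: conj_by_def word_eval\<close>)
qed (use assms in simp)

text \<open>Conjugating \<open>x \<mapsto> v x\<close> by the conjugation of \<open>x\<close> by \<open>y\<close> conjugates \<open>v\<close> by \<open>y\<close>.\<close>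

lemma multiplier_conj:
  assumes v: "multiplier x v" and c: "\<And>e. endo_in S H (conj_by x y e)" and y: "y \<in> S" "y \<noteq> x"
  shows "multiplier x (push (y, d) (foldr push v [(y, \<not> d)]))"
proof -
  define C where "C = free_group (S - {x})"
  have multiplier: "x \<in> S" "v \<in> carrier C" "endo_in S H (lmult x v)" using v by (auto simp: multiplier_def C_def)
  have yC: "[(y, e)] \<in> carrier C" for e using y by (simp add: C_def)
  define w where "w = push (y, d) (foldr push v [(y, \<not> d)])"
  have wC: "w \<in> carrier C"
    using mul_closed[OF yC[of d, unfolded C_def] mul_closed[OF multiplier(2)[unfolded C_def] yC[of "\<not> d", unfolded C_def]]]
    by (simp add: w_def C_def)
  have "lmult x w a = wlift (conj_by x y (\<not> d)) (wlift (lmult x v) (conj_by x y d a))" if "a \<in> S" for a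
  proof (cases "a = x")
    case True
    have y_fixed: "signed_lift (lmult x v) (y, b) = [(y, b)]" "signed_lift (conj_by x y (\<not> d)) (y, b) = [(y, b)]" for b
      using y by (simp_all add: signed_lift_def lmult_def conj_by_def word_eval)
    have x_img: "signed_lift (lmult x v) (x, True) = v @ [(x, True)]"
      by (simp add: signed_lift_def lmult_def)
    have v_fixed: "wlift (conj_by x y (\<not> d)) v = v"
      unfolding conj_by_def by (rule wlift_upd_avoiding) (use multiplier(2) in \<open>simp add: C_def\<close>)
    have e: "wlift (conj_by x y (\<not> d)) [(x, True), (y, \<not> d)] = [(y, \<not> d), (x, True)]"
      using y by (simp add: conj_by_def word_eval)
    have p: "push (x, True) [(y, \<not> d)] = [(x, True), (y, \<not> d)]"
      "push (y, \<not> d) [(x, True)] = [(y, \<not> d), (x, True)]"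
      using y by (simp_all add: push_Cons inv_letter_def)
    have "wlift (lmult x v) (conj_by x y d x) = push (y, d) (foldr push v [(x, True), (y, \<not> d)])"
      by (simp add: conj_by_def wlift_Cons y_fixed x_img push_Nil p)
    then have "wlift (conj_by x y (\<not> d)) (wlift (lmult x v) (conj_by x y d x)) =
        push (y, d) (foldr push v [(y, \<not> d), (x, True)])"
      by (simp only: wlift_push wlift_mul v_fixed y_fixed e) simp
    moreover have "w @ [(x, True)] = foldr push w [(x, True)]"
      by (rule mul_reduced_append[symmetric])
        (use append_in_free_group(1)[OF wC[unfolded C_def] multiplier(1)] in \<open>simp add: carrier_free_group\<close>)
    moreover have "foldr push w [(x, True)] = push (y, d) (foldr push v [(y, \<not> d), (x, True)])"
      by (simp add: w_def foldr_push_push foldr_push_assoc word_closed_Cons p)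
    ultimately show ?thesis using True by (simp add: lmult_same)
  next
    case False
    then show ?thesis using that by (simp add: conj_by_def word_eval)
  qed
  then have "endo_in S H (lmult x w)" by (rule endo_in_mult3[OF c multiplier(3) c])
  then show ?thesis using multiplier wC by (simp add: multiplier_def C_def w_def)
qed

end

section \<open>Conjugation by automorphisms that move only the x among themselves\<close>

lemma X_in [simp]: "x \<in> X_set n \<Longrightarrow> x \<in> XY_set n k"
  and Y_in [simp]: "y \<in> Y_set k \<Longrightarrow> y \<in> XY_set n k"
  and X_neq_Y: "x \<in> X_set n \<Longrightarrow> y \<in> Y_set k \<Longrightarrow> x \<noteq> y"
  by (auto simp: XY_set_def X_set_def Y_set_def)

lemma Y_words_avoid:
  assumes "x \<in> X_set n" "v \<in> carrier (free_group (Y_set k))"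
  shows "v \<in> carrier (free_group (XY_set n k - {x}))"
proof -
  have "Y_set k \<subseteq> XY_set n k - {x}" using X_neq_Y[OF assms(1)] by auto
  then show ?thesis using assms(2) unfolding carrier_free_group by blast
qed

text \<open>A subgroup containing the maps \<open>x \<mapsto> y x\<close>, \<open>x \<mapsto> y x y\<^sup>-\<^sup>1\<close> and \<open>y \<mapsto> z y z\<^sup>-\<^sup>1\<close>. The lemmas below
  show that it contains their conjugates by automorphisms that fix the \<open>y\<close> and come from
  transvections or signed permutations of the \<open>x\<close>.\<close>

locale twist_group = auto_subgroup "XY_set n k" H for n k H +
  assumes lmult_xy: "x \<in> X_set n \<Longrightarrow> y \<in> Y_set k \<Longrightarrow> endo_in (XY_set n k) H (lmult x [(y, True)])"
    and conj_by_xy': "x \<in> X_set n \<Longrightarrow> y \<in> Y_set k \<Longrightarrow> endo_in (XY_set n k) H (conj_by x y True)"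
    and conj_by_yz': "y \<in> Y_set k \<Longrightarrow> z \<in> XY_set n k \<Longrightarrow> z \<noteq> y \<Longrightarrow> endo_in (XY_set n k) H (conj_by y z True)"
begin

abbreviation "inH \<equiv> endo_in (XY_set n k) H"

lemma conj_by_xy: "x \<in> X_set n \<Longrightarrow> y \<in> Y_set k \<Longrightarrow> inH (conj_by x y e)"
  by (rule conj_by_inverse[OF conj_by_xy']) (simp_all add: X_neq_Y)

lemma conj_by_yz: "y \<in> Y_set k \<Longrightarrow> z \<in> XY_set n k \<Longrightarrow> z \<noteq> y \<Longrightarrow> inH (conj_by y z e)"
  by (rule conj_by_inverse[OF conj_by_yz']) simp_all

lemma multiplier_letter:
  assumes "x \<in> X_set n" "y \<in> Y_set k"
  shows "multiplier x [(y, e)]"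
proof -
  have T: "multiplier x [(y, True)]"
    using assms lmult_xy[OF assms] X_neq_Y[OF assms] by (auto simp: multiplier_def)
  then show ?thesis using multiplier_winv[OF T] by (cases e) (simp_all add: winv_Cons inv_letter_def)
qed

text \<open>Obtained from \<open>x \<mapsto> y x\<close> by conjugating with \<open>y \<mapsto> b y b\<^sup>-\<^sup>1\<close>, which leaves \<open>x\<close> alone.\<close>

lemma multiplier_twisted:
  assumes x: "x \<in> X_set n" and y: "y \<in> Y_set k" and b: "b \<in> X_set n" "b \<noteq> x"
  shows "multiplier x [(b, d), (y, e), (b, \<not> d)]"
proof -
  have ne: "x \<noteq> y" "b \<noteq> y" using X_neq_Y assms by auto
  have "inH (lmult x [(b, d), (y, e), (b, \<not> d)])"
    by (rule endo_in_mult3[OF conj_by_yz[of y b d] multiplier_mem[OF multiplier_letter[OF x y, of e]] conj_by_yz[of y b "\<not> d"]])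
      (use assms ne in \<open>auto simp: lmult_def conj_by_def word_eval\<close>)
  then show ?thesis using assms ne by (auto simp: multiplier_def word_mem)
qed

lemma rmult_letter:
  assumes "x \<in> X_set n" "y \<in> Y_set k"
  shows "inH (rmult x [(y, e)])"
  by (rule endo_in_mult[OF multiplier_mem[OF multiplier_letter[OF assms, of e]] conj_by_xy[OF assms, of "\<not> e"]])
    (use X_neq_Y[OF assms] in \<open>auto simp: lmult_def conj_by_def rmult_def word_eval\<close>)

context
  fixes a b :: letter and d :: bool
  assumes a: "a \<in> X_set n" and b: "b \<in> X_set n" and ab: "a \<noteq> b"
begin

text \<open>With \<open>\<beta> = b\<^sup>\<plusminus>\<^sup>1\<close>, the transvection is \<open>a \<mapsto> \<beta> a\<close>. The conjugate differs from the original map only if \<open>x\<close>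
  is \<open>a\<close> or \<open>b\<close>, and then it multiplies \<open>a\<close> on the left by a conjugate of \<open>y\<^sup>\<plusminus>\<^sup>1\<close> by a power of \<open>b\<close>,
  besides multiplying \<open>b\<close> by \<open>y\<close> in the second case.\<close>

lemma transvection_conj_lmult:
  assumes x: "x \<in> X_set n" and y: "y \<in> Y_set k"
  shows "inH (\<lambda>c. wlift (lmult a [(b, d)]) (wlift (lmult x [(y, True)]) (lmult a [(b, \<not> d)] c)))"
proof -
  have ne: "x \<noteq> y" "a \<noteq> y" "b \<noteq> y" using X_neq_Y a b x y by auto
  consider "x \<noteq> a" "x \<noteq> b" | "x = a" | "x = b" by blast
  then show ?thesis
  proof cases
    case 1
    then show ?thesis
      by - (rule endo_in_cong[OF lmult_xy[OF x y]], use ab ne in \<open>auto simp: lmult_def word_eval\<close>)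
  next
    case 2
    then show ?thesis
      using ab ne
      by - (rule endo_in_cong[OF multiplier_mem[OF multiplier_twisted[OF a y b ab[symmetric], of "\<not> d" True]]],
        auto simp: lmult_def word_eval)
  next
    case 3
    \<comment> \<open>\<open>\<beta>\<^sup>-\<^sup>1\<close> goes to \<open>b\<^sup>-\<^sup>1 y\<^sup>-\<^sup>1\<close> or to \<open>y b\<close>, depending on the sign of \<open>\<beta>\<close>.\<close>
    define v where "v = (if d then [(b, False), (y, False), (b, True)] else [(y, True)])"
    have "inH (lmult a v)"
      using multiplier_mem[OF multiplier_twisted[OF a y b ab[symmetric], of False False]] multiplier_mem[OF multiplier_letter[OF a y, of True]]
      by (simp add: v_def)
    then show ?thesis
      by (rule endo_in_mult[OF _ lmult_xy[OF b y]])
        (use ab ne 3 in \<open>auto simp: v_def lmult_def word_eval\<close>)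
  qed
qed

text \<open>For \<open>x = a\<close> the conjugate is \<open>a \<mapsto> \<beta>\<^sup>-\<^sup>1 y \<beta> a y\<^sup>-\<^sup>1\<close>. For \<open>x = b\<close> it conjugates \<open>b\<close> by \<open>y\<close> and multiplies
  \<open>a\<close> by the commutator of \<open>y\<close> and \<open>\<beta>\<^sup>-\<^sup>1\<close>, a product of \<open>y\<close> and a conjugate of \<open>y\<^sup>-\<^sup>1\<close>.\<close>

lemma transvection_conj_conj_by_x:
  assumes x: "x \<in> X_set n" and y: "y \<in> Y_set k"
  shows "inH (\<lambda>c. wlift (lmult a [(b, d)]) (wlift (conj_by x y True) (lmult a [(b, \<not> d)] c)))"
proof -
  have ne: "x \<noteq> y" "a \<noteq> y" "b \<noteq> y" using X_neq_Y a b x y by auto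
  consider "x \<noteq> a" "x \<noteq> b" | "x = a" | "x = b" by blast
  then show ?thesis
  proof cases
    case 1
    then show ?thesis
      by - (rule endo_in_cong[OF conj_by_xy[OF x y, of True]], use ab ne in \<open>auto simp: lmult_def conj_by_def word_eval\<close>)
  next
    case 2
    then show ?thesis
      by - (rule endo_in_mult[OF multiplier_mem[OF multiplier_twisted[OF a y b ab[symmetric], of "\<not> d" True]]
          rmult_letter[OF a y, of False]],
        use ab ne in \<open>auto simp: lmult_def conj_by_def rmult_def word_eval\<close>)
  next
    case 3
    have "multiplier a (foldr push [(y, True)] [(b, \<not> d), (y, False), (b, d)])"
      using multiplier_mult[OF multiplier_letter[OF a y] multiplier_twisted[OF a y b ab[symmetric], of "\<not> d" False]] by simp
    then have v: "multiplier a [(y, True), (b, \<not> d), (y, False), (b, d)]"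
      using ne by (simp add: push_Cons inv_letter_def)
    show ?thesis
      by (rule endo_in_mult[OF multiplier_mem[OF v] conj_by_xy[OF b y, of True]])
        (use ab ne 3 in \<open>auto simp: lmult_def conj_by_def word_eval\<close>)
  qed
qed

text \<open>Only \<open>z = a\<close> matters, where the conjugate is \<open>y \<mapsto> \<beta> a y a\<^sup>-\<^sup>1 \<beta>\<^sup>-\<^sup>1\<close>.\<close>

lemma transvection_conj_conj_by_y:
  assumes y: "y \<in> Y_set k" and z: "z \<in> XY_set n k" "z \<noteq> y"
  shows "inH (\<lambda>c. wlift (lmult a [(b, d)]) (wlift (conj_by y z True) (lmult a [(b, \<not> d)] c)))"
proof -
  have ne: "a \<noteq> y" "b \<noteq> y" using X_neq_Y a b y by auto
  show ?thesis
  proof (cases "z = a")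
    case True
    then show ?thesis
      by - (rule endo_in_mult[OF conj_by_yz[OF y, of a True] conj_by_yz[OF y, of b d]],
        use a b ab ne in \<open>auto simp: lmult_def conj_by_def word_eval\<close>)
  next
    case False
    then show ?thesis
      by - (rule endo_in_cong[OF conj_by_yz[OF y z, of True]],
        use ab ne z in \<open>auto simp: lmult_def conj_by_def word_eval\<close>)
  qed
qed

end

context
  fixes h h' :: "letter \<Rightarrow> letter word"
  assumes h: "perm_subst n k h" and h': "perm_subst n k h'"
    and hh': "\<And>a. a \<in> XY_set n k \<Longrightarrow> wlift h (h' a) = gen a"
    and h'h: "\<And>a. a \<in> XY_set n k \<Longrightarrow> wlift h' (h a) = gen a"
begin

lemma perm_Y: "y \<in> Y_set k \<Longrightarrow> h y = gen y" "y \<in> Y_set k \<Longrightarrow> h' y = gen y"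
  using h h' by (auto simp: perm_subst_def Y_set_def)

lemma perm_X:
  assumes "x \<in> X_set n"
  obtains x1 e where "x1 \<in> X_set n" "h x = [(x1, e)]" "h' x1 = [(x, e)]"
proof -
  obtain x1 e where 1: "x1 \<in> X_set n" "h x = [(x1, e)]"
    using h assms unfolding perm_subst_def by blast
  obtain x2 e2 where 2: "x2 \<in> X_set n" "h' x1 = [(x2, e2)]"
    using h' 1 unfolding perm_subst_def by blast
  have "wlift h' [(x1, e)] = gen x" using h'h[of x] assms 1 by simp
  then have "x2 = x" "e2 = e"
    using 2 by (auto simp: word_eval split: if_splits)
  then show thesis using that 1 2 by blast
qed

text \<open>The conjugate of a substitution that changes only \<open>x\<close> changes only the letter underlying \<open>h x\<close>.\<close>

lemma perm_conj_other:
  assumes x: "x \<in> X_set n" "h x = [(x1, e)]" and c: "c \<in> XY_set n k" "c \<noteq> x1"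
  shows "wlift h (wlift (gen(x := u)) (h' c)) = gen c"
proof -
  from c(1) have "c \<in> X_set n \<or> c \<in> Y_set k" by (simp add: XY_set_def)
  then obtain c1 e1 where c1: "h' c = [(c1, e1)]" "c1 \<noteq> x"
  proof
    assume cX: "c \<in> X_set n"
    obtain c1 e1 where c1: "c1 \<in> X_set n" "h' c = [(c1, e1)]"
      using h' cX unfolding perm_subst_def by blast
    have "c1 \<noteq> x"
    proof
      assume "c1 = x"
      then have "wlift h [(x, e1)] = gen c" using hh'[OF c(1)] c1 by simp
      then show False using x c(2) by (auto simp: word_eval split: if_splits)
    qed
    then show thesis using that c1 by blast
  next
    assume "c \<in> Y_set k"
    then show thesis using that[of c True] perm_Y X_neq_Y[OF x(1)] by (auto simp: gen_def)
  qed
  then have "wlift (gen(x := u)) (h' c) = h' c" by (simp add: word_eval)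
  then show ?thesis using hh'[OF c(1)] by simp
qed

text \<open>If \<open>h\<close> inverts \<open>x\<close>, left multiplication by \<open>y\<close> becomes right multiplication by \<open>y\<^sup>-\<^sup>1\<close>.\<close>

lemma perm_conj_lmult:
  assumes x: "x \<in> X_set n" and y: "y \<in> Y_set k"
  shows "inH (\<lambda>c. wlift h (wlift (lmult x [(y, True)]) (h' c)))"
proof -
  obtain x1 e where x1: "x1 \<in> X_set n" "h x = [(x1, e)]" "h' x1 = [(x, e)]" by (rule perm_X[OF x])
  have ne: "x \<noteq> y" "x1 \<noteq> y" using X_neq_Y x x1 y by auto
  have "inH (if e then lmult x1 [(y, True)] else rmult x1 [(y, False)])"
    using lmult_xy[OF x1(1) y] rmult_letter[OF x1(1) y] by simp
  then show ?thesis
  proof (rule endo_in_cong)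
    fix c assume c: "c \<in> XY_set n k"
    show "wlift h (wlift (lmult x [(y, True)]) (h' c)) =
        (if e then lmult x1 [(y, True)] else rmult x1 [(y, False)]) c"
    proof (cases "c = x1")
      case True
      then show ?thesis
        using x1 ne perm_Y[OF y] by (cases e) (auto simp: lmult_def rmult_def word_eval)
    next
      case False
      then show ?thesis
        using perm_conj_other[OF x x1(2) c] by (simp add: lmult_def rmult_def)
    qed
  qed
qed

lemma perm_conj_conj_by_x:
  assumes x: "x \<in> X_set n" and y: "y \<in> Y_set k"
  shows "inH (\<lambda>c. wlift h (wlift (conj_by x y True) (h' c)))"
proof -
  obtain x1 e where x1: "x1 \<in> X_set n" "h x = [(x1, e)]" "h' x1 = [(x, e)]" by (rule perm_X[OF x])
  have ne: "x \<noteq> y" "x1 \<noteq> y" using X_neq_Y x x1 y by auto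
  show ?thesis
  proof (rule endo_in_cong[OF conj_by_xy[OF x1(1) y, of True]])
    fix c assume c: "c \<in> XY_set n k"
    show "wlift h (wlift (conj_by x y True) (h' c)) = conj_by x1 y True c"
    proof (cases "c = x1")
      case True
      then show ?thesis
        using x1 ne perm_Y[OF y] by (cases e) (auto simp: conj_by_def word_eval)
    next
      case False
      then show ?thesis
        using perm_conj_other[OF x x1(2) c] by (simp add: conj_by_def)
    qed
  qed
qed

lemma perm_conj_conj_by_y:
  assumes y: "y \<in> Y_set k" and z: "z \<in> XY_set n k" "z \<noteq> y"
  shows "inH (\<lambda>c. wlift h (wlift (conj_by y z True) (h' c)))"
proof -
  obtain z1 e where z1: "z1 \<in> XY_set n k" "z1 \<noteq> y" "h z = [(z1, e)]"
  proof (cases "z \<in> X_set n")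
    case True
    then show thesis using that perm_X[OF True] X_neq_Y[OF _ y] by (metis X_in)
  next
    case False
    then have "z \<in> Y_set k" using z by (simp add: XY_set_def)
    then show thesis using that[of z True] perm_Y z by (auto simp: gen_def)
  qed
  show ?thesis
  proof (rule endo_in_cong[OF conj_by_yz[OF y z1(1,2), of e]])
    fix c assume c: "c \<in> XY_set n k"
    show "wlift h (wlift (conj_by y z True) (h' c)) = conj_by y z1 e c"
    proof (cases "c = y")
      case True
      then show ?thesis
        using z1 z(2) perm_Y[OF y] by (cases e) (auto simp: conj_by_def word_eval)
    next
      case False
      have "wlift (conj_by y z True) (h' c) = h' c"
      proof (cases "c \<in> X_set n")
        case True
        then obtain c1 e1 where "c1 \<in> X_set n" "h' c = [(c1, e1)]"
          using h' unfolding perm_subst_def by blast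
        then show ?thesis using X_neq_Y[OF _ y] by (auto simp: conj_by_def word_eval)
      next
        case cX: False
        then have "h' c = gen c" using c perm_Y by (simp add: XY_set_def)
        then show ?thesis using False by (auto simp: conj_by_def word_eval)
      qed
      then show ?thesis using hh'[OF c] False by (simp add: conj_by_def)
    qed
  qed
qed

end

end

section \<open>Conjugation by left multiplications with a y\<close>

text \<open>A subgroup containing the generators of the theorem. The lemmas below show that it contains their
  conjugates by \<open>x \<mapsto> y\<^sup>\<plusminus>\<^sup>1 x\<close>.\<close>

locale commutator_group = auto_subgroup "XY_set n k" H for n k H +
  assumes lmult_comm: "x \<in> X_set n \<Longrightarrow> y \<in> Y_set k \<Longrightarrow> z \<in> XY_set n k \<Longrightarrow> z \<noteq> x \<Longrightarrow> z \<noteq> y \<Longrightarrow>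
      endo_in (XY_set n k) H (lmult x [(y, True), (z, True), (y, False), (z, False)])"
    and conj_by_yz': "y \<in> Y_set k \<Longrightarrow> z \<in> XY_set n k \<Longrightarrow> z \<noteq> y \<Longrightarrow> endo_in (XY_set n k) H (conj_by y z True)"
    and conj_by_zy': "y \<in> Y_set k \<Longrightarrow> z \<in> XY_set n k \<Longrightarrow> z \<noteq> y \<Longrightarrow> endo_in (XY_set n k) H (conj_by z y True)"
begin

abbreviation "inH \<equiv> endo_in (XY_set n k) H"

lemma conj_by_yz: "y \<in> Y_set k \<Longrightarrow> z \<in> XY_set n k \<Longrightarrow> z \<noteq> y \<Longrightarrow> inH (conj_by y z e)"
  by (rule conj_by_inverse[OF conj_by_yz']) simp_all

lemma conj_by_zy: "y \<in> Y_set k \<Longrightarrow> z \<in> XY_set n k \<Longrightarrow> z \<noteq> y \<Longrightarrow> inH (conj_by z y e)"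
  by (rule conj_by_inverse[OF conj_by_zy']) simp_all

lemma multiplier_conj_Y:
  assumes "multiplier x v" "x \<in> X_set n" "y \<in> Y_set k"
  shows "multiplier x (push (y, d) (foldr push v [(y, \<not> d)]))"
  by (rule multiplier_conj[OF assms(1)]) (use assms X_neq_Y[OF assms(2,3)] conj_by_zy[OF assms(3)] in auto)

text \<open>The case of \<open>y\<^sup>-\<^sup>1\<close> follows from \<open>[y\<^sup>-\<^sup>1, z] = y\<^sup>-\<^sup>1 [z, y] y\<close>.\<close>

lemma multiplier_comm_yz:
  assumes x: "x \<in> X_set n" and y: "y \<in> Y_set k" and z: "z \<in> XY_set n k" "z \<noteq> x" "z \<noteq> y"
  shows "multiplier x [(y, e), (z, True), (y, \<not> e), (z, False)]"
    "multiplier x [(z, True), (y, e), (z, False), (y, \<not> e)]"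
proof -
  have ne: "x \<noteq> y" using X_neq_Y[OF x y] .
  have T: "multiplier x [(y, True), (z, True), (y, False), (z, False)]"
    using lmult_comm[OF assms] x y z ne by (auto simp: multiplier_def word_mem)
  have 1: "multiplier x [(z, True), (y, True), (z, False), (y, False)]"
    using multiplier_winv[OF T] by (simp add: winv_Cons inv_letter_def)
  have 2: "multiplier x [(y, False), (z, True), (y, True), (z, False)]"
    using multiplier_conj_Y[OF 1 x y, of False] z by (simp add: push_Cons push_Nil inv_letter_def)
  have 3: "multiplier x [(z, True), (y, False), (z, False), (y, True)]"
    using multiplier_winv[OF 2] by (simp add: winv_Cons inv_letter_def)
  show "multiplier x [(y, e), (z, True), (y, \<not> e), (z, False)]"
    "multiplier x [(z, True), (y, e), (z, False), (y, \<not> e)]"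
    using T 1 2 3 by (cases e; simp)+
qed

context
  fixes x y :: letter and e :: bool
  assumes x: "x \<in> X_set n" and y: "y \<in> Y_set k"
begin

text \<open>Write \<open>y\<close> for \<open>y\<^sup>\<plusminus>\<^sup>1\<close>. For \<open>x' = x\<close> the commutator is conjugated by \<open>y\<^sup>-\<^sup>1\<close>. For \<open>z = x\<close> it becomes
  \<open>[y', y x] = [y', y] \<cdot> y [y', x] y\<^sup>-\<^sup>1\<close>. In all other cases the two maps commute.\<close>

lemma lmult_conj_lmult:
  assumes x': "x' \<in> X_set n" and y': "y' \<in> Y_set k" and z: "z \<in> XY_set n k" "z \<noteq> x'" "z \<noteq> y'"
  shows "inH (\<lambda>c. wlift (lmult x [(y, e)])
    (wlift (lmult x' [(y', True), (z, True), (y', False), (z, False)]) (lmult x [(y, \<not> e)] c)))"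
proof -
  have ne: "x \<noteq> y" "x' \<noteq> y'" "x' \<noteq> y" "x \<noteq> y'" using X_neq_Y x x' y y' by auto
  consider "x' = x" | "x' \<noteq> x" "z \<noteq> x" | "x' \<noteq> x" "z = x" by blast
  then show ?thesis
  proof cases
    case 1
    have "multiplier x (push (y, \<not> e) (foldr push [(y', True), (z, True), (y', False), (z, False)] [(y, \<not> \<not> e)]))"
      by (rule multiplier_conj_Y[OF multiplier_comm_yz(1)[of x y' z True, simplified]]) (use 1 x y y' z in auto)
    then show ?thesis
      by (rule endo_in_cong[OF multiplier_mem])
        (use 1 ne z in \<open>cases e; cases "y = y'"; cases "y = z"; auto simp: lmult_def word_eval\<close>)
  next
    case 2
    then show ?thesis
      by - (rule endo_in_cong[OF lmult_comm[OF x' y' z]], use ne z in \<open>auto simp: lmult_def word_eval\<close>)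
  next
    case 3
    have A: "multiplier x' (push (y, e) (foldr push [(y', True), (x, True), (y', False), (x, False)] [(y, \<not> e)]))"
      by (rule multiplier_conj_Y[OF multiplier_comm_yz(1)[of x' y' x True, simplified]]) (use 3 x x' y y' ne in auto)
    have B: "multiplier x' (if y' = y then [] else [(y', True), (y, e), (y', False), (y, \<not> e)])"
      using multiplier_comm_yz(2)[OF x' y, of y' e] multiplier_Nil[of x'] x' y' ne by auto
    show ?thesis
      by (rule endo_in_cong[OF multiplier_mem[OF multiplier_mult[OF B A]]])
        (use 3 ne in \<open>cases e; cases "y = y'"; auto simp: lmult_def word_eval\<close>)
  qed
qed

text \<open>Write \<open>y\<close> for \<open>y\<^sup>\<plusminus>\<^sup>1\<close>, except in comparisons. If \<open>z \<noteq> x\<close> and \<open>y = y'\<close>, the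
  conjugate also multiplies \<open>x\<close> by \<open>[z, y\<^sup>-\<^sup>1]\<close>. If \<open>z = x\<close> and \<open>y \<noteq> y'\<close>, it conjugates \<open>y'\<close> by
  \<open>y x\<close>. If \<open>z = x\<close> and \<open>y = y'\<close>, it is the conjugation of \<open>y'\<close> by \<open>x\<close> followed by that of \<open>x\<close> by
  \<open>y\<close>.\<close>

lemma lmult_conj_conj_by_y:
  assumes y': "y' \<in> Y_set k" and z: "z \<in> XY_set n k" "z \<noteq> y'"
  shows "inH (\<lambda>c. wlift (lmult x [(y, e)]) (wlift (conj_by y' z True) (lmult x [(y, \<not> e)] c)))"
proof -
  have ne: "x \<noteq> y" "x \<noteq> y'" using X_neq_Y x y y' by auto
  consider "z \<noteq> x" "y \<noteq> y'" | "z \<noteq> x" "y = y'" | "z = x" "y \<noteq> y'" | "z = x" "y = y'" by blast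
  then show ?thesis
  proof cases
    case 1
    then show ?thesis
      by - (rule endo_in_cong[OF conj_by_yz'[OF y' z]], use ne z in \<open>auto simp: lmult_def conj_by_def word_eval\<close>)
  next
    case 2
    then show ?thesis
      by - (rule endo_in_mult[OF multiplier_mem[OF multiplier_comm_yz(2)[OF x y, of z "\<not> e"]] conj_by_yz'[OF y' z]],
        use ne z in \<open>auto simp: lmult_def conj_by_def word_eval\<close>)
  next
    case 3
    then show ?thesis
      by - (rule endo_in_mult[OF conj_by_yz'[OF y', of x] conj_by_yz[OF y', of y e]],
        use ne x y in \<open>auto simp: lmult_def conj_by_def word_eval\<close>)
  next
    case 4
    then show ?thesis
      by - (rule endo_in_mult[OF conj_by_zy[OF y, of x e] conj_by_yz'[OF y, of x]],
        use ne x y in \<open>auto simp: lmult_def conj_by_def word_eval\<close>)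
  qed
qed

text \<open>For \<open>x' = x\<close> the conjugate is \<open>x \<mapsto> y\<^sup>-\<^sup>1 y' y x y'\<^sup>-\<^sup>1\<close> (with \<open>y\<close> for \<open>y\<^sup>\<plusminus>\<^sup>1\<close>), which is the conjugation by
  \<open>y'\<close> after multiplication by \<open>[y\<^sup>-\<^sup>1, y']\<close>.\<close>

lemma lmult_conj_conj_by_x:
  assumes x': "x' \<in> X_set n" and y': "y' \<in> Y_set k"
  shows "inH (\<lambda>c. wlift (lmult x [(y, e)]) (wlift (conj_by x' y' True) (lmult x [(y, \<not> e)] c)))"
proof -
  have ne: "x \<noteq> y" "x \<noteq> y'" "x' \<noteq> y'" "x' \<noteq> y" using X_neq_Y x y x' y' by auto
  show ?thesis
  proof (cases "x' = x")
    case True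
    have multiplier: "multiplier x (if y' = y then [] else [(y, \<not> e), (y', True), (y, e), (y', False)])"
      using multiplier_comm_yz(1)[OF x y, of y' "\<not> e"] multiplier_Nil[of x] x y' ne by auto
    show ?thesis
      by (rule endo_in_mult[OF conj_by_zy'[OF y', of x] multiplier_mem[OF multiplier]])
        (use True ne x in \<open>auto simp: lmult_def conj_by_def word_eval\<close>)
  next
    case False
    then show ?thesis
      by - (rule endo_in_cong[OF conj_by_zy'[OF y', of x']], use ne x' in \<open>auto simp: lmult_def conj_by_def word_eval\<close>)
  qed
qed

end

end

section \<open>Membership conditions on the generators of the free group\<close>

abbreviation FN where "FN n k \<equiv> ab_kernel (F n k)"

lemma FN_normal: "FN n k \<lhd> F n k"
  unfolding ab_kernel_def by (rule group.derived_self_is_normal[OF group_free_group])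

lemma auto_eqI:
  assumes "f \<in> auto G" "g \<in> auto G" "\<And>w. w \<in> carrier G \<Longrightarrow> f w = g w"
  shows "f = g"
  using assms by (intro extensionalityI[of f "carrier G" g]) (auto simp: auto_def Bij_def)

text \<open>Applies to the projection to automorphisms of \<open>Fx n\<close> as well as to the action on the
  abelianization.\<close>

lemma induced_identity_iff:
  assumes G: "group G" and g: "g \<in> auto G" and surj: "q ` A = carrier G"
    and ind: "\<And>w. w \<in> A \<Longrightarrow> g (q w) = q (f w)"
  shows "g = \<one>\<^bsub>AutoGroup G\<^esub> \<longleftrightarrow> (\<forall>w\<in>A. q (f w) = q w)"
proof
  assume g1: "g = \<one>\<^bsub>AutoGroup G\<^esub>"
  show "\<forall>w\<in>A. q (f w) = q w"
  proof
    fix w assume w: "w \<in> A"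
    then have "q w \<in> carrier G" using surj by blast
    then show "q (f w) = q w" using ind[OF w] by (simp add: g1 one_AutoGroup)
  qed
next
  assume q: "\<forall>w\<in>A. q (f w) = q w"
  show "g = \<one>\<^bsub>AutoGroup G\<^esub>"
    unfolding one_AutoGroup
  proof (rule auto_eqI[OF g group.id_in_auto[OF G]])
    fix c assume c: "c \<in> carrier G"
    then obtain w where "w \<in> A" "c = q w" using surj by blast
    then show "g c = (\<lambda>x\<in>carrier G. x) c" using ind q c by simp
  qed
qed

lemma K_set_iff:
  "f \<in> K_set n k \<longleftrightarrow> f \<in> A_set n k \<and> (\<forall>w\<in>carrier (F n k). kill_Y n (f w) = kill_Y n w)"
  using induced_identity_iff[OF group_free_group proj_kill_Y(1) kill_Y_surj proj_kill_Y(2)]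
  unfolding K_set_def kernel_def by (auto simp: A_group_def)

lemma IA_set_iff:
  "f \<in> IA_set n k \<longleftrightarrow> f \<in> auto (F n k) \<and>
    (\<forall>w\<in>carrier (F n k). FN n k #>\<^bsub>F n k\<^esub> f w = FN n k #>\<^bsub>F n k\<^esub> w)"
proof -
  interpret N: normal "FN n k" "F n k" by (rule FN_normal)
  have H: "group (abelianization (F n k))"
    unfolding abelianization_def by (rule N.factorgroup_is_group)
  have surj: "(\<lambda>w. FN n k #>\<^bsub>F n k\<^esub> w) ` carrier (F n k) = carrier (abelianization (F n k))"
    by (simp add: abelianization_def carrier_FactGroup)
  note act = ab_action[OF group_free_group[of "XY_set n k"]]
  have "ab_action (F n k) f = \<one>\<^bsub>AutoGroup (abelianization (F n k))\<^esub> \<longleftrightarrow>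
      (\<forall>w\<in>carrier (F n k). FN n k #>\<^bsub>F n k\<^esub> f w = FN n k #>\<^bsub>F n k\<^esub> w)"
    if f: "f \<in> auto (F n k)"
    by (rule induced_identity_iff[OF H act(1)[OF f] surj act(2)[OF f]])
  then show ?thesis unfolding IA_set_def kernel_def by auto
qed

text \<open>Covers both conditions cutting out the group of the theorem: preserving the fibres of \<open>kill_Y\<close> and
  preserving the cosets of the commutator subgroup.\<close>

lemma subgroup_preserving:
  assumes A: "subgroup A (AutoGroup G)" and G: "group G"
  shows "subgroup {f \<in> A. \<forall>w\<in>carrier G. q (f w) = q w} (AutoGroup G)" (is "subgroup ?B _")
proof -
  interpret AG: group "AutoGroup G" by (rule group.AutoGroup[OF G])
  have a: "f \<in> auto G" if "f \<in> A" for f using subgroup.mem_carrier[OF A that] by simp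
  show ?thesis
  proof (rule AG.subgroupI)
    show "?B \<subseteq> carrier (AutoGroup G)" using a by auto
    have "(\<lambda>x\<in>carrier G. x) \<in> ?B"
      using subgroup.one_closed[OF A] by (simp add: one_AutoGroup)
    then show "?B \<noteq> {}" by blast
  next
    fix f assume f: "f \<in> ?B"
    let ?i = "inv\<^bsub>AutoGroup G\<^esub> f"
    have i: "?i \<in> A" using f subgroup.m_inv_closed[OF A] by simp
    have "q (?i w) = q w" if w: "w \<in> carrier G" for w
    proof -
      have "f (?i w) = w"
        using AutoGroup_inv_apply[OF G a[OF i] w] f a by simp
      moreover have "q (f (?i w)) = q (?i w)" using f auto_closed[OF a[OF i] w] by blast
      ultimately show ?thesis by simp
    qed
    then show "?i \<in> ?B" using i by blast
  next
    fix f g assume fg: "f \<in> ?B" "g \<in> ?B"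
    then have c: "f \<otimes>\<^bsub>AutoGroup G\<^esub> g \<in> A" "f \<in> auto G" "g \<in> auto G"
      using subgroup.m_closed[OF A] a by auto
    have "q ((f \<otimes>\<^bsub>AutoGroup G\<^esub> g) w) = q w" if w: "w \<in> carrier G" for w
      using fg auto_closed[OF c(3) w] w by (simp add: AutoGroup_mult[OF c(2,3)] compose_eq)
    then show "f \<otimes>\<^bsub>AutoGroup G\<^esub> g \<in> ?B" using c(1) by blast
  qed
qed

lemma subgroup_K_set: "subgroup (K_set n k) (AF n k)"
proof -
  have "K_set n k = {f \<in> A_set n k. \<forall>w\<in>carrier (F n k). kill_Y n (f w) = kill_Y n w}"
    by (auto simp: K_set_iff)
  then show ?thesis by (simp add: subgroup_preserving subgroup_A_set group_free_group)
qed

lemma subgroup_KIA_set: "subgroup (KIA_set n k) (AF n k)"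
proof -
  have "KIA_set n k = {f \<in> K_set n k. \<forall>w\<in>carrier (F n k).
      FN n k #>\<^bsub>F n k\<^esub> f w = FN n k #>\<^bsub>F n k\<^esub> w}"
    by (auto simp: KIA_set_def IA_set_iff K_set_iff A_set_def)
  then show ?thesis by (simp add: subgroup_preserving subgroup_K_set group_free_group)
qed

lemma K_setI:
  assumes f: "f \<in> A_set n k" and X: "\<And>i. i \<in> {1..n} \<Longrightarrow> kill_Y n (f (gen (X i))) = gen (X i)"
  shows "f \<in> K_set n k"
  unfolding K_set_iff
proof (intro conjI ballI f)
  fix w assume w: "w \<in> carrier (F n k)"
  have h: "kill_Y n \<circ> f \<in> hom (F n k) (Fx n)"
    by (rule Group.hom_compose[OF auto_homD[OF A_setD[OF f]] kill_Y_hom])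
  have "(kill_Y n \<circ> f) w = kill_Y n w"
  proof (rule hom_eq_on_gens[OF h kill_Y_hom group_free_group _ w])
    fix a assume a: "a \<in> XY_set n k"
    then show "(kill_Y n \<circ> f) (gen a) = kill_Y n (gen a)"
    proof (cases rule: XY_cases)
      case (1 i)
      then have "i \<in> {1..n}" by (auto simp: X_set_def)
      then show ?thesis using X 1 by (simp add: kill_Y_X)
    next
      case (2 i)
      then show ?thesis
        using A_set_kernel[OF f gen_Y_in_F[OF 2(2)]] by (simp add: kill_Y_Y)
    qed
  qed
  then show "kill_Y n (f w) = kill_Y n w" by simp
qed

lemma IA_setI:
  assumes f: "f \<in> auto (F n k)"
    and gens: "\<And>a. a \<in> XY_set n k \<Longrightarrow> FN n k #>\<^bsub>F n k\<^esub> f (gen a) = FN n k #>\<^bsub>F n k\<^esub> gen a"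
  shows "f \<in> IA_set n k"
  unfolding IA_set_iff
proof (intro conjI ballI f)
  fix w assume w: "w \<in> carrier (F n k)"
  interpret N: normal "FN n k" "F n k" by (rule FN_normal)
  have h: "(\<lambda>w. FN n k #>\<^bsub>F n k\<^esub> w) \<circ> f \<in> hom (F n k) (F n k Mod FN n k)"
    by (rule Group.hom_compose[OF auto_homD[OF f] N.r_coset_hom_Mod])
  have "((\<lambda>w. FN n k #>\<^bsub>F n k\<^esub> w) \<circ> f) w = FN n k #>\<^bsub>F n k\<^esub> w"
    by (rule hom_eq_on_gens[OF h N.r_coset_hom_Mod N.factorgroup_is_group _ w]) (simp add: gens)
  then show "FN n k #>\<^bsub>F n k\<^esub> f w = FN n k #>\<^bsub>F n k\<^esub> w" by simp
qed

lemma commutator_closed: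
  "group G \<Longrightarrow> a \<in> carrier G \<Longrightarrow> b \<in> carrier G \<Longrightarrow> commutator G a b \<in> carrier G"
  by (simp add: commutator_def group.inv_closed group.is_monoid monoid.m_closed)

lemma coset_mult_iff:
  assumes "N \<lhd> G" and c: "c \<in> carrier G" and w: "w \<in> carrier G"
  shows "N #>\<^bsub>G\<^esub> (c \<otimes>\<^bsub>G\<^esub> w) = N #>\<^bsub>G\<^esub> w \<longleftrightarrow> c \<in> N"
proof -
  interpret N: normal N G by fact
  show ?thesis
  proof
    assume "N #>\<^bsub>G\<^esub> (c \<otimes>\<^bsub>G\<^esub> w) = N #>\<^bsub>G\<^esub> w"
    then have "c \<otimes>\<^bsub>G\<^esub> w \<in> N #>\<^bsub>G\<^esub> w"
      using N.rcos_self[OF _ N.is_subgroup, of "c \<otimes>\<^bsub>G\<^esub> w"] c w by simp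
    then obtain h where h: "h \<in> N" "c \<otimes>\<^bsub>G\<^esub> w = h \<otimes>\<^bsub>G\<^esub> w" by (auto simp: r_coset_def)
    then have "c = h" using c w N.subset N.right_cancel[of w c h] by auto
    then show "c \<in> N" using h by simp
  next
    assume "c \<in> N"
    then have "N #>\<^bsub>G\<^esub> c = N" by (rule N.coset_join2[OF c N.is_subgroup])
    then show "N #>\<^bsub>G\<^esub> (c \<otimes>\<^bsub>G\<^esub> w) = N #>\<^bsub>G\<^esub> w"
      using N.coset_mult_assoc[OF N.subset c w] by simp
  qed
qed

lemma commutator_coset:
  assumes "a \<in> carrier (F n k)" "b \<in> carrier (F n k)" "w \<in> carrier (F n k)"
  shows "FN n k #>\<^bsub>F n k\<^esub> (commutator (F n k) a b \<otimes>\<^bsub>F n k\<^esub> w) = FN n k #>\<^bsub>F n k\<^esub> w"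
proof -
  have "commutator (F n k) a b \<in> FN n k"
    unfolding ab_kernel_def derived_def commutator_def
    using assms by (intro generate.incl) blast
  then show ?thesis
    using coset_mult_iff[OF FN_normal commutator_closed[OF group_free_group assms(1,2)] assms(3)] by simp
qed

lemma M_aut_eq:
  assumes "x \<in> X_set n" "y \<in> Y_set k" "z \<in> XY_set n k" "z \<noteq> x" "z \<noteq> y"
  shows "M_aut n k x (commutator (F n k) (gen y) (gen z)) =
    endoF n k (lmult x [(y, True), (z, True), (y, False), (z, False)])"
proof -
  have ne: "x \<noteq> y" by (rule X_neq_Y[OF assms(1,2)])
  have eq: "commutator (F n k) (gen y) (gen z) \<otimes>\<^bsub>F n k\<^esub> gen x =
      [(y, True), (z, True), (y, False), (z, False), (x, True)]"
    using assms ne unfolding commutator_def mult_free_group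
    by (simp add: inv_gen) (simp add: word_eval)
  show ?thesis
    unfolding M_aut_def subst_gen_def endo_def lmult_def fun_upd_def eq append.simps ..
qed

lemma C_aut_eq:
  assumes "z \<in> XY_set n k" "z' \<in> XY_set n k" "z \<noteq> z'"
  shows "C_aut n k z z' = endoF n k (conj_by z z' True)"
proof -
  have eq: "gen z' \<otimes>\<^bsub>F n k\<^esub> gen z \<otimes>\<^bsub>F n k\<^esub> inv\<^bsub>F n k\<^esub> (gen z') = [(z', True), (z, True), (z', False)]"
    using assms unfolding mult_free_group by (simp add: inv_gen) (simp add: word_eval)
  show ?thesis
    unfolding C_aut_def subst_gen_def endo_def conj_by_def fun_upd_def eq not_True_eq_False ..
qed

lemma lmult_auto:
  assumes x: "x \<in> S" and v: "v \<in> carrier (free_group (S - {x}))"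
  shows "endo S (lmult x v) \<in> auto (free_group S)"
proof -
  note w = winv_closed[OF v]
  show ?thesis
    by (rule endo_auto[OF adm_lmult[OF v x] adm_lmult[OF w x] lmult_inverse[OF v x]])
      (use lmult_inverse[OF w x] in simp)
qed

lemma conj_by_auto:
  assumes "z \<in> S" "z' \<in> S" "z \<noteq> z'"
  shows "endo S (conj_by z z' e) \<in> auto (free_group S)"
  by (rule endo_auto[of _ _ "conj_by z z' (\<not> e)"])
    (use assms in \<open>auto simp: adm_conj_by simp del: Pi_iff\<close>, (auto simp: conj_by_def word_eval)?)

lemma lmult_in_A_set:
  assumes "x \<in> X_set n" "v \<in> carrier (free_group (XY_set n k - {x}))"
  shows "endoF n k (lmult x v) \<in> A_set n k"
  unfolding A_set_iff
proof (intro conjI ballI)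
  show "endoF n k (lmult x v) \<in> auto (F n k)" by (rule lmult_auto) (use assms in auto)
  fix i assume i: "i \<in> {1..k}"
  then have Y: "Y i \<in> Y_set k" by (simp add: Y_set_def)
  have "endoF n k (lmult x v) (gen (Y i)) = gen (Y i)"
    using X_neq_Y[OF assms(1) Y] Y assms by (simp add: endo_gen adm_lmult)
  then show "endoF n k (lmult x v) (gen (Y i)) \<in> conj_class (F n k) (gen (Y i))"
    using conj_class_self[OF group_free_group gen_Y_in_F[OF i]] by simp
qed

lemma conj_by_in_A_set:
  assumes "z \<in> XY_set n k" "z' \<in> XY_set n k" "z \<noteq> z'"
  shows "endoF n k (conj_by z z' e) \<in> A_set n k"
  unfolding A_set_iff
proof (intro conjI ballI)
  show "endoF n k (conj_by z z' e) \<in> auto (F n k)" by (rule conj_by_auto[OF assms])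
  fix i assume i: "i \<in> {1..k}"
  then have Y: "Y i \<in> XY_set n k" by (simp add: XY_set_def Y_set_def)
  have g: "reduced (gen (Y i))" by (simp add: gen_def reduced_def)
  have e: "endoF n k (conj_by z z' e) (gen (Y i)) = conj_by z z' e (Y i)"
    by (rule endo_gen[OF Y adm_conj_by[OF assms(2,1,3)]])
  show "endoF n k (conj_by z z' e) (gen (Y i)) \<in> conj_class (F n k) (gen (Y i))"
  proof (cases "Y i = z")
    case True
    have "conj_by z z' e (Y i) = foldr push [(z', e)] (foldr push (gen (Y i)) (winv [(z', e)]))"
      using True assms(3) by (auto simp: conj_by_def word_eval)
    moreover have "[(z', e)] \<in> carrier (F n k)" using assms(2) by simp
    ultimately show ?thesis unfolding e conj_class_iff[OF g] by blast
  next
    case False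
    then show ?thesis
      unfolding e using conj_class_self[OF group_free_group gen_Y_in_F[OF i]] by (simp add: conj_by_def)
  qed
qed

text \<open>Every generator changes a single letter \<open>z\<close>, into \<open>[c, d] z\<close> for letters \<open>c\<close> and \<open>d\<close> one of which is
  a \<open>y\<close>: a conjugate \<open>z' z z'\<^sup>-\<^sup>1\<close> is \<open>[z', z] z\<close>. Such a commutator dies both in the abelianization and
  under \<open>kill_Y\<close>.\<close>

lemma KIA_generators_in_KIA: "KIA_generators n k \<subseteq> KIA_set n k"
proof -
  interpret G: group "F n k" by (rule group_free_group)
  interpret Q: group_hom "F n k" "Fx n" "kill_Y n"
    by (intro group_hom.intro group_hom_axioms.intro group_free_group kill_Y_hom)
  have main: "f \<in> KIA_set n k"
    if f: "f \<in> A_set n k" and fe: "f = endoF n k (gen(z := u))" "adm (XY_set n k) (gen(z := u))"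
      and z: "z \<in> XY_set n k"
      and u: "u = commutator (F n k) (gen c) (gen d) \<otimes>\<^bsub>F n k\<^esub> gen z"
      and cd: "c \<in> XY_set n k" "d \<in> XY_set n k" "c \<in> Y_set k \<or> d \<in> Y_set k"
    for f z u c d
  proof -
    have val: "f (gen a) = (if a = z then u else gen a)" if "a \<in> XY_set n k" for a
      unfolding fe(1) using endo_gen[OF that fe(2)] by simp
    have gens: "gen c \<in> carrier (F n k)" "gen d \<in> carrier (F n k)" "gen z \<in> carrier (F n k)"
      using cd z by simp_all
    have "f \<in> IA_set n k"
      by (rule IA_setI[OF A_setD[OF f]]) (use val commutator_coset[OF gens] in \<open>auto simp: u\<close>)
    moreover have "f \<in> K_set n k"
    proof (rule K_setI[OF f])
      fix i assume i: "i \<in> {1..n}"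
      then have X: "X i \<in> XY_set n k" by (simp add: XY_set_def X_set_def)
      have k1: "kill_Y n (gen c) = \<one>\<^bsub>Fx n\<^esub> \<or> kill_Y n (gen d) = \<one>\<^bsub>Fx n\<^esub>"
        using cd(3) by (auto simp: Y_set_def kill_Y_Y)
      have "kill_Y n (commutator (F n k) (gen c) (gen d)) = \<one>\<^bsub>Fx n\<^esub>"
        using k1 gens by (auto simp: commutator_def)
      then have "kill_Y n u = kill_Y n (gen z)"
        using gens commutator_closed[OF group_free_group gens(1,2)] by (simp add: u)
      then show "kill_Y n (f (gen (X i))) = gen (X i)"
        using val[OF X] kill_Y_X[OF i] by auto
    qed
    ultimately show ?thesis by (simp add: KIA_set_def)
  qed
  have comm_gen: "gen d \<otimes>\<^bsub>F n k\<^esub> gen c \<otimes>\<^bsub>F n k\<^esub> inv\<^bsub>F n k\<^esub> (gen d) =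
      commutator (F n k) (gen d) (gen c) \<otimes>\<^bsub>F n k\<^esub> gen c"
    if "c \<in> XY_set n k" "d \<in> XY_set n k" for c d
    using that by (simp add: commutator_def G.m_assoc)
  have C: "C_aut n k z z' \<in> KIA_set n k"
    if zz: "z \<in> XY_set n k" "z' \<in> XY_set n k" "z \<noteq> z'" "z \<in> Y_set k \<or> z' \<in> Y_set k" for z z'
  proof (rule main[of _ z _ z' z])
    show "C_aut n k z z' \<in> A_set n k"
      unfolding C_aut_eq[OF zz(1-3)] by (rule conj_by_in_A_set[OF zz(1-3)])
    show "C_aut n k z z' = endoF n k (gen(z := commutator (F n k) (gen z') (gen z) \<otimes>\<^bsub>F n k\<^esub> gen z))"
      unfolding C_aut_def subst_gen_def endo_def fun_upd_def comm_gen[OF zz(1,2)] ..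
    show "adm (XY_set n k) (gen(z := commutator (F n k) (gen z') (gen z) \<otimes>\<^bsub>F n k\<^esub> gen z))"
      using zz by (intro adm_upd G.m_closed commutator_closed[OF group_free_group]) auto
  qed (use zz in auto)
  have M: "M_aut n k x (commutator (F n k) (gen y) (gen z)) \<in> KIA_set n k"
    if xyz: "x \<in> X_set n" "y \<in> Y_set k" "z \<in> XY_set n k" "z \<noteq> x" "z \<noteq> y" for x y z
  proof (rule main[of _ x _ y z])
    have c: "[(y, True), (z, True), (y, False), (z, False)] \<in> carrier (free_group (XY_set n k - {x}))"
      using xyz X_neq_Y[OF xyz(1,2)] by (auto simp: word_mem)
    show "M_aut n k x (commutator (F n k) (gen y) (gen z)) \<in> A_set n k"
      unfolding M_aut_eq[OF xyz] by (rule lmult_in_A_set[OF xyz(1) c])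
    show "M_aut n k x (commutator (F n k) (gen y) (gen z)) =
        endoF n k (gen(x := commutator (F n k) (gen y) (gen z) \<otimes>\<^bsub>F n k\<^esub> gen x))"
      unfolding M_aut_def subst_gen_def endo_def fun_upd_def ..
    show "adm (XY_set n k) (gen(x := commutator (F n k) (gen y) (gen z) \<otimes>\<^bsub>F n k\<^esub> gen x))"
      using xyz by (intro adm_upd G.m_closed commutator_closed[OF group_free_group]) auto
  qed (use xyz in auto)
  show ?thesis
    unfolding KIA_generators_def using C M by (auto simp: eq_commute)
qed

lemma finite_KIA_generators: "finite (KIA_generators n k)"
proof -
  have fin: "finite (X_set n)" "finite (Y_set k)" "finite (XY_set n k)"
    by (simp_all add: X_set_def Y_set_def XY_set_def)
  have "KIA_generators n k \<subseteq>
      (\<Union>x\<in>X_set n. \<Union>y\<in>Y_set k. \<Union>z\<in>XY_set n k. {M_aut n k x (commutator (F n k) (gen y) (gen z))})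
      \<union> (\<Union>y\<in>XY_set n k. \<Union>z\<in>XY_set n k. {C_aut n k y z})" (is "_ \<subseteq> ?M \<union> ?C")
  proof
    fix f assume "f \<in> KIA_generators n k"
    then consider x y z where "x \<in> X_set n" "y \<in> Y_set k" "z \<in> XY_set n k"
        "f = M_aut n k x (commutator (F n k) (gen y) (gen z))"
      | y z where "y \<in> Y_set k" "z \<in> XY_set n k" "f = C_aut n k y z \<or> f = C_aut n k z y"
      unfolding KIA_generators_def by blast
    then show "f \<in> ?M \<union> ?C"
    proof cases
      case (2 y z)
      then have "y \<in> XY_set n k" by simp
      then show ?thesis using 2 by blast
    qed blast
  qed
  then show ?thesis by (rule finite_subset) (use fin in simp)
qed

section \<open>A generating set of the kernel of the projection\<close>

lemma subgroup_generate: "Q \<subseteq> auto (free_group S) \<Longrightarrow> subgroup (generate (AG S) Q) (AG S)"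
  by (rule group.generate_is_subgroup[OF group_AG]) simp

text \<open>Together with the signed permutations, these account for the moves that involve only the \<open>x\<close>.\<close>

definition transvections :: "nat \<Rightarrow> nat \<Rightarrow> (letter word \<Rightarrow> letter word) set"
  where "transvections n k =
    {endoF n k (lmult a [(b, d)]) | a b d. a \<in> X_set n \<and> b \<in> X_set n \<and> a \<noteq> b}"

definition K_generators :: "nat \<Rightarrow> nat \<Rightarrow> (letter word \<Rightarrow> letter word) set"
  where "K_generators n k =
    {endoF n k (lmult x [(y, True)]) | x y. x \<in> X_set n \<and> y \<in> Y_set k}
    \<union> {endoF n k (conj_by x y True) | x y. x \<in> X_set n \<and> y \<in> Y_set k}
    \<union> {endoF n k (conj_by y z True) | y z. y \<in> Y_set k \<and> z \<in> XY_set n k \<and> z \<noteq> y}"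

definition Y_multiplications :: "nat \<Rightarrow> nat \<Rightarrow> (letter word \<Rightarrow> letter word) set"
  where "Y_multiplications n k =
    {endoF n k (lmult x [(y, d)]) | x y d. x \<in> X_set n \<and> y \<in> Y_set k}"

lemma letter_closed:
  assumes "a \<in> X_set n" "b \<in> XY_set n k" "a \<noteq> b"
  shows "[(b, d)] \<in> carrier (free_group (XY_set n k - {a}))"
  using assms by auto

lemma K_generators_in_K: "K_generators n k \<subseteq> K_set n k"
proof -
  have "endoF n k (lmult x [(y, True)]) \<in> K_set n k" if xy: "x \<in> X_set n" "y \<in> Y_set k" for x y
  proof (rule K_setI)
    have c: "[(y, True)] \<in> carrier (free_group (XY_set n k - {x}))"
      by (rule letter_closed) (use xy X_neq_Y in auto)
    show "endoF n k (lmult x [(y, True)]) \<in> A_set n k" by (rule lmult_in_A_set[OF xy(1) c])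
    fix i assume i: "i \<in> {1..n}"
    then have X: "X i \<in> XY_set n k" by (simp add: XY_set_def X_set_def)
    interpret Q: group_hom "F n k" "Fx n" "kill_Y n"
      by (intro group_hom.intro group_hom_axioms.intro group_free_group kill_Y_hom)
    have e: "endoF n k (lmult x [(y, True)]) (gen (X i)) = lmult x [(y, True)] (X i)"
      using endo_gen[OF X adm_lmult[OF c]] xy by simp
    have "lmult x [(y, True)] (X i) = (if X i = x then gen y \<otimes>\<^bsub>F n k\<^esub> gen (X i) else gen (X i))"
      using X_neq_Y[OF xy] by (auto simp: lmult_def mult_free_group word_eval)
    then show "kill_Y n (endoF n k (lmult x [(y, True)]) (gen (X i))) = gen (X i)"
      using xy X kill_Y_X[OF i] Q.H.l_one[of "gen (X i)"] gen_in_free_group[of "X i" "X_set n"] i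
      by (auto simp: e Y_set_def kill_Y_Y X_set_def)
  qed
  moreover have "endoF n k (conj_by z z' True) \<in> K_set n k"
    if "z \<in> XY_set n k" "z' \<in> XY_set n k" "z \<noteq> z'" "z \<in> Y_set k \<or> z' \<in> Y_set k" for z z'
  proof -
    have "C_aut n k z z' \<in> KIA_generators n k"
      using that unfolding KIA_generators_def by blast
    then show ?thesis
      using KIA_generators_in_KIA by (auto simp: C_aut_eq[OF that(1-3)] KIA_set_def)
  qed
  ultimately show ?thesis
    unfolding K_generators_def using X_neq_Y by (auto simp: eq_commute)
qed

lemma K_generators_auto: "K_generators n k \<subseteq> auto (F n k)"
  using K_generators_in_K subgroup.subset[OF subgroup_K_set] by fastforce

lemma lmult_letter_auto:
  "a \<in> X_set n \<Longrightarrow> b \<in> XY_set n k \<Longrightarrow> a \<noteq> b \<Longrightarrow> endoF n k (lmult a [(b, d)]) \<in> auto (F n k)"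
  by (rule lmult_auto) auto

lemma perm_adm: "perm_subst n k \<phi> \<Longrightarrow> adm (XY_set n k) \<phi>"
proof
  fix a assume p: "perm_subst n k \<phi>" and a: "a \<in> XY_set n k"
  from a show "\<phi> a \<in> carrier (F n k)"
  proof (cases rule: XY_cases)
    case (1 i)
    then obtain b e where "b \<in> X_set n" "\<phi> a = [(b, e)]" using p unfolding perm_subst_def by blast
    then show ?thesis by simp
  next
    case (2 i)
    then show ?thesis using p a unfolding perm_subst_def by simp
  qed
qed

lemma signed_perms_auto: "signed_perms n k \<subseteq> auto (F n k)"
proof
  fix f assume "f \<in> signed_perms n k"
  then obtain \<phi> \<phi>' where p: "f = endoF n k \<phi>" "perm_subst n k \<phi>" "perm_subst n k \<phi>'"
    "\<forall>a\<in>XY_set n k. wlift \<phi> (\<phi>' a) = gen a \<and> wlift \<phi>' (\<phi> a) = gen a"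
    unfolding signed_perms_def by blast
  show "f \<in> auto (F n k)"
    unfolding p(1) by (rule endo_auto[OF perm_adm[OF p(2)] perm_adm[OF p(3)]]) (use p(4) in blast)+
qed

lemma transvections_auto: "transvections n k \<subseteq> auto (F n k)"
  unfolding transvections_def using lmult_letter_auto by auto

lemma Y_multiplications_auto: "Y_multiplications n k \<subseteq> auto (F n k)"
  unfolding Y_multiplications_def using lmult_letter_auto X_neq_Y by fastforce

lemma inv_lmult_letter:
  assumes "a \<in> X_set n" "b \<in> XY_set n k" "a \<noteq> b"
  shows "inv\<^bsub>AF n k\<^esub> (endoF n k (lmult a [(b, d)])) = endoF n k (lmult a [(b, \<not> d)])"
  by (rule endo_inv[OF lmult_letter_auto[OF assms]])
    (use assms letter_closed in \<open>simp_all add: adm_lmult del: Pi_iff\<close>, auto simp: lmult_def word_eval)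

abbreviation X_generators where "X_generators n k \<equiv> signed_perms n k \<union> transvections n k"

lemma X_generators_inv:
  assumes "p \<in> X_generators n k"
  shows "inv\<^bsub>AF n k\<^esub> p \<in> X_generators n k"
  using assms
proof
  assume "p \<in> signed_perms n k"
  then obtain \<phi> \<phi>' where p: "p = endoF n k \<phi>" "perm_subst n k \<phi>" "perm_subst n k \<phi>'"
    "\<forall>a\<in>XY_set n k. wlift \<phi> (\<phi>' a) = gen a \<and> wlift \<phi>' (\<phi> a) = gen a"
    unfolding signed_perms_def by blast
  have pa: "endoF n k \<phi> \<in> auto (F n k)"
    using \<open>p \<in> signed_perms n k\<close> signed_perms_auto p(1) by blast
  have "inv\<^bsub>AF n k\<^esub> p = endoF n k \<phi>'"
    unfolding p(1)
    by (rule endo_inv[OF pa perm_adm[OF p(2)] perm_adm[OF p(3)]]) (use p(4) in blast)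
  moreover have "endoF n k \<phi>' \<in> signed_perms n k"
    unfolding signed_perms_def using p by blast
  ultimately show ?thesis by simp
next
  assume "p \<in> transvections n k"
  then show ?thesis unfolding transvections_def using inv_lmult_letter by fastforce
qed

lemma twist_groupI:
  assumes "subgroup H (AF n k)" "K_generators n k \<subseteq> H"
  shows "twist_group n k H"
proof (intro twist_group.intro auto_subgroup.intro twist_group_axioms.intro assms(1))
  fix x y assume xy: "x \<in> X_set n" "y \<in> Y_set k"
  have adm: "adm (XY_set n k) (lmult x [(y, True)])" "adm (XY_set n k) (conj_by x y True)"
    by (rule adm_lmult letter_closed adm_conj_by; use xy X_neq_Y[OF xy] in simp)+
  have "endoF n k (lmult x [(y, True)]) \<in> K_generators n k"
    "endoF n k (conj_by x y True) \<in> K_generators n k"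
    using xy unfolding K_generators_def by blast+
  then have "endoF n k (lmult x [(y, True)]) \<in> H" "endoF n k (conj_by x y True) \<in> H"
    using assms(2) by (simp_all only: subsetD)
  then show "endo_in (XY_set n k) H (lmult x [(y, True)])" "endo_in (XY_set n k) H (conj_by x y True)"
    unfolding endo_in_def using adm by blast+
next
  fix y z assume yz: "y \<in> Y_set k" "z \<in> XY_set n k" "z \<noteq> y"
  have "adm (XY_set n k) (conj_by y z True)" by (rule adm_conj_by) (use yz in auto)
  moreover have "endoF n k (conj_by y z True) \<in> K_generators n k"
    using yz unfolding K_generators_def by blast
  then have "endoF n k (conj_by y z True) \<in> H" by (rule subsetD[OF assms(2)])
  ultimately show "endo_in (XY_set n k) H (conj_by y z True)" unfolding endo_in_def by blast
qed

text \<open>Collects the conjugation formulas of \<open>twist_group\<close> for the group generated by \<open>K_generators\<close>.\<close>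

lemma X_generators_normalize:
  assumes p: "p \<in> X_generators n k" and q: "q \<in> K_generators n k"
  shows "conjugateF n k p q
    \<in> generate (AF n k) (K_generators n k)" (is "_ \<in> ?H")
proof -
  interpret twist_group n k ?H
    by (rule twist_groupI) (auto simp: subgroup_generate K_generators_auto generate.incl)
  have conj: "conjugateF n k p q \<in> ?H"
    if pe: "p = endoF n k \<phi>" "adm (XY_set n k) \<phi>" "adm (XY_set n k) \<phi>'"
      "\<And>a. a \<in> XY_set n k \<Longrightarrow> wlift \<phi> (\<phi>' a) = gen a"
      and lmult: "\<And>x y. x \<in> X_set n \<Longrightarrow> y \<in> Y_set k \<Longrightarrow> inH (\<lambda>c. wlift \<phi> (wlift (lmult x [(y, True)]) (\<phi>' c)))"
      and conj_by_x: "\<And>x y. x \<in> X_set n \<Longrightarrow> y \<in> Y_set k \<Longrightarrow> inH (\<lambda>c. wlift \<phi> (wlift (conj_by x y True) (\<phi>' c)))"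
      and conj_by_y: "\<And>y z. y \<in> Y_set k \<Longrightarrow> z \<in> XY_set n k \<Longrightarrow> z \<noteq> y \<Longrightarrow>
        inH (\<lambda>c. wlift \<phi> (wlift (conj_by y z True) (\<phi>' c)))"
    for \<phi> \<phi>'
  proof -
    have pa: "endoF n k \<phi> \<in> auto (F n k)"
      using p pe(1) signed_perms_auto transvections_auto by blast
    have qa: "q \<in> auto (F n k)" using q K_generators_auto by blast
    have *: "conjugateF n k p q \<in> ?H"
      if "q = endoF n k \<psi>" "inH \<psi>" "inH (\<lambda>c. wlift \<phi> (wlift \<psi> (\<phi>' c)))" for \<psi>
    proof -
      have \<psi>: "endoF n k \<psi> \<in> auto (F n k)" "adm (XY_set n k) \<psi>"
        using that(1,2) qa unfolding endo_in_def by blast+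
      have "endoF n k \<phi> \<otimes>\<^bsub>AF n k\<^esub> endoF n k \<psi> \<otimes>\<^bsub>AF n k\<^esub>
          inv\<^bsub>AF n k\<^esub> (endoF n k \<phi>) = endoF n k (\<lambda>c. wlift \<phi> (wlift \<psi> (\<phi>' c)))"
        by (rule endo_conj[OF pa pe(2,3) _ \<psi>]) (rule pe(4))
      then show ?thesis
        using that(3) unfolding pe(1) that(1) endo_in_def by (simp only:)
    qed
    from q consider x y where "x \<in> X_set n" "y \<in> Y_set k" "q = endoF n k (lmult x [(y, True)])"
      | x y where "x \<in> X_set n" "y \<in> Y_set k" "q = endoF n k (conj_by x y True)"
      | y z where "y \<in> Y_set k" "z \<in> XY_set n k" "z \<noteq> y" "q = endoF n k (conj_by y z True)"
      unfolding K_generators_def by blast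
    then show ?thesis
    proof cases
      case (1 x y)
      then show ?thesis by (intro *[OF 1(3) lmult_xy lmult])
    next
      case (2 x y)
      then show ?thesis by (intro *[OF 2(3) conj_by_xy conj_by_x])
    next
      case (3 y z)
      then show ?thesis by (intro *[OF 3(4) conj_by_yz conj_by_y])
    qed
  qed
  from p show ?thesis
  proof
    assume "p \<in> signed_perms n k"
    then obtain \<phi> \<phi>' where p: "p = endoF n k \<phi>" "perm_subst n k \<phi>" "perm_subst n k \<phi>'"
      and inv: "\<And>a. a \<in> XY_set n k \<Longrightarrow> wlift \<phi> (\<phi>' a) = gen a"
        "\<And>a. a \<in> XY_set n k \<Longrightarrow> wlift \<phi>' (\<phi> a) = gen a"
      unfolding signed_perms_def by blast
    show ?thesis
      by (rule conj[OF p(1) perm_adm[OF p(2)] perm_adm[OF p(3)] inv(1)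
            perm_conj_lmult[OF p(2,3) inv] perm_conj_conj_by_x[OF p(2,3) inv] perm_conj_conj_by_y[OF p(2,3) inv]])
  next
    assume "p \<in> transvections n k"
    then obtain a b d where p: "p = endoF n k (lmult a [(b, d)])"
      and ab: "a \<in> X_set n" "b \<in> X_set n" "a \<noteq> b"
      unfolding transvections_def by blast
    have adm: "adm (XY_set n k) (lmult a [(b, e)])" for e
      using ab by (intro adm_lmult letter_closed) auto
    have inv: "wlift (lmult a [(b, d)]) (lmult a [(b, \<not> d)] c) = gen c" for c
      using ab by (auto simp: lmult_def word_eval)
    show ?thesis
      by (rule conj[OF p adm adm inv transvection_conj_lmult[OF ab] transvection_conj_conj_by_x[OF ab]
            transvection_conj_conj_by_y[OF ab]])
  qed
qed

text \<open>Every Nielsen move lies in the group on the right. The moves \<open>x \<mapsto> x q\<close> are obtained from the left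
  multiplications by conjugating with the inversion of \<open>x\<close>.\<close>

lemma A_set_factor:
  assumes "f \<in> A_set n k"
  shows "f \<in> generate (AF n k) (X_generators n k \<union> K_generators n k)" (is "f \<in> ?H")
proof (rule A_set_generated[OF _ _ _ assms])
  have auto: "X_generators n k \<union> K_generators n k \<subseteq> auto (F n k)"
    using signed_perms_auto transvections_auto K_generators_auto by blast
  show sub: "subgroup ?H (AF n k)" by (rule subgroup_generate[OF auto])
  show perms: "signed_perms n k \<subseteq> ?H" by (blast intro: generate.incl)
  interpret twist_group n k ?H
    by (rule twist_groupI[OF sub]) (blast intro: generate.incl)
  have lmult_X: "inH (lmult a [(b, d)])" if "a \<in> X_set n" "b \<in> X_set n" "a \<noteq> b" for a b d
    unfolding endo_in_def
  proof
    show "adm (XY_set n k) (lmult a [(b, d)])" using that by (intro adm_lmult letter_closed) simp_all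
    have "endoF n k (lmult a [(b, d)]) \<in> transvections n k"
      using that unfolding transvections_def by blast
    then show "endoF n k (lmult a [(b, d)]) \<in> ?H" by (blast intro: generate.incl)
  qed
  have flip: "inH (gen(a := [(a, False)]))" if a: "a \<in> X_set n" for a
    unfolding endo_in_def
  proof
    have perm: "perm_subst n k (gen(a := [(a, False)]))"
      using X_neq_Y[OF a] unfolding perm_subst_def by (auto simp: gen_def Y_set_def)
    then show "adm (XY_set n k) (gen(a := [(a, False)]))" by (rule perm_adm)
    have inv: "wlift (gen(a := [(a, False)])) ((gen(a := [(a, False)])) c) = gen c" for c
      by (auto simp: word_eval)
    have "endoF n k (gen(a := [(a, False)])) \<in> signed_perms n k"
      unfolding signed_perms_def using perm inv by blast
    then show "endoF n k (gen(a := [(a, False)])) \<in> ?H" using perms by blast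
  qed
  fix p q assume pq: "p \<in> letters n k" "q \<in> letters n k" "fst p \<noteq> fst q"
  obtain a e b d where p: "p = (a, e)" and q: "q = (b, d)" by (cases p; cases q) blast
  have ab: "a \<in> XY_set n k" "b \<in> XY_set n k" "a \<noteq> b" using pq p q by auto
  have "inH (move p q)"
  proof (cases "a \<in> X_set n")
    case True
    then obtain i where ai: "a = X i" by (auto simp: X_set_def)
    have lmult_b: "inH (lmult a [(b, c)])" for c
      using ab(2) lmult_X[OF True _ ab(3)] multiplier_mem[OF multiplier_letter[OF True]] by (auto simp: XY_set_def)
    show ?thesis
    proof (cases e)
      case True
      have "inH (move p q)"
        by (rule endo_in_cong[OF lmult_b[of "\<not> d"]])
          (auto simp: move_def lmult_def p q ai True inv_letter_def)
      then show ?thesis .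
    next
      case False
      show ?thesis
        \<comment> \<open>\<open>a \<mapsto> a\<^sup>-\<^sup>1\<close>, then \<open>a \<mapsto> q\<^sup>-\<^sup>1 a\<close>, then \<open>a \<mapsto> a\<^sup>-\<^sup>1\<close> again, gives \<open>a \<mapsto> a q\<close>.\<close>
        by (rule endo_in_mult3[OF flip lmult_b[of "\<not> d"] flip])
          (use True ab in \<open>auto simp: move_def lmult_def p q ai False word_eval\<close>)
    qed
  next
    case False
    then have a: "a \<in> Y_set k" using ab by (simp add: XY_set_def)
    then obtain i where ai: "a = Y i" by (auto simp: Y_set_def)
    show ?thesis
      by (rule endo_in_cong[OF conj_by_yz[OF a ab(2), of "\<not> d"]])
        (use ab in \<open>auto simp: move_def conj_by_def p q ai inv_letter_def\<close>)
  qed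
  then show "endoF n k (move p q) \<in> ?H" unfolding endo_in_def by blast
qed

lemma X_generator_preserves_Fx:
  assumes "h \<in> X_generators n k"
  shows "h \<in> auto (F n k) \<and> (\<forall>i\<in>{1..k}. h (gen (Y i)) = gen (Y i)) \<and>
    (\<forall>a\<in>X_set n. h (gen a) \<in> carrier (Fx n))"
  using assms
proof
  assume "h \<in> signed_perms n k"
  then obtain \<phi> where h: "h = endoF n k \<phi>" "perm_subst n k \<phi>" "h \<in> auto (F n k)"
    using signed_perms_auto unfolding signed_perms_def by blast
  note v = endo_gen[OF _ perm_adm[OF h(2)], folded h(1)]
  show ?thesis
  proof (intro conjI ballI h(3))
    fix i assume i: "i \<in> {1..k}"
    then show "h (gen (Y i)) = gen (Y i)"
      using v[of "Y i"] h(2) by (simp add: perm_subst_def XY_set_def Y_set_def)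
  next
    fix a assume a: "a \<in> X_set n"
    then obtain b d where b: "b \<in> X_set n" "\<phi> a = [(b, d)]"
      using h(2) unfolding perm_subst_def by blast
    show "h (gen a) \<in> carrier (Fx n)"
      using v[of a] a b by simp
  qed
next
  assume "h \<in> transvections n k"
  then obtain a b d where h: "h = endoF n k (lmult a [(b, d)])" "h \<in> auto (F n k)"
    and ab: "a \<in> X_set n" "b \<in> X_set n" "a \<noteq> b"
    using transvections_auto unfolding transvections_def by blast
  have adm: "adm (XY_set n k) (lmult a [(b, d)])" using ab by (intro adm_lmult letter_closed) simp_all
  note v = endo_gen[OF _ adm, folded h(1)]
  show ?thesis
  proof (intro conjI ballI h(2))
    fix i assume i: "i \<in> {1..k}"
    then have "Y i \<in> Y_set k" by (simp add: Y_set_def)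
    then show "h (gen (Y i)) = gen (Y i)"
      using v[of "Y i"] X_neq_Y[OF ab(1), of "Y i"] by (auto simp: lmult_def)
  next
    fix c assume c: "c \<in> X_set n"
    show "h (gen c) \<in> carrier (Fx n)"
      using v[of c] c ab by (auto simp: lmult_def word_mem)
  qed
qed

lemma X_generators_preserve_Fx:
  assumes "e \<in> generate (AF n k) (X_generators n k)"
  shows "e \<in> auto (F n k) \<and> (\<forall>i\<in>{1..k}. e (gen (Y i)) = gen (Y i)) \<and>
    (\<forall>a\<in>X_set n. e (gen a) \<in> carrier (Fx n))"
  using assms
proof induction
  case one
  show ?case
    unfolding one_AutoGroup
    by (intro conjI ballI group.id_in_auto[OF group_free_group]) (simp_all add: gen_Y_in_F)
next
  case (incl h)
  then show ?case by (rule X_generator_preserves_Fx)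
next
  case (inv h)
  from X_generators_inv[OF inv] show ?case by (rule X_generator_preserves_Fx)
next
  case (eng e1 e2)
  then have a: "e1 \<in> auto (F n k)" "e2 \<in> auto (F n k)" by blast+
  have v: "(e1 \<otimes>\<^bsub>AF n k\<^esub> e2) w = e1 (e2 w)" if "w \<in> carrier (F n k)" for w
    using that by (simp add: AutoGroup_mult[OF a] compose_eq)
  have "e1 w \<in> carrier (Fx n)" if w: "w \<in> carrier (Fx n)" for w
  proof -
    have wF: "w \<in> carrier (F n k)" using w carrier_Fx_subset by blast
    have "e1 w = wlift (\<lambda>a. e1 (gen a)) w"
      using fun_cong[OF auto_eq_endo(2)[OF a(1)], of w] endo_apply[OF auto_eq_endo(1)[OF a(1)] wF] by simp
    also have "\<dots> \<in> carrier (Fx n)"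
      by (rule wlift_closed[OF _ w]) (use eng.IH(1) in blast)
    finally show ?thesis .
  qed
  moreover have "e1 \<otimes>\<^bsub>AF n k\<^esub> e2 \<in> auto (F n k)"
    unfolding AutoGroup_mult[OF a] by (rule compose_auto[OF group_free_group a])
  ultimately show ?case using eng.IH v gen_Y_in_F by (simp add: Ball_def)
qed

text \<open>Write an element of \<open>K\<close> as \<open>e s\<close>. As \<open>s\<close> lies in \<open>K\<close>, so does \<open>e\<close>; but \<open>e\<close> maps \<open>Fx n\<close> to itself, where
  \<open>kill_Y\<close> is the identity, so \<open>e\<close> fixes every letter.\<close>

lemma K_set_generated: "K_set n k \<subseteq> generate (AF n k) (K_generators n k)"
proof
  fix f assume f: "f \<in> K_set n k"
  interpret A: group "AF n k" by (rule group_AG)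
  have "f \<in> generate (AF n k) (X_generators n k \<union> K_generators n k)"
    using f by (intro A_set_factor) (simp add: K_set_iff)
  moreover have "X_generators n k \<subseteq> carrier (AF n k)" "K_generators n k \<subseteq> carrier (AF n k)"
    using signed_perms_auto transvections_auto K_generators_auto by simp_all
  ultimately obtain e s where e: "e \<in> generate (AF n k) (X_generators n k)"
    and s: "s \<in> generate (AF n k) (K_generators n k)" and fes: "f = e \<otimes>\<^bsub>AF n k\<^esub> s"
      and es: "f \<otimes>\<^bsub>AF n k\<^esub> inv\<^bsub>AF n k\<^esub> s = e"
    using generate_Un_decomp[OF group_AG _ _ X_generators_inv X_generators_normalize] by blast
  note pe = X_generators_preserve_Fx[OF e]
  have sK: "s \<in> K_set n k"
    using s group.generate_subgroup_incl[OF group_AG K_generators_in_K subgroup_K_set] by blast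
  have eK: "e \<in> K_set n k"
    using subgroup.m_closed[OF subgroup_K_set f subgroup.m_inv_closed[OF subgroup_K_set sK]] es by simp
  have "e (gen a) = gen a" if a: "a \<in> XY_set n k" for a
    using a
  proof (cases rule: XY_cases)
    case (1 i)
    have "kill_Y n (e (gen a)) = kill_Y n (gen a)" using eK a unfolding K_set_iff by simp
    moreover have "kill_Y n (e (gen a)) = e (gen a)" using pe 1 by (intro kill_Y_id) blast
    moreover have "kill_Y n (gen a) = gen a" using 1 by (intro kill_Y_id) simp
    ultimately show ?thesis by simp
  next
    case (2 i)
    then show ?thesis using pe by blast
  qed
  then have "endoF n k (\<lambda>a. e (gen a)) = endoF n k gen" by (rule endo_cong)
  then have "e = \<one>\<^bsub>AF n k\<^esub>"
    using auto_eq_endo(2)[of e "XY_set n k"] pe by (simp add: one_AutoGroup endo_id)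
  then show "f \<in> generate (AF n k) (K_generators n k)"
    using fes s A.l_one subgroup.mem_carrier[OF subgroup_K_set sK] by simp
qed

section \<open>The part acting trivially on the abelianization\<close>

lemma commutator_iff_coset:
  assumes N: "N \<lhd> G" and c: "a \<in> carrier G" "b \<in> carrier G"
  shows "commutator G a b \<in> N \<longleftrightarrow> N #>\<^bsub>G\<^esub> (a \<otimes>\<^bsub>G\<^esub> b \<otimes>\<^bsub>G\<^esub> inv\<^bsub>G\<^esub> a) = N #>\<^bsub>G\<^esub> b"
proof -
  interpret N: normal N G by (rule N)
  have "a \<otimes>\<^bsub>G\<^esub> b \<otimes>\<^bsub>G\<^esub> inv\<^bsub>G\<^esub> a = commutator G a b \<otimes>\<^bsub>G\<^esub> b"
    using c by (simp add: commutator_def N.m_assoc)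
  then show ?thesis
    using coset_mult_iff[OF N commutator_closed[OF N.is_group c] c(2)] by simp
qed

text \<open>Modulo \<open>N\<close>, conjugation by a fixed \<open>v\<close> is a homomorphism. If \<open>v\<close> commutes with the generators, this
  homomorphism agrees with the quotient map on generators, hence everywhere. This is used first for
  generators \<open>v\<close> and then for arbitrary \<open>v\<close>.\<close>

lemma free_group_commutators_in_normal:
  assumes N: "N \<lhd> free_group S"
    and gens: "\<And>a b. a \<in> S \<Longrightarrow> b \<in> S \<Longrightarrow> commutator (free_group S) (gen a) (gen b) \<in> N"
    and uw: "u \<in> carrier (free_group S)" "w \<in> carrier (free_group S)"
  shows "commutator (free_group S) u w \<in> N"
proof -
  let ?G = "free_group S"
  interpret N: normal N "?G" by (rule N)
  let ?C = "carrier (?G)" and ?q = "\<lambda>w. N #>\<^bsub>?G\<^esub> w"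
  note cc = commutator_iff_coset[OF N]
  have sym: "commutator (?G) b a \<in> N" if "commutator (?G) a b \<in> N" "a \<in> ?C" "b \<in> ?C" for a b
  proof -
    have "commutator (?G) b a = inv\<^bsub>?G\<^esub> (commutator (?G) a b)"
      using that by (simp add: commutator_def N.inv_mult_group N.m_assoc)
    then show ?thesis using N.m_inv_closed[OF that(1)] by simp
  qed
  have ext: "commutator (?G) v w \<in> N"
    if v: "v \<in> ?C" and w: "w \<in> ?C" and h: "\<And>a. a \<in> S \<Longrightarrow> commutator (?G) v (gen a) \<in> N" for v w
  proof -
    let ?k = "\<lambda>w. v \<otimes>\<^bsub>?G\<^esub> w \<otimes>\<^bsub>?G\<^esub> inv\<^bsub>?G\<^esub> v"
    have k: "?k \<in> hom (?G) (?G)"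
    proof (rule homI)
      fix x y assume xy: "x \<in> ?C" "y \<in> ?C"
      have "inv\<^bsub>?G\<^esub> v \<otimes>\<^bsub>?G\<^esub> (v \<otimes>\<^bsub>?G\<^esub> (y \<otimes>\<^bsub>?G\<^esub> inv\<^bsub>?G\<^esub> v)) =
          y \<otimes>\<^bsub>?G\<^esub> inv\<^bsub>?G\<^esub> v"
        using v xy by (simp add: N.m_assoc[symmetric])
      then show "?k (x \<otimes>\<^bsub>?G\<^esub> y) = ?k x \<otimes>\<^bsub>?G\<^esub> ?k y"
        using v xy by (simp add: N.m_assoc)
    qed (use v in simp)
    have "(?q \<circ> ?k) w = ?q w"
      by (rule hom_eq_on_gens[OF Group.hom_compose[OF k N.r_coset_hom_Mod] N.r_coset_hom_Mod
            N.factorgroup_is_group _ w])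
        (use h cc[OF v] in simp)
    then show ?thesis using cc[OF v w] by simp
  qed
  have "commutator (?G) (gen a) u \<in> N" if a: "a \<in> S" for a
    by (rule ext[OF gen_closed[OF a] uw(1) gens[OF a]])
  then have "commutator (?G) u (gen a) \<in> N" if "a \<in> S" for a
    using sym[of "gen a" u] that uw(1) by simp
  then show ?thesis by (rule ext[OF uw])
qed

context commutator_group
begin

abbreviation "FY \<equiv> free_group (Y_set k)"

lemma multiplier_conj_FY:
  assumes x: "x \<in> X_set n" and v: "multiplier x v" "v \<in> carrier FY" and u: "u \<in> carrier FY"
  shows "multiplier x (u \<otimes>\<^bsub>FY\<^esub> v \<otimes>\<^bsub>FY\<^esub> inv\<^bsub>FY\<^esub> u)"
  using u
proof (induction u)
  case Nil
  interpret group FY by (rule group_free_group)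
  show ?case using v r_one[OF v(2)] inv_one l_one[OF v(2)] by (simp add: one_free_group)
next
  case (Cons p u)
  interpret G: group FY by (rule group_free_group)
  have pu: "[p] \<in> carrier FY" "u \<in> carrier FY" "fst p \<in> Y_set k"
    using Cons.prems reduced_tl[of p u] by (auto simp: carrier_free_group word_closed_Cons)
  have "[p] \<otimes>\<^bsub>FY\<^esub> u = p # u"
    using Cons.prems by (simp add: mult_free_group push_reduced carrier_free_group)
  then have "(p # u) \<otimes>\<^bsub>FY\<^esub> v \<otimes>\<^bsub>FY\<^esub> inv\<^bsub>FY\<^esub> (p # u) =
      [p] \<otimes>\<^bsub>FY\<^esub> (u \<otimes>\<^bsub>FY\<^esub> v \<otimes>\<^bsub>FY\<^esub> inv\<^bsub>FY\<^esub> u) \<otimes>\<^bsub>FY\<^esub> inv\<^bsub>FY\<^esub> [p]"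
    using pu v by (simp add: G.m_assoc G.inv_mult_group flip: \<open>[p] \<otimes>\<^bsub>FY\<^esub> u = p # u\<close>)
  also have "\<dots> = [p] \<otimes>\<^bsub>FY\<^esub> ((u \<otimes>\<^bsub>FY\<^esub> v \<otimes>\<^bsub>FY\<^esub> inv\<^bsub>FY\<^esub> u) \<otimes>\<^bsub>FY\<^esub> [(fst p, \<not> snd p)])"
  proof -
    have "inv\<^bsub>FY\<^esub> [p] = [(fst p, \<not> snd p)]"
      using inv_free_group[OF pu(1)] by (simp add: winv_Cons inv_letter_def)
    then show ?thesis using G.m_assoc[OF pu(1) _ G.inv_closed[OF pu(1)]] pu v by simp
  qed
  also have "\<dots> = push (fst p, snd p) (foldr push (u \<otimes>\<^bsub>FY\<^esub> v \<otimes>\<^bsub>FY\<^esub> inv\<^bsub>FY\<^esub> u) [(fst p, \<not> snd p)])"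
    by (simp add: mult_free_group)
  finally show ?case using multiplier_conj_Y[OF Cons.IH[OF pu(2)] x pu(3), of "snd p"] by simp
qed

lemma multiplier_normal:
  assumes x: "x \<in> X_set n"
  shows "{v \<in> carrier FY. multiplier x v} \<lhd> FY"
proof -
  interpret G: group FY by (rule group_free_group)
  show ?thesis
  proof (rule G.normal_invI)
    show "subgroup {v \<in> carrier FY. multiplier x v} FY"
    proof (rule G.subgroupI)
      have "[] \<in> {v \<in> carrier FY. multiplier x v}" using multiplier_Nil x by (simp add: carrier_free_group)
      then show "{v \<in> carrier FY. multiplier x v} \<noteq> {}" by blast
    qed (auto simp: multiplier_mult multiplier_winv mult_free_group inv_free_group mul_closed winv_closed)
    show "u \<otimes>\<^bsub>FY\<^esub> v \<otimes>\<^bsub>FY\<^esub> inv\<^bsub>FY\<^esub> u \<in> {v \<in> carrier FY. multiplier x v}"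
      if "u \<in> carrier FY" "v \<in> {v \<in> carrier FY. multiplier x v}" for u v
      using that multiplier_conj_FY[OF x] by simp
  qed
qed

lemma multiplier_commutator:
  assumes x: "x \<in> X_set n" and "u \<in> carrier FY" "w \<in> carrier FY"
  shows "multiplier x (commutator FY u w)"
proof -
  have "commutator FY (gen y) (gen z) \<in> {v \<in> carrier FY. multiplier x v}" if yz: "y \<in> Y_set k" "z \<in> Y_set k" for y z
  proof -
    have e: "commutator FY (gen y) (gen z) = (if y = z then [] else [(y, True), (z, True), (y, False), (z, False)])"
      using yz unfolding commutator_def mult_free_group by (simp add: inv_gen) (simp add: word_eval)
    have "multiplier x (commutator FY (gen y) (gen z))"
      unfolding e using multiplier_Nil[of x] multiplier_comm_yz(1)[OF x yz(1), of z True] x yz X_neq_Y[OF x yz(2)] by auto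
    moreover have "commutator FY (gen y) (gen z) \<in> carrier FY"
      by (rule commutator_closed[OF group_free_group]) (use yz in simp_all)
    ultimately show ?thesis by simp
  qed
  then show ?thesis
    using free_group_commutators_in_normal[OF multiplier_normal[OF x] _ assms(2,3)] by blast
qed

text \<open>The retraction \<open>r\<close> of \<open>F n k\<close> onto the free group on the \<open>y\<close> that kills the \<open>x\<close> maps commutators to
  commutators and fixes \<open>v\<close>. So a word in the \<open>y\<close> that is a product of commutators in \<open>F n k\<close> is
  already one in the free group on the \<open>y\<close>, where \<open>multiplier_commutator\<close> applies.\<close>

lemma multiplier_derived:
  assumes x: "x \<in> X_set n" and v: "v \<in> carrier FY" "v \<in> FN n k"
  shows "multiplier x v"
proof -
  interpret FY: group FY by (rule group_free_group)
  define \<rho> where "\<rho> a = (if a \<in> Y_set k then gen a else [])" for a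
  define r where "r = free_lift FY \<rho>"
  have r: "r \<in> hom (F n k) FY"
    unfolding r_def by (rule FY.free_lift_hom) (auto simp: \<rho>_def carrier_free_group gen_def word_closed_Cons)
  interpret r: group_hom "F n k" FY r
    by (intro group_hom.intro group_free_group group_hom_axioms.intro r)
  have adm: "adm (Y_set k) \<rho>" by (auto simp: \<rho>_def)
  have "r v = wlift \<rho> v"
    unfolding r_def using v(1) by (intro free_lift_eq_wlift[OF adm]) (simp add: carrier_free_group)
  also have "\<dots> = v" by (rule wlift_fixing[OF _ v(1)]) (simp add: \<rho>_def)
  finally have rv: "r v = v" .
  have "multiplier x (r w)" if "w \<in> FN n k" for w
    using that unfolding ab_kernel_def derived_def
  proof induction
    case one
    then show ?case using multiplier_Nil x r.hom_one by (simp add: one_free_group)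
  next
    case (incl h)
    then obtain a b where ab: "a \<in> carrier (F n k)" "b \<in> carrier (F n k)"
      "h = commutator (F n k) a b" by (auto simp: commutator_def)
    then have "r h = commutator FY (r a) (r b)" by (simp add: commutator_def)
    then show ?case using multiplier_commutator[OF x] ab by simp
  next
    case (inv h)
    then obtain a b where ab: "a \<in> carrier (F n k)" "b \<in> carrier (F n k)"
      "h = commutator (F n k) a b" by (auto simp: commutator_def)
    then have rh: "r h = commutator FY (r a) (r b)" "h \<in> carrier (F n k)"
      by (simp_all add: commutator_def)
    then have "r (inv\<^bsub>F n k\<^esub> h) = winv (r h)"
      using r.hom_inv[OF rh(2)] inv_free_group[OF r.hom_closed[OF rh(2)]] by simp
    then show ?case using multiplier_winv multiplier_commutator[OF x] ab rh by simp
  next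
    case (eng h1 h2)
    have sub: "generate (F n k) (derived_set (F n k) (carrier (F n k))) \<subseteq> carrier (F n k)"
      using group.derived_in_carrier[OF group_free_group, of "carrier (F n k)" "XY_set n k"]
      by (simp add: derived_def)
    have "r (h1 \<otimes>\<^bsub>F n k\<^esub> h2) = foldr push (r h1) (r h2)"
      using r.hom_mult[of h1 h2] eng.hyps sub by (auto simp: mult_free_group)
    then show ?case using multiplier_mult eng.IH by simp
  qed
  then show ?thesis using rv v(2) by metis
qed

text \<open>The single multiplications can be composed one after the other, since the words \<open>v x\<close> do not involve
  the letters that are being multiplied.\<close>

lemma multiplication_product:
  assumes "finite A" "A \<subseteq> X_set n" "\<And>x. x \<in> A \<Longrightarrow> multiplier x (v x)" "\<And>x. x \<in> A \<Longrightarrow> v x \<in> carrier FY"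
  shows "inH (\<lambda>a. if a \<in> A then v a @ [(a, True)] else gen a)"
  using assms
proof (induction A rule: finite_induct)
  case empty
  have "endoF n k gen = \<one>\<^bsub>AF n k\<^esub>" by (simp add: one_AutoGroup endo_id)
  then show ?case using subgroup.one_closed[OF H] by (simp add: endo_in_def)
next
  case (insert x A)
  have IH: "inH (\<lambda>a. if a \<in> A then v a @ [(a, True)] else gen a)" using insert by simp
  have x: "x \<in> X_set n" "multiplier x (v x)" "v x \<in> carrier FY" using insert.prems by auto
  show ?case
  proof (rule endo_in_mult[OF multiplier_mem[OF x(2)] IH])
    fix a assume a: "a \<in> XY_set n k"
    consider "a = x" | "a \<in> A" "a \<noteq> x" | "a \<notin> A" "a \<noteq> x" by blast
    then show "(if a \<in> insert x A then v a @ [(a, True)] else gen a) =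
        wlift (lmult x (v x)) (if a \<in> A then v a @ [(a, True)] else gen a)"
    proof cases
      case 1
      then show ?thesis
        using insert.hyps wlift_lmult_same[OF Y_words_avoid[OF x(1,3)]] x(1) by (simp add: gen_def)
    next
      case 2
      have va: "v a \<in> carrier FY" "a \<in> X_set n" using 2 insert.prems by auto
      have "v a @ [(a, True)] \<in> carrier (free_group (XY_set n k - {x}))"
        using append_in_free_group(1)[OF Y_words_avoid[OF va(2,1)]] Y_words_avoid[OF x(1) va(1)] 2 a
        by (auto simp: carrier_free_group)
      then show ?thesis using 2 wlift_lmult_avoiding by fastforce
    next
      case 3
      then show ?thesis by (simp add: word_eval)
    qed
  qed
qed

end

lemma Y_multiplications_inv:
  assumes "p \<in> Y_multiplications n k"
  shows "inv\<^bsub>AF n k\<^esub> p \<in> Y_multiplications n k"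
proof -
  obtain x y d where p: "x \<in> X_set n" "y \<in> Y_set k" "p = endoF n k (lmult x [(y, d)])"
    using assms unfolding Y_multiplications_def by blast
  then have "inv\<^bsub>AF n k\<^esub> p = endoF n k (lmult x [(y, \<not> d)])"
    using inv_lmult_letter[of x n y k d] X_neq_Y by simp
  then show ?thesis using p unfolding Y_multiplications_def by blast
qed

lemma Y_multiplication_form:
  assumes "m \<in> generate (AF n k) (Y_multiplications n k)"
  shows "m \<in> auto (F n k) \<and> (\<forall>y\<in>Y_set k. m (gen y) = gen y) \<and>
    (\<forall>a\<in>X_set n. \<exists>v\<in>carrier (free_group (Y_set k)). m (gen a) = v @ [(a, True)])"
proof -
  have base: "m \<in> auto (F n k) \<and> (\<forall>y\<in>Y_set k. m (gen y) = gen y) \<and>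
    (\<forall>a\<in>X_set n. \<exists>v\<in>carrier (free_group (Y_set k)). m (gen a) = v @ [(a, True)])"
    if m: "m \<in> Y_multiplications n k" for m
  proof -
    obtain x y d where p: "x \<in> X_set n" "y \<in> Y_set k" "m = endoF n k (lmult x [(y, d)])"
      using m unfolding Y_multiplications_def by blast
    have adm: "adm (XY_set n k) (lmult x [(y, d)])"
      using p X_neq_Y[OF p(1,2)] by (intro adm_lmult letter_closed) simp_all
    note v = endo_gen[OF _ adm, folded p(3)]
    show ?thesis
    proof (intro conjI ballI)
      show "m \<in> auto (F n k)" using m Y_multiplications_auto by blast
      show "m (gen y) = gen y" if "y \<in> Y_set k" for y
        using v[of y] that X_neq_Y[OF p(1) that] by simp
      fix a assume a: "a \<in> X_set n"
      show "\<exists>v\<in>carrier (free_group (Y_set k)). m (gen a) = v @ [(a, True)]"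
        using v[of a] a p(2)
        by (cases "a = x")
          (auto simp: lmult_same gen_def carrier_free_group word_closed_Cons intro: bexI[of _ "[(y, d)]"] bexI[of _ "[]"])
    qed
  qed
  show ?thesis
    using assms
  proof induction
    case one
    show ?case
      unfolding one_AutoGroup
      by (intro conjI ballI group.id_in_auto[OF group_free_group])
        (auto intro!: bexI[of _ "[]"] simp: gen_def carrier_free_group word_closed_Cons)
  next
    case (incl h)
    then show ?case by (rule base)
  next
    case (inv h)
    then show ?case by (intro base Y_multiplications_inv)
  next
    case (eng m1 m2)
    then have a: "m1 \<in> auto (F n k)" "m2 \<in> auto (F n k)" by blast+
    have v: "(m1 \<otimes>\<^bsub>AF n k\<^esub> m2) w = m1 (m2 w)" if "w \<in> carrier (F n k)" for w
      using that by (simp add: AutoGroup_mult[OF a] compose_eq)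
    have m1: "m1 w = wlift (\<lambda>a. m1 (gen a)) w" if "w \<in> carrier (F n k)" for w
      using fun_cong[OF auto_eq_endo(2)[OF a(1)], of w] endo_apply[OF auto_eq_endo(1)[OF a(1)] that] by simp
    have "\<exists>v\<in>carrier (free_group (Y_set k)). (m1 \<otimes>\<^bsub>AF n k\<^esub> m2) (gen x) = v @ [(x, True)]"
      if x: "x \<in> X_set n" for x
    proof -
      obtain v1 v2 where 1: "v1 \<in> carrier (free_group (Y_set k))" "m1 (gen x) = v1 @ [(x, True)]"
        and 2: "v2 \<in> carrier (free_group (Y_set k))" "m2 (gen x) = v2 @ [(x, True)]"
        using eng.IH x by blast
      note sub = Y_words_avoid[OF x]
      have cl: "v2 @ [(x, True)] \<in> carrier (F n k)" "v1 @ [(x, True)] \<in> carrier (F n k)"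
        by (rule append_in_free_group(1)[OF sub]; use 1 2 x in simp)+
      have "(m1 \<otimes>\<^bsub>AF n k\<^esub> m2) (gen x) = wlift (\<lambda>a. m1 (gen a)) (v2 @ [(x, True)])"
        using v[of "gen x"] x m1[OF cl(1)] 2 by simp
      also have "\<dots> = foldr push (wlift (\<lambda>a. m1 (gen a)) v2) (wlift (\<lambda>a. m1 (gen a)) (gen x))"
        by (simp add: wlift_append gen_def)
      also have "wlift (\<lambda>a. m1 (gen a)) v2 = v2"
        by (rule wlift_fixing[OF _ 2(1)]) (use eng.IH in blast)
      also have "wlift (\<lambda>a. m1 (gen a)) (gen x) = v1 @ [(x, True)]"
        using m1[of "gen x"] x 1 by simp
      also have "foldr push v2 (v1 @ [(x, True)]) = foldr push v2 v1 @ [(x, True)]"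
        by (rule mul_append_assoc[OF _ sub[OF 1(1)] sub[OF 2(1)]]) (use 2 x in \<open>simp_all add: carrier_free_group\<close>)
      finally show ?thesis using mul_closed[OF 2(1) 1(1)] by blast
    qed
    moreover have "m1 \<otimes>\<^bsub>AF n k\<^esub> m2 \<in> auto (F n k)"
      unfolding AutoGroup_mult[OF a] by (rule compose_auto[OF group_free_group a])
    moreover have "(m1 \<otimes>\<^bsub>AF n k\<^esub> m2) (gen y) = gen y" if "y \<in> Y_set k" for y
      using v[of "gen y"] that eng.IH by simp
    ultimately show ?case by blast
  qed
qed

lemma KIA_generators_auto: "KIA_generators n k \<subseteq> auto (F n k)"
  using KIA_generators_in_KIA subgroup.subset[OF subgroup_KIA_set] by fastforce

lemma commutator_group_generated:
  "commutator_group n k (generate (AF n k) (KIA_generators n k))" (is "commutator_group n k ?H")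
proof (intro commutator_group.intro auto_subgroup.intro commutator_group_axioms.intro)
  show "subgroup ?H (AF n k)" by (rule subgroup_generate[OF KIA_generators_auto])
next
  fix x y z assume xyz: "x \<in> X_set n" "y \<in> Y_set k" "z \<in> XY_set n k" "z \<noteq> x" "z \<noteq> y"
  have "M_aut n k x (commutator (F n k) (gen y) (gen z)) \<in> KIA_generators n k"
    using xyz unfolding KIA_generators_def by blast
  moreover have "adm (XY_set n k) (lmult x [(y, True), (z, True), (y, False), (z, False)])"
    using xyz X_neq_Y[OF xyz(1,2)] by (intro adm_lmult) (auto simp: word_mem)
  ultimately show "endo_in (XY_set n k) ?H (lmult x [(y, True), (z, True), (y, False), (z, False)])"
    unfolding endo_in_def M_aut_eq[OF xyz] by (blast intro: generate.incl)
next
  fix y z assume yz: "y \<in> Y_set k" "z \<in> XY_set n k" "z \<noteq> y"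
  then have y: "y \<in> XY_set n k" "y \<noteq> z" by auto
  have "C_aut n k y z \<in> KIA_generators n k" "C_aut n k z y \<in> KIA_generators n k"
    using yz unfolding KIA_generators_def by blast+
  then show "endo_in (XY_set n k) ?H (conj_by y z True)" "endo_in (XY_set n k) ?H (conj_by z y True)"
    unfolding endo_in_def C_aut_eq[OF y(1) yz(2) y(2)] C_aut_eq[OF yz(2) y(1) yz(3)]
    using adm_conj_by[OF yz(2) y(1) y(2)] adm_conj_by[OF y(1) yz(2) yz(3)] by (blast intro: generate.incl)+
qed

text \<open>Collects the conjugation formulas of \<open>commutator_group\<close>. A conjugation of one \<open>y\<close> by another occurs
  in both families of conjugations and is treated as a conjugation of a \<open>y\<close>.\<close>

lemma Y_multiplications_normalize:
  assumes p: "p \<in> Y_multiplications n k" and q: "q \<in> KIA_generators n k"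
  shows "conjugateF n k p q
    \<in> generate (AF n k) (KIA_generators n k)" (is "_ \<in> ?H")
proof -
  interpret commutator_group n k ?H by (rule commutator_group_generated)
  obtain x y e where xy: "x \<in> X_set n" "y \<in> Y_set k" and pe: "p = endoF n k (lmult x [(y, e)])"
    using p unfolding Y_multiplications_def by blast
  have ne: "x \<noteq> y" by (rule X_neq_Y[OF xy])
  have pa: "endoF n k (lmult x [(y, e)]) \<in> auto (F n k)"
    using p pe Y_multiplications_auto by blast
  have adm: "adm (XY_set n k) (lmult x [(y, d)])" for d
    using xy ne by (intro adm_lmult letter_closed) simp_all
  have inv: "wlift (lmult x [(y, e)]) (lmult x [(y, \<not> e)] c) = gen c" for c
    using ne by (cases "c = x") (auto simp: lmult_def word_eval)
  have *: "conjugateF n k p q \<in> ?H"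
    if "q = endoF n k \<psi>" "inH \<psi>"
      "inH (\<lambda>c. wlift (lmult x [(y, e)]) (wlift \<psi> (lmult x [(y, \<not> e)] c)))" for \<psi>
  proof -
    have \<psi>: "endoF n k \<psi> \<in> auto (F n k)" "adm (XY_set n k) \<psi>"
      using that(1,2) q KIA_generators_auto unfolding endo_in_def by blast+
    show ?thesis
      using that(3) unfolding pe that(1) endo_conj[OF pa adm adm inv \<psi>] endo_in_def by (rule conjunct2)
  qed
  from q consider x' y' z where "x' \<in> X_set n" "y' \<in> Y_set k" "z \<in> XY_set n k" "z \<noteq> x'" "z \<noteq> y'"
      "q = M_aut n k x' (commutator (F n k) (gen y') (gen z))"
    | y' z where "y' \<in> Y_set k" "z \<in> XY_set n k" "z \<noteq> y'" "q = C_aut n k y' z"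
    | y' z where "y' \<in> Y_set k" "z \<in> XY_set n k" "z \<noteq> y'" "q = C_aut n k z y'"
    unfolding KIA_generators_def by blast
  then show ?thesis
  proof cases
    case (1 x' y' z)
    show ?thesis
      by (rule *[OF 1(6)[unfolded M_aut_eq[OF 1(1-5)]] lmult_comm[OF 1(1-5)] lmult_conj_lmult[OF xy 1(1-5)]])
  next
    case (2 y' z)
    then have y': "y' \<in> XY_set n k" "y' \<noteq> z" by auto
    show ?thesis
      by (rule *[OF 2(4)[unfolded C_aut_eq[OF y'(1) 2(2) y'(2)]] conj_by_yz'[OF 2(1-3)] lmult_conj_conj_by_y[OF xy 2(1-3)]])
  next
    case (3 y' z)
    then have y': "y' \<in> XY_set n k" "y' \<noteq> z" by auto
    note qe = 3(4)[unfolded C_aut_eq[OF 3(2) y'(1) 3(3)]]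
    show ?thesis
    proof (cases "z \<in> X_set n")
      case True
      show ?thesis
        by (rule *[OF qe conj_by_zy'[OF 3(1-3)] lmult_conj_conj_by_x[OF xy True 3(1)]])
    next
      case False
      then have z: "z \<in> Y_set k" using 3(2) by (simp add: XY_set_def)
      show ?thesis
        by (rule *[OF qe conj_by_zy'[OF 3(1-3)] lmult_conj_conj_by_y[OF xy z y'(1) y'(2)]])
    qed
  qed
qed

text \<open>Trivial action on the abelianization puts each multiplying word into the commutator subgroup of
  \<open>F n k\<close>, so \<open>multiplier_derived\<close> applies to it.\<close>

lemma Y_multiplications_IA:
  assumes m: "m \<in> generate (AF n k) (Y_multiplications n k)" and IA: "m \<in> IA_set n k"
  shows "m \<in> generate (AF n k) (KIA_generators n k)" (is "_ \<in> ?H")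
proof -
  interpret commutator_group n k ?H by (rule commutator_group_generated)
  note form = Y_multiplication_form[OF m]
  then obtain v where v: "\<And>a. a \<in> X_set n \<Longrightarrow> v a \<in> carrier FY"
      "\<And>a. a \<in> X_set n \<Longrightarrow> m (gen a) = v a @ [(a, True)]"
    by metis
  have "v a \<in> FN n k" if a: "a \<in> X_set n" for a
  proof -
    have va: "v a \<in> carrier (F n k)" "v a @ [(a, True)] \<in> carrier (F n k)"
      using Y_words_avoid[OF a v(1)[OF a]] append_in_free_group(1)[OF Y_words_avoid[OF a v(1)[OF a]]] a
      by (auto simp: carrier_free_group)
    have e: "m (gen a) = v a \<otimes>\<^bsub>F n k\<^esub> gen a"
      using mul_reduced_append[of "v a" "[(a, True)]"] va v(2)[OF a]
      by (simp add: mult_free_group gen_def carrier_free_group)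
    have "FN n k #>\<^bsub>F n k\<^esub> m (gen a) = FN n k #>\<^bsub>F n k\<^esub> gen a"
      using IA a unfolding IA_set_iff by simp
    then show ?thesis
      unfolding e using coset_mult_iff[OF FN_normal va(1), of "gen a"] a by simp
  qed
  then have "inH (\<lambda>a. if a \<in> X_set n then v a @ [(a, True)] else gen a)"
    by (intro multiplication_product) (use v multiplier_derived in \<open>auto simp: X_set_def\<close>)
  then have "endoF n k (\<lambda>a. if a \<in> X_set n then v a @ [(a, True)] else gen a) \<in> ?H"
    by (simp add: endo_in_def)
  moreover have "endoF n k (\<lambda>a. if a \<in> X_set n then v a @ [(a, True)] else gen a) =
      endoF n k (\<lambda>a. m (gen a))"
    by (rule endo_cong) (use v(2) form in \<open>auto simp: XY_set_def\<close>)
  moreover have "endoF n k (\<lambda>a. m (gen a)) = m"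
    using auto_eq_endo(2) form by metis
  ultimately show ?thesis by simp
qed

lemma K_generators_split: "K_generators n k \<subseteq> Y_multiplications n k \<union> KIA_generators n k"
proof
  fix q assume "q \<in> K_generators n k"
  then consider x y where "x \<in> X_set n" "y \<in> Y_set k" "q = endoF n k (lmult x [(y, True)])"
    | x y where "x \<in> X_set n" "y \<in> Y_set k" "q = endoF n k (conj_by x y True)"
    | y z where "y \<in> Y_set k" "z \<in> XY_set n k" "z \<noteq> y" "q = endoF n k (conj_by y z True)"
    unfolding K_generators_def by blast
  then show "q \<in> Y_multiplications n k \<union> KIA_generators n k"
  proof cases
    case (1 x y)
    then show ?thesis unfolding Y_multiplications_def by blast
  next
    case (2 x y)
    then have "q = C_aut n k x y" using X_neq_Y[OF 2(1,2)] by (simp add: C_aut_eq)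
    then show ?thesis
      using 2 X_neq_Y[OF 2(1,2)] X_in[OF 2(1), of k] unfolding KIA_generators_def by blast
  next
    case (3 y z)
    then have "q = C_aut n k y z" by (simp add: C_aut_eq)
    then show ?thesis using 3 unfolding KIA_generators_def by blast
  qed
qed

theorem theorem1:
  fixes n k :: nat
  shows "finite (KIA_generators n k) \<and>
    generate (AutoGroup (F n k)) (KIA_generators n k) = KIA_set n k"
proof (intro conjI equalityI)
  show "finite (KIA_generators n k)" by (rule finite_KIA_generators)
  show sub: "generate (AF n k) (KIA_generators n k) \<subseteq> KIA_set n k"
    by (rule group.generate_subgroup_incl[OF group_AG KIA_generators_in_KIA subgroup_KIA_set])
  show "KIA_set n k \<subseteq> generate (AF n k) (KIA_generators n k)"
  proof
    fix f assume f: "f \<in> KIA_set n k"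
    then have "f \<in> generate (AF n k) (K_generators n k)"
      using K_set_generated by (auto simp: KIA_set_def)
    then have "f \<in> generate (AF n k) (Y_multiplications n k \<union> KIA_generators n k)"
      using group.mono_generate[OF group_AG K_generators_split] by blast
    moreover have "Y_multiplications n k \<subseteq> carrier (AF n k)" "KIA_generators n k \<subseteq> carrier (AF n k)"
      using Y_multiplications_auto KIA_generators_auto by simp_all
    ultimately obtain m t where m: "m \<in> generate (AF n k) (Y_multiplications n k)"
      and t: "t \<in> generate (AF n k) (KIA_generators n k)" and fmt: "f = m \<otimes>\<^bsub>AF n k\<^esub> t"
      and mt: "f \<otimes>\<^bsub>AF n k\<^esub> inv\<^bsub>AF n k\<^esub> t = m"
      using generate_Un_decomp[OF group_AG _ _ Y_multiplications_inv Y_multiplications_normalize] by blast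
    have tK: "t \<in> KIA_set n k" using t sub by blast
    have "m \<in> KIA_set n k"
      using subgroup.m_closed[OF subgroup_KIA_set f subgroup.m_inv_closed[OF subgroup_KIA_set tK]] mt by simp
    then have "m \<in> generate (AF n k) (KIA_generators n k)"
      by (intro Y_multiplications_IA[OF m]) (simp add: KIA_set_def)
    then show "f \<in> generate (AF n k) (KIA_generators n k)"
      unfolding fmt using t by (rule generate.eng)
  qed
qed

end
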